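(* Assume there exists a barrier digit $b$. Then $f_H(\alpha)=\hat\tau^*(\alpha)$ for every $\alpha\in(\underline{\alpha},\alpha^* )$, where $f_H(\alpha)=\dim_H\{x\in\operatorname{supp}\mu:\dim\mu(x)=\alpha\}$ and $\hat\tau^*(\alpha)=\inf_{q\in\mathbb R}(q\alpha-\hat\tau(q))$ is the Legendre transform of $\hat\tau$.
   Context: Fix integers $d\ge 3$ and $m\ge d$ and a probability vector $\mathbf p=(p_0,\dots,p_m)$ with all $p_i>0$ which is regular, normalized so that $p_0\le p_m\le p_i$ for all $1\le i\le m-1$. Let $\mathcal A=\{0,\dots,m\}$; $\mathcal A^k$ is the set of words of length $k$, $\mathcal A^*=\bigcup_{k\ge0}\mathcal A^k$, $\mathcal A^{\mathbb N}$ the set of infinite sequences; $|\sigma|$ is the length of $\sigma$, $\sigma_j$ its $j$-th letter; $(\sigma,\sigma')$ denotes concatenation. Put $\delta=-1/\log d$ and $\xi=m/(d-1)$. Define $\pi(\sigma)=\sum_{i}\sigma_i d^{-i}$ for finite or infinite words. Let $\mu$ be the unique compactly supported Borel probability measure with $\mu(A)=\sum_{i=0}^m p_i\,\mu(dA-i)$ for all Borel $A$; its support is $[0,\xi]$. For $\sigma\in\mathcal A^k$ let $\mathbf p(\sigma)=\prod_{j=1}^k p_{\sigma_j}$ and $\eta(\sigma)=\sum\{\mathbf p(\sigma'):\sigma'\in\mathcal A^k,\ \pi(\sigma')=\pi(\sigma)\}$. For each $k$, $\Xi_k\subset\mathcal A^k$ is a fixed set containing exactly one word from each nonempty class $\{\sigma\in\mathcal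 A^k:\pi(\sigma)=s\}$. Let $a=1+\lfloor (m-d)/(d-1)\rfloor$, set $p_j=0$ for $j\notin\mathcal A$, and let $M_i$ ($i\in\mathcal A$) be the $(2a+1)\times(2a+1)$ matrix indexed by $\{-a,\dots,a\}^2$ with $M_i(k,l)=p_{k+i-ld}$; $M(\sigma)=M_{\sigma_k}\cdots M_{\sigma_1}$; $\rho$ is spectral radius and $\tilde\rho(\mathcal M)=\limsup_{k}\left(\sup\{\rho(A_1\cdots A_k):A_i\in\mathcal M\}\right)^{1/k}$. Set $\underline{\alpha}=\delta\log\tilde\rho(M_0,\dots,M_m)$ and $\alpha^*=\delta\log\inf\{\rho(M(\sigma))^{1/|\sigma|}:\sigma\in\mathcal A^*,\ \sigma_1\notin\{0,m\}\}$. A digit $b\in\mathcal A$ is a barrier digit if for every $\omega\in\mathcal A^{\mathbb N}$ with $\omega_1=b$ one has $\pi(\omega)-1<0<\xi<\pi(\omega)+1$. Given a barrier digit $b$, $\hat\tau(q)=\lim_{k\to\infty}\delta k^{-1}\log\sum_{\sigma\in\Xi_{k-1}}\eta(b,\sigma)^q$ (this limit exists for all $q$). Local dimension $\dim\mu(x)=\lim_{r\to0^+}\log\mu(B(x,r))/\log r$ when it exists; $\dim_H$ is Hausdorff dimension, with $\dim_H\varnothing=-\infty$. *)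

theory Defs
  imports "HOL-Analysis.Analysis" "Jordan_Normal_Form.Spectral_Radius"
begin

text \<open>Words over the alphabet {0..m}; letter sigma_j (j from 1) is the list entry at index j-1.\<close>
definition words :: "nat \<Rightarrow> nat \<Rightarrow> nat list set" where
  "words m k = {\<sigma>. length \<sigma> = k \<and> set \<sigma> \<subseteq> {0..m}}"

definition piw :: "nat \<Rightarrow> nat list \<Rightarrow> real" where
  "piw d \<sigma> = (\<Sum>j<length \<sigma>. real (\<sigma> ! j) / real d ^ (Suc j))"

text \<open>Infinite words are sequences; omega_1 is omega 0.\<close>
definition piinf :: "nat \<Rightarrow> (nat \<Rightarrow> nat) \<Rightarrow> real" where
  "piinf d \<omega> = (\<Sum>j. real (\<omega> j) / real d ^ (Suc j))"

definition pw :: "(nat \<Rightarrow> real) \<Rightarrow> nat list \<Rightarrow> real" where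
  "pw p \<sigma> = prod_list (map p \<sigma>)"

definition eta :: "nat \<Rightarrow> nat \<Rightarrow> (nat \<Rightarrow> real) \<Rightarrow> nat list \<Rightarrow> real" where
  "eta d m p \<sigma> = (\<Sum>\<sigma>'\<in>{\<sigma>' \<in> words m (length \<sigma>). piw d \<sigma>' = piw d \<sigma>}. pw p \<sigma>')"

definition xi :: "nat \<Rightarrow> nat \<Rightarrow> real" where
  "xi d m = real m / (real d - 1)"

definition barrier_digit :: "nat \<Rightarrow> nat \<Rightarrow> nat \<Rightarrow> bool" where
  "barrier_digit d m b \<longleftrightarrow> b \<le> m \<and>
     (\<forall>\<omega>. (\<forall>j. \<omega> j \<le> m) \<and> \<omega> 0 = b \<longrightarrow>
        piinf d \<omega> - 1 < 0 \<and> 0 < xi d m \<and> xi d m < piinf d \<omega> + 1)"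

definition representatives :: "nat \<Rightarrow> nat \<Rightarrow> (nat \<Rightarrow> nat list set) \<Rightarrow> bool" where
  "representatives d m \<Xi> \<longleftrightarrow> (\<forall>k. \<Xi> k \<subseteq> words m k \<and>
      (\<forall>\<sigma>\<in>words m k. \<exists>!\<sigma>'. \<sigma>' \<in> \<Xi> k \<and> piw d \<sigma>' = piw d \<sigma>))"

definition tau_hat :: "nat \<Rightarrow> nat \<Rightarrow> (nat \<Rightarrow> real) \<Rightarrow> (nat \<Rightarrow> nat list set) \<Rightarrow> nat \<Rightarrow> real \<Rightarrow> real" where
  "tau_hat d m p \<Xi> b q = lim (\<lambda>k. (- 1 / ln (real d)) * (1 / real k) *
       ln (\<Sum>\<sigma>\<in>\<Xi> (k - 1). eta d m p (b # \<sigma>) powr q))"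

definition aa :: "nat \<Rightarrow> nat \<Rightarrow> int" where
  "aa d m = 1 + \<lfloor>(real m - real d) / (real d - 1)\<rfloor>"

definition pz :: "nat \<Rightarrow> (nat \<Rightarrow> real) \<Rightarrow> int \<Rightarrow> real" where
  "pz m p j = (if 0 \<le> j \<and> j \<le> int m then p (nat j) else 0)"

text \<open>Row/column index r in {0..2a} corresponds to k = r - a in {-a..a}.\<close>
definition Mi :: "nat \<Rightarrow> nat \<Rightarrow> (nat \<Rightarrow> real) \<Rightarrow> nat \<Rightarrow> complex mat" where
  "Mi d m p i = mat (2 * nat (aa d m) + 1) (2 * nat (aa d m) + 1)
     (\<lambda>(r, c). complex_of_real
        (pz m p ((int r - aa d m) + int i - (int c - aa d m) * int d)))"

definition Mw :: "nat \<Rightarrow> nat \<Rightarrow> (nat \<Rightarrow> real) \<Rightarrow> nat list \<Rightarrow> complex mat" where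
  "Mw d m p \<sigma> = foldl (\<lambda>A x. Mi d m p x * A) (1\<^sub>m (2 * nat (aa d m) + 1)) \<sigma>"

text \<open>joint spectral radius tilde rho(M_0,...,M_m): products of k matrices from the set are exactly M(sigma), |sigma| = k\<close>
definition jsr :: "nat \<Rightarrow> nat \<Rightarrow> (nat \<Rightarrow> real) \<Rightarrow> ereal" where
  "jsr d m p = limsup (\<lambda>k. ereal ((Max (spectral_radius ` Mw d m p ` words m k)) powr (1 / real k)))"

text \<open>delta * log x, with the conventions log 0 = -infinity, log infinity = infinity\<close>
definition delta_log :: "nat \<Rightarrow> ereal \<Rightarrow> ereal" where
  "delta_log d x = (if x = 0 then PInfty else if x = PInfty then MInfty
                    else ereal (- ln (real_of_ereal x) / ln (real d)))"

definition alpha_low :: "nat \<Rightarrow> nat \<Rightarrow> (nat \<Rightarrow> real) \<Rightarrow> ereal" where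
  "alpha_low d m p = delta_log d (jsr d m p)"

definition alpha_star :: "nat \<Rightarrow> nat \<Rightarrow> (nat \<Rightarrow> real) \<Rightarrow> ereal" where
  "alpha_star d m p = delta_log d (ereal (Inf
     {spectral_radius (Mw d m p \<sigma>) powr (1 / real (length \<sigma>)) | \<sigma>.
        \<sigma> \<noteq> [] \<and> set \<sigma> \<subseteq> {0..m} \<and> hd \<sigma> \<notin> {0, m}}))"

definition msupport :: "real measure \<Rightarrow> real set" where
  "msupport \<mu> = {x. \<forall>e>0. emeasure \<mu> (ball x e) > 0}"

definition has_local_dim :: "real measure \<Rightarrow> real \<Rightarrow> real \<Rightarrow> bool" where
  "has_local_dim \<mu> x \<alpha> \<longleftrightarrow> ((\<lambda>r. ln (measure \<mu> (ball x r)) / ln r) \<longlongrightarrow> \<alpha>) (at_right 0)"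

text \<open>Hausdorff measure and dimension on the real line (diam(emptyset)^s = 0, diam(U)^0 = 1 for nonempty U).\<close>
definition hcontent :: "real \<Rightarrow> real set \<Rightarrow> real" where
  "hcontent s U = (if U = {} then 0 else if s = 0 then 1 else diameter U powr s)"

definition hausdorff_measure :: "real \<Rightarrow> real set \<Rightarrow> ennreal" where
  "hausdorff_measure s E = (SUP \<delta>\<in>{0<..}. INF U\<in>{U :: nat \<Rightarrow> real set.
       E \<subseteq> (\<Union>i. U i) \<and> (\<forall>i. bounded (U i) \<and> diameter (U i) \<le> \<delta>)}.
       (\<Sum>i. ennreal (hcontent s (U i))))"

definition hausdorff_dim :: "real set \<Rightarrow> ereal" where
  "hausdorff_dim E = (if E = {} then MInfty
     else ereal (Inf {s. 0 \<le> s \<and> hausdorff_measure s E = 0}))"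

end

theory Submission
  imports Defs
begin

text \<open>A barrier digit stops carries: words with the same value that carry a barrier digit at some
  position have prefixes of equal value and suffixes of equal value, so the weights of values are
  multiplicative across it. Hence the partition sums \<open>Z k q\<close> over values of words beginning with \<open>b\<close>
  are supermultiplicative, and their exponential growth rate \<open>P q\<close> equals \<open>- tau_hat q * ln d\<close>.

  With \<open>D\<close> the logarithm of a weight normalised at level \<open>\<alpha>\<close>, the Legendre transform is governed by
  the sums of \<open>exp (q * D)\<close>. The hypotheses on \<open>\<alpha>\<close> imply that \<open>D\<close> takes both signs. At the
  critical point of such a sum, Chebyshev's inequality gives many concatenations with small \<open>\<bar>D\<bar>\<close>;
  appending fixed correcting blocks turns them into two equally large alphabets with \<open>D \<ge> 0\<close> and
  \<open>D \<le> 0\<close>. Choosing the alphabet according to the sign of the accumulated \<open>D\<close> builds a Cantor set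
  of points of local dimension exactly \<open>\<alpha>\<close>, and reading digits maps it onto the unit interval in a
  Hoelder continuous way, which bounds its dimension from below. For the upper bound one counts
  cells of large (for \<open>q \<ge> 0\<close>) or small (for \<open>q < 0\<close>) weight, in the second case away from the
  endpoints of the support.\<close>

section \<open>Words, values and multiplicities\<close>

text \<open>Because \<open>m \<ge> d\<close>, a value can have many words and cells of one level
  overlap, so a suffix may borrow from or carry into its prefix. The barrier inequalities force
  \<open>\<xi> < 2\<close>, which leaves only the carries -1, 0 and 1 and makes the matrices 3 by 3.
  \<open>P\<close> is only a limit, so the critical \<open>q\<close> is taken at a finite length
  \<open>N\<close>, where the sum is smooth in \<open>q\<close>. This \<open>q\<close> depends on
  \<open>N\<close> and is not known in advance; hence \<open>ln (g N q)\<close> must be bounded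
  below by \<open>c * real N\<close> for all \<open>q\<close> at once, for any \<open>c\<close>
  below every \<open>\<Lambda> q\<close>. The two alphabets have equal size so that a choice
  depending on the past leaves the coding by base-\<open>n\<close> digits intact.
  \<open>tau_hat\<close> sees only words beginning with \<open>b\<close>, the level set all points.
  For \<open>q \<ge> 0\<close>, prepending \<open>b\<close> loses a bounded factor. For
  \<open>q < 0\<close> a prefix can be compared with \<open>b\<close> only if its value and both
  neighbouring values have weight bounded below, which fails at the ends of the support. Exhausting
  the interior by countably many pieces makes the constants harmless, since Hausdorff null sets are
  closed under countable unions.\<close>

fun val :: "nat \<Rightarrow> nat list \<Rightarrow> int" where
  "val d [] = 0"
| "val d (x # xs) = int x * int d ^ length xs + val d xs"

text \<open>The largest value of a word of length \<open>k\<close>, attained by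
  \<open>m, ..., m\<close>.\<close>

definition Lv :: "nat \<Rightarrow> nat \<Rightarrow> nat \<Rightarrow> int" where
  "Lv d m k = (\<Sum>j<k. int m * int d ^ j)"

text \<open>This is \<open>eta\<close> as a function of the value, with values scaled by
  \<open>d ^ k\<close> to integers. Taking \<open>n\<close> over all integers, with weight 0 out of
  range, lets carries be written as plain shifts of \<open>n\<close>.\<close>

definition H :: "nat \<Rightarrow> nat \<Rightarrow> (nat \<Rightarrow> real) \<Rightarrow> nat \<Rightarrow> int \<Rightarrow> real" where
  "H d m p k n = (\<Sum>\<sigma> | \<sigma> \<in> words m k \<and> val d \<sigma> = n. pw p \<sigma>)"

lemma val_append: "val d (u @ v) = val d u * int d ^ length v + val d v"
  by (induction u) (auto simp: algebra_simps power_add)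

lemma piw_val:
  assumes "d > 0"
  shows "piw d \<sigma> = real_of_int (val d \<sigma>) / real d ^ length \<sigma>"
proof (induction \<sigma>)
  case Nil
  then show ?case by (simp add: piw_def)
next
  case (Cons x xs)
  have "piw d (x # xs) = real x / real d + piw d xs / real d"
    unfolding piw_def length_Cons sum.lessThan_Suc_shift by (simp add: sum_divide_distrib field_simps)
  also have "\<dots> = real_of_int (val d (x # xs)) / real d ^ length (x # xs)"
    using assms Cons by (simp add: field_simps)
  finally show ?case .
qed

lemma words_0 [simp]: "words m 0 = {[]}"
  by (auto simp: words_def)

lemma words_Suc: "words m (Suc k) = (\<lambda>(x, xs). x # xs) ` ({0..m} \<times> words m k)"
proof -
  have "\<sigma> \<in> (\<lambda>(x, xs). x # xs) ` ({0..m} \<times> words m k)" if "\<sigma> \<in> words m (Suc k)" for \<sigma>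
    using that by (cases \<sigma>) (auto simp: words_def)
  then show ?thesis by (auto simp: words_def)
qed

lemma finite_words [simp]: "finite (words m k)"
  by (induction k) (auto simp: words_Suc)

lemma words_append: "words m (j + k) = (\<lambda>(u, v). u @ v) ` (words m j \<times> words m k)"
proof -
  have "\<sigma> \<in> (\<lambda>(u, v). u @ v) ` (words m j \<times> words m k)" if "\<sigma> \<in> words m (j + k)" for \<sigma>
  proof -
    have "\<sigma> = take j \<sigma> @ drop j \<sigma>" by simp
    moreover have "take j \<sigma> \<in> words m j" "drop j \<sigma> \<in> words m k"
      using that by (auto simp: words_def dest: in_set_takeD in_set_dropD)
    ultimately show ?thesis by (metis (no_types, lifting) SigmaI case_prod_conv image_eqI)
  qed
  then show ?thesis by (fastforce simp: words_def)
qed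

lemma Lv_0 [simp]: "Lv d m 0 = 0"
  by (simp add: Lv_def)

lemma Lv_Suc: "Lv d m (Suc k) = int m * int d ^ k + Lv d m k"
  by (simp add: Lv_def)

lemma Lv_Suc': "Lv d m (Suc k) = int d * Lv d m k + int m"
  unfolding Lv_def sum.lessThan_Suc_shift by (simp add: sum_distrib_left algebra_simps)

lemma Lv_add: "Lv d m (j + k) = Lv d m j * int d ^ k + Lv d m k"
  by (induction j) (auto simp: Lv_Suc algebra_simps power_add)

lemma Lv_closed: "(int d - 1) * Lv d m k = int m * (int d ^ k - 1)"
  by (induction k) (auto simp: Lv_Suc algebra_simps)

lemma Lv_nonneg: "0 \<le> Lv d m k"
  unfolding Lv_def by (intro sum_nonneg) auto

lemma val_range:
  assumes "\<sigma> \<in> words m k"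
  shows "0 \<le> val d \<sigma>" "val d \<sigma> \<le> Lv d m k"
proof -
  have "0 \<le> val d \<sigma> \<and> val d \<sigma> \<le> Lv d m k"
    using assms
  proof (induction k arbitrary: \<sigma>)
    case (Suc k)
    obtain x xs where "\<sigma> = x # xs" "x \<le> m" "xs \<in> words m k" "length xs = k"
      using Suc.prems by (auto simp: words_Suc) (auto simp: words_def)
    moreover have "int x * int d ^ k \<le> int m * int d ^ k"
      using \<open>x \<le> m\<close> by (intro mult_right_mono) auto
    ultimately show ?case using Suc.IH[of xs] by (auto simp: Lv_Suc)
  qed auto
  then show "0 \<le> val d \<sigma>" "val d \<sigma> \<le> Lv d m k" by auto
qed

text \<open>The values of length \<open>k\<close> fill an interval of integers. The last letter is
  \<open>n mod d\<close>, a letter since \<open>d \<le> m + 1\<close>, unless the quotient is too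
  large for length \<open>k\<close>; then the prefix \<open>m, ..., m\<close> is used and the rest
  of \<open>n\<close> fits into one letter.\<close>

lemma val_surj:
  assumes "d > 0" "d \<le> m + 1" "0 \<le> n" "n \<le> Lv d m k"
  shows "\<exists>\<sigma>\<in>words m k. val d \<sigma> = n"
  using assms(3,4)
proof (induction k arbitrary: n)
  case (Suc k)
  have "\<exists>q i. 0 \<le> q \<and> q \<le> Lv d m k \<and> i \<le> m \<and> n = int d * q + int i"
  proof (cases "n div int d \<le> Lv d m k")
    case True
    have "n mod int d < int d" using assms(1) by simp
    then have "nat (n mod int d) \<le> m" using assms(2) by linarith
    moreover have "n = int d * (n div int d) + int (nat (n mod int d))" using assms(1) by simp
    moreover have "0 \<le> n div int d" using Suc.prems by (simp add: pos_imp_zdiv_nonneg_iff assms(1))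
    ultimately show ?thesis using True by blast
  next
    case False
    then have "int d * Lv d m k \<le> int d * (n div int d)" by (intro mult_left_mono) auto
    also have "\<dots> \<le> n" using assms(1)
      by (smt (verit) mult_div_mod_eq of_nat_0_less_iff pos_mod_sign)
    finally have 1: "int d * Lv d m k \<le> n" .
    have "nat (n - int d * Lv d m k) \<le> m" using Suc.prems by (simp add: Lv_Suc')
    then show ?thesis using 1 Lv_nonneg[of d m k]
      by (intro exI[of _ "Lv d m k"] exI[of _ "nat (n - int d * Lv d m k)"]) auto
  qed
  then obtain q i where qi: "0 \<le> q" "q \<le> Lv d m k" "i \<le> m" "n = int d * q + int i" by blast
  then obtain \<sigma> where \<sigma>: "\<sigma> \<in> words m k" "val d \<sigma> = q" using Suc.IH by blast
  have "\<sigma> @ [i] \<in> words m (Suc k)" using \<sigma>(1) qi(3) by (auto simp: words_def)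
  moreover have "val d (\<sigma> @ [i]) = n" using \<sigma>(2) qi(4) by (simp add: val_append)
  ultimately show ?case by blast
qed auto

lemma pw_Nil [simp]: "pw p [] = 1" and pw_Cons [simp]: "pw p (x # xs) = p x * pw p xs"
  by (auto simp: pw_def)

lemma pw_append: "pw p (u @ v) = pw p u * pw p v"
  by (simp add: pw_def)

lemma eta_H:
  assumes "d > 0"
  shows "eta d m p \<sigma> = H d m p (length \<sigma>) (val d \<sigma>)"
proof -
  have "{\<sigma>' \<in> words m (length \<sigma>). piw d \<sigma>' = piw d \<sigma>} = {\<sigma>' \<in> words m (length \<sigma>). val d \<sigma>' = val d \<sigma>}"
    using assms by (auto simp: piw_val words_def)
  then show ?thesis unfolding eta_def H_def by simp
qed

lemma sum_pw_words:
  shows "(\<Sum>\<sigma>\<in>words m k. pw p \<sigma> * F (val d \<sigma>)) = (\<Sum>i=0..Lv d m k. H d m p k i * F i)"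
proof -
  have "(\<Sum>i=0..Lv d m k. H d m p k i * F i)
     = (\<Sum>i=0..Lv d m k. \<Sum>\<sigma> | \<sigma> \<in> words m k \<and> val d \<sigma> = i. pw p \<sigma> * F (val d \<sigma>))"
    unfolding H_def sum_distrib_right by (intro sum.cong refl) auto
  also have "\<dots> = (\<Sum>\<sigma>\<in>words m k. pw p \<sigma> * F (val d \<sigma>))"
    by (intro sum.group) (auto dest: val_range)
  finally show ?thesis by simp
qed

lemma H_words_append:
  "H d m p (j + k) n = (\<Sum>u\<in>words m j. pw p u * H d m p k (n - val d u * int d ^ k))"
proof -
  have inj: "inj_on (\<lambda>(u, v). u @ v) (words m j \<times> words m k)"
    by (auto simp: inj_on_def words_def)
  have "H d m p (j + k) n = (\<Sum>\<sigma>\<in>words m (j + k). if val d \<sigma> = n then pw p \<sigma> else 0)"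
    unfolding H_def by (rule sum.mono_neutral_cong_left) auto
  also have "\<dots> = (\<Sum>(u, v)\<in>words m j \<times> words m k. if val d (u @ v) = n then pw p (u @ v) else 0)"
    unfolding words_append by (subst sum.reindex[OF inj]) (auto intro!: sum.cong)
  also have "\<dots> = (\<Sum>u\<in>words m j. \<Sum>v\<in>words m k. if val d (u @ v) = n then pw p (u @ v) else 0)"
    by (simp add: sum.cartesian_product)
  also have "\<dots> = (\<Sum>u\<in>words m j. pw p u * H d m p k (n - val d u * int d ^ k))"
  proof (rule sum.cong[OF refl])
    fix u assume "u \<in> words m j"
    have "pw p u * H d m p k (n - val d u * int d ^ k)
       = (\<Sum>v\<in>words m k. if val d v = n - val d u * int d ^ k then pw p u * pw p v else 0)"
      unfolding H_def sum_distrib_left by (rule sum.mono_neutral_cong_left) auto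
    also have "\<dots> = (\<Sum>v\<in>words m k. if val d (u @ v) = n then pw p (u @ v) else 0)"
      by (rule sum.cong) (auto simp: val_append pw_append words_def)
    finally show "(\<Sum>v\<in>words m k. if val d (u @ v) = n then pw p (u @ v) else 0)
      = pw p u * H d m p k (n - val d u * int d ^ k)"
      by simp
  qed
  finally show ?thesis .
qed

text \<open>Cutting words after \<open>j\<close> letters makes the weights a convolution, in which
  the prefix value \<open>i\<close> is scaled by \<open>d ^ k\<close>.\<close>

lemma H_add:
  "H d m p (j + k) n = (\<Sum>i=0..Lv d m j. H d m p j i * H d m p k (n - i * int d ^ k))"
  unfolding H_words_append using sum_pw_words[where F = "\<lambda>i. H d m p k (n - i * int d ^ k)"] by simp

lemma H_outside: "n < 0 \<or> n > Lv d m k \<Longrightarrow> H d m p k n = 0"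
  unfolding H_def using val_range[of _ m k d] by (intro sum.neutral) fastforce

lemma H_0: "H d m p 0 n = (if n = 0 then 1 else 0)"
proof -
  have "{\<sigma>. \<sigma> \<in> words m 0 \<and> val d \<sigma> = n} = (if n = 0 then {[]} else {})" by auto
  then show ?thesis by (simp add: H_def)
qed

lemma H_1: "H d m p 1 n = pz m p n"
proof (cases "0 \<le> n \<and> n \<le> int m")
  case True
  have "{\<sigma>. \<sigma> \<in> words m 1 \<and> val d \<sigma> = n} = {[nat n]}"
    using True by (auto simp: words_Suc)
  then show ?thesis using True by (simp add: H_def pz_def)
next
  case False
  then show ?thesis using H_outside[of n d m 1 p] by (auto simp: pz_def Lv_Suc)
qed

text \<open>The two inequalities are the barrier condition for the extreme words \<open>b, m, m, \<dots>\<close> and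
  \<open>b, 0, 0, \<dots>\<close>, cleared of denominators.\<close>

locale barrier_system =
  fixes d m b :: nat and p :: "nat \<Rightarrow> real"
  assumes d3: "d \<ge> 3" and md: "m \<ge> d"
    and ppos: "\<forall>i\<le>m. p i > 0" and psum: "(\<Sum>i\<le>m. p i) = 1"
    and bar1: "(int d - 1) * int b + int m < int d * (int d - 1)"
    and bar2: "int m * int d < (int b + int d) * (int d - 1)"
begin

text \<open>Adding the two barrier inequalities cancels \<open>b\<close>. This is the inequality
  \<open>\<xi> < 2\<close>.\<close>

lemma m_less: "int m < 2 * (int d - 1)"
proof -
  have "int m * (int d + 1) < 2 * int d * (int d - 1)" using bar1 bar2 by (simp add: algebra_simps)
  also have "\<dots> \<le> 2 * (int d - 1) * (int d + 1)" using d3 by (simp add: algebra_simps)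
  finally show ?thesis by (simp add: mult_less_cancel_right)
qed

lemma b_upper: "int b + 1 < int d"
proof -
  have "(int d - 1) * int b < int d * (int d - 1) - int d" using bar1 md by simp
  also have "\<dots> \<le> (int d - 1) * (int d - 1)" by (simp add: algebra_simps)
  finally have "int b < int d - 1" using d3 by (simp add: mult_less_cancel_left)
  then show ?thesis by simp
qed

lemma b_pos: "b \<ge> 1"
proof (rule ccontr)
  assume "\<not> b \<ge> 1"
  then have "b = 0" by simp
  then have "int m * int d < int d * (int d - 1)" using bar2 by simp
  then have "int m < int d - 1" using d3 by (simp add: mult.commute mult_less_cancel_left)
  then show False using md by simp
qed

lemma b_le: "b + 1 \<le> m"
  using b_upper md by linarith

abbreviation "L \<equiv> Lv d m"
abbreviation "h \<equiv> H d m p"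

lemma dpos [simp]: "d > 0" "d \<noteq> 0" "real d > 0" "int d > 0"
  using d3 by auto

lemma L_le: "L k \<le> 2 * int d ^ k - 2"
proof -
  have "(int d - 1) * L k \<le> 2 * (int d - 1) * (int d ^ k - 1)"
    unfolding Lv_closed using m_less by (intro mult_right_mono) auto
  then have "(int d - 1) * L k \<le> (int d - 1) * (2 * int d ^ k - 2)" by (simp add: algebra_simps)
  then show ?thesis using d3 by (simp add: mult_le_cancel_left)
qed

lemma L_ge: "int d ^ k \<le> L k + 1"
proof -
  have "(int d - 1) * (int d ^ k - 1) \<le> (int d - 1) * L k"
    unfolding Lv_closed using md by (intro mult_right_mono) auto
  then show ?thesis using d3 by (simp add: mult_le_cancel_left)
qed

definition pmin :: real where "pmin = Min (p ` {..m})"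

lemma pmin_le: "i \<le> m \<Longrightarrow> pmin \<le> p i"
  unfolding pmin_def by (rule Min_le) auto

lemma pmin_pos: "pmin > 0"
  unfolding pmin_def using ppos by (subst Min_gr_iff) auto

lemma pw_pos: "\<sigma> \<in> words m k \<Longrightarrow> pw p \<sigma> > 0"
  using ppos by (induction k arbitrary: \<sigma>) (auto simp: words_Suc)

lemma pw_ge: "\<sigma> \<in> words m k \<Longrightarrow> pw p \<sigma> \<ge> pmin ^ k"
  using pmin_pos pmin_le by (induction k arbitrary: \<sigma>) (auto simp: words_Suc intro!: mult_mono less_imp_le[OF pw_pos] less_imp_le[OF ppos[rule_format]])

lemma sum_pw: "(\<Sum>\<sigma>\<in>words m k. pw p \<sigma>) = 1"
proof (induction k)
  case (Suc k)
  have inj: "inj_on (\<lambda>(x, xs). x # xs) ({0..m} \<times> words m k)"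
    by (auto simp: inj_on_def)
  have "(\<Sum>\<sigma>\<in>words m (Suc k). pw p \<sigma>) = (\<Sum>(x, xs)\<in>{0..m} \<times> words m k. p x * pw p xs)"
    unfolding words_Suc by (subst sum.reindex[OF inj]) (auto intro!: sum.cong)
  also have "\<dots> = (\<Sum>x\<le>m. p x) * (\<Sum>xs\<in>words m k. pw p xs)"
    by (simp add: sum_product sum.cartesian_product atLeast0AtMost)
  finally show ?case using Suc psum by simp
qed auto

lemma h_nonneg: "h k n \<ge> 0"
  unfolding H_def using pw_pos less_imp_le by (intro sum_nonneg) blast

lemma h_le1: "h k n \<le> 1"
  unfolding H_def sum_pw[of k, symmetric] using pw_pos less_imp_le by (intro sum_mono2) auto

lemma h_ge:
  assumes "0 \<le> n" "n \<le> L k"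
  shows "h k n \<ge> pmin ^ k"
proof -
  obtain \<sigma> where \<sigma>: "\<sigma> \<in> words m k" "val d \<sigma> = n"
    using val_surj[of d m n k] md assms by auto
  have "pw p \<sigma> \<le> h k n"
    unfolding H_def by (rule member_le_sum) (use \<sigma> pw_pos less_imp_le in auto)
  then show ?thesis using pw_ge[OF \<sigma>(1)] by linarith
qed

lemma h_pos: "0 \<le> n \<Longrightarrow> n \<le> L k \<Longrightarrow> h k n > 0"
  using h_ge[of n k] pmin_pos by (smt (verit) zero_less_power)

text \<open>By \<open>L_le\<close>, moving \<open>t\<close> by two or more multiples of
  \<open>d ^ k\<close> leaves \<open>0..L k\<close>, so only three prefixes contribute to the
  convolution. The slack of one at both ends of the range of \<open>t\<close> is what the outer rows
  of the matrices need.\<close>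

lemma h_split:
  assumes "-1 \<le> t" "t \<le> L k + 1"
  shows "h (j + k) (i * int d ^ k + t)
    = h j (i - 1) * h k (t + int d ^ k) + h j i * h k t + h j (i + 1) * h k (t - int d ^ k)"
proof -
  let ?F = "\<lambda>l. h j l * h k (i * int d ^ k + t - l * int d ^ k)"
  have dk: "int d ^ k > 0" by simp
  have z: "?F l = 0" if "l \<notin> {i - 1, i, i + 1}" for l
  proof -
    have "l \<noteq> i - 1" "l \<noteq> i" "l \<noteq> i + 1" using that by auto
    then consider "l \<le> i - 2" | "l \<ge> i + 2" by linarith
    then have "i * int d ^ k + t - l * int d ^ k < 0 \<or> i * int d ^ k + t - l * int d ^ k > L k"
    proof cases
      case 1
      then have "2 * int d ^ k \<le> (i - l) * int d ^ k" by (intro mult_right_mono) auto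
      then show ?thesis using L_le[of k] assms by (simp add: algebra_simps)
    next
      case 2
      then have "2 * int d ^ k \<le> (l - i) * int d ^ k" by (intro mult_right_mono) auto
      then show ?thesis using L_le[of k] assms by (simp add: algebra_simps)
    qed
    then show ?thesis by (simp add: H_outside)
  qed
  have "h (j + k) (i * int d ^ k + t) = sum ?F {0..L j}" by (simp add: H_add)
  also have "\<dots> = sum ?F ({0..L j} \<union> {i - 1, i, i + 1})"
    by (rule sum.mono_neutral_left) (auto intro!: H_outside)
  also have "\<dots> = sum ?F {i - 1, i, i + 1}"
    by (rule sum.mono_neutral_right) (use z in auto)
  finally show ?thesis by (simp add: algebra_simps)
qed

text \<open>The set of values of the words of length \<open>k \<ge> 1\<close> that begin with \<open>b\<close>.\<close>

definition X :: "nat \<Rightarrow> int set" where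
  "X k = {int b * int d ^ (k - 1) .. int b * int d ^ (k - 1) + L (k - 1)}"

lemma finite_X [simp]: "finite (X k)"
  by (simp add: X_def)

text \<open>The last two bounds are the barrier: adding or subtracting \<open>d ^ k\<close> pushes
  \<open>w\<close> out of \<open>0..L k\<close>. They come from \<open>bar1\<close> and
  \<open>bar2\<close> at the largest and the smallest value of a word beginning with
  \<open>b\<close>.\<close>

lemma X_bounds:
  assumes "k \<ge> 1" "w \<in> X k"
  shows "0 \<le> w" "w \<le> L k" "w < int d ^ k" "L k < w + int d ^ k"
proof -
  obtain j where k: "k = Suc j" using assms(1) by (cases k) auto
  let ?D = "int d ^ j"
  have D: "?D > 0" by simp
  have w: "int b * ?D \<le> w" "w \<le> int b * ?D + L j" using assms by (auto simp: X_def k)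
  show "0 \<le> w" using w(1) D by (smt (verit) mult_nonneg_nonneg of_nat_0_le_iff)
  have "int b * ?D \<le> int m * ?D" using b_le by (intro mult_right_mono) auto
  then show "w \<le> L k" unfolding k Lv_Suc using w by linarith
  have c: "(int d - 1) * L j = int m * (?D - 1)" by (rule Lv_closed)
  have "(int d - 1) * w \<le> (int d - 1) * (int b * ?D + L j)" using w d3 by (intro mult_left_mono) auto
  also have "\<dots> = ((int d - 1) * int b + int m) * ?D - int m" using c by (simp add: algebra_simps)
  also have "\<dots> < int d * (int d - 1) * ?D"
  proof -
    have "((int d - 1) * int b + int m) * ?D \<le> int d * (int d - 1) * ?D"
      using bar1 by (intro mult_right_mono) auto
    then show ?thesis using md d3 by linarith
  qed
  finally have "(int d - 1) * w < (int d - 1) * int d ^ k" by (simp add: k algebra_simps)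
  then show "w < int d ^ k" using d3 by (simp add: mult_less_cancel_left)
  have "(int d - 1) * L k = int m * (int d * ?D - 1)" unfolding k Lv_closed by simp
  also have "\<dots> < (int m * int d) * ?D" using md d3 by (simp add: algebra_simps)
  also have "\<dots> \<le> ((int b + int d) * (int d - 1)) * ?D" using bar2 by (intro mult_right_mono) auto
  also have "\<dots> = (int d - 1) * (int b * ?D + int d ^ k)" by (simp add: k algebra_simps)
  finally have "L k < int b * ?D + int d ^ k" using d3 by (simp add: mult_less_cancel_left)
  then show "L k < w + int d ^ k" using w by linarith
qed

text \<open>Both carry terms of \<open>h_split\<close> are weights of values out of range.\<close>

lemma h_barrier:
  assumes "k \<ge> 1" "w \<in> X k"
  shows "h (j + k) (i * int d ^ k + w) = h j i * h k w"
  using X_bounds[OF assms] by (simp add: h_split H_outside)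

lemma h_X_pos: "k \<ge> 1 \<Longrightarrow> w \<in> X k \<Longrightarrow> h k w > 0"
  using X_bounds h_pos by blast

lemma X_append:
  assumes "j \<ge> 1" "v \<in> X j" "0 \<le> w" "w \<le> L k"
  shows "v * int d ^ k + w \<in> X (j + k)"
proof -
  obtain i where j: "j = Suc i" using assms(1) by (cases j) auto
  have "int b * int d ^ i \<le> v" "v \<le> int b * int d ^ i + L i" using assms(2) by (auto simp: X_def j)
  then have "(int b * int d ^ i) * int d ^ k \<le> v * int d ^ k"
    "v * int d ^ k \<le> (int b * int d ^ i + L i) * int d ^ k" by (auto intro!: mult_right_mono)
  then have "int b * int d ^ i * int d ^ k \<le> v * int d ^ k + w"
    "v * int d ^ k + w \<le> int b * int d ^ i * int d ^ k + (L i * int d ^ k + L k)"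
    using assms(3,4) unfolding distrib_right by linarith+
  then show ?thesis by (simp add: X_def j Lv_add power_add mult.assoc)
qed

text \<open>Values in \<open>X k\<close> lie below \<open>d ^ k\<close>, so \<open>w\<close> is the
  residue modulo \<open>d ^ k\<close>.\<close>

lemma append_inj:
  assumes "k \<ge> 1" "w \<in> X k" "w' \<in> X k" "i * int d ^ k + w = i' * int d ^ k + w'"
  shows "i = i'" "w = w'"
proof -
  have "w mod int d ^ k = w" "w' mod int d ^ k = w'"
    using X_bounds[OF assms(1,2)] X_bounds[OF assms(1,3)] by auto
  moreover have "(i * int d ^ k + w) mod int d ^ k = w mod int d ^ k"
     "(i' * int d ^ k + w') mod int d ^ k = w' mod int d ^ k" by simp_all
  ultimately show "w = w'" using assms(4) by simp
  then show "i = i'" using assms(4) by simp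
qed

end

section \<open>Matrix products\<close>

context barrier_system
begin

text \<open>By \<open>m_less\<close> the floor in \<open>aa\<close> is 0. Rows and columns 0, 1, 2
  of the matrices then stand for the carries -1, 0, 1.\<close>

lemma aa_1: "aa d m = 1"
proof -
  have "0 \<le> (real m - real d) / (real d - 1)" using md d3 by simp
  moreover have "(real m - real d) / (real d - 1) < 1" using m_less md d3 by (simp add: field_simps)
  ultimately have "\<lfloor>(real m - real d) / (real d - 1)\<rfloor> = 0" by (simp add: floor_eq_iff)
  then show ?thesis by (simp add: aa_def)
qed

lemma Mi_eq: "Mi d m p i = mat 3 3 (\<lambda>(r, c). complex_of_real (h 1 (int r - 1 + int i - (int c - 1) * int d)))"
  unfolding Mi_def aa_1 H_1 by (simp add: numeral_3_eq_3)

lemma Mw_snoc: "Mw d m p (\<sigma> @ [i]) = Mi d m p i * Mw d m p \<sigma>"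
  by (simp add: Mw_def)

text \<open>The column is a carry passed to whatever precedes the word, the row a shift of its value
  caused by what follows. Multiplying by one more \<open>Mi\<close> is \<open>h_split\<close> with a
  suffix of length 1, whose shifted value lies in \<open>-1..L 1 + 1\<close>.\<close>

lemma Mw_eq:
  assumes "set \<sigma> \<subseteq> {0..m}"
  shows "Mw d m p \<sigma> = mat 3 3 (\<lambda>(r, c). complex_of_real
    (h (length \<sigma>) (val d \<sigma> + (int r - 1) - (int c - 1) * int d ^ length \<sigma>)))"
  using assms
proof (induction \<sigma> rule: rev_induct)
  case Nil
  show ?case unfolding Mw_def aa_1
    by (rule eq_matI) (auto simp: H_0 numeral_3_eq_3)
next
  case (snoc i \<sigma>)
  let ?k = "length \<sigma>" let ?n = "val d \<sigma>"
  have IH: "Mw d m p \<sigma> = mat 3 3 (\<lambda>(r, c). complex_of_real (h ?k (?n + (int r - 1) - (int c - 1) * int d ^ ?k)))"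
    using snoc by simp
  have i: "i \<le> m" using snoc.prems by simp
  let ?R = "mat 3 3 (\<lambda>(r, c). complex_of_real (h (length (\<sigma> @ [i]))
    (val d (\<sigma> @ [i]) + (int r - 1) - (int c - 1) * int d ^ length (\<sigma> @ [i]))))"
  show "Mw d m p (\<sigma> @ [i]) = ?R"
  proof (rule eq_matI)
    show "dim_row (Mw d m p (\<sigma> @ [i])) = dim_row ?R" "dim_col (Mw d m p (\<sigma> @ [i])) = dim_col ?R"
      unfolding Mw_snoc IH Mi_eq by simp_all
  next
    fix r c :: nat assume "r < dim_row ?R" "c < dim_col ?R"
    then have rc: "r < 3" "c < 3" by simp_all
    let ?t = "int i + (int r - 1)" let ?N = "?n - (int c - 1) * int d ^ ?k"
    have A: "val d (\<sigma> @ [i]) + (int r - 1) - (int c - 1) * int d ^ length (\<sigma> @ [i]) = ?N * int d ^ 1 + ?t"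
      by (simp add: val_append algebra_simps)
    have B: "h (?k + 1) (?N * int d ^ 1 + ?t) = h ?k (?N - 1) * h 1 (?t + int d ^ 1)
       + h ?k ?N * h 1 ?t + h ?k (?N + 1) * h 1 (?t - int d ^ 1)"
      using i rc by (intro h_split) (auto simp: Lv_Suc)
    have "?R $$ (r, c) = of_real (h (?k + 1) (?N * int d ^ 1 + ?t))"
      using rc by (simp only: index_mat(1) case_prod_conv A) simp
    also have "\<dots> = (\<Sum>j\<in>{0,1,2::nat}. of_real (h 1 (int r - 1 + int i - (int j - 1) * int d)) *
        of_real (h ?k (?n + (int j - 1) - (int c - 1) * int d ^ ?k)))"
      unfolding B by (simp add: algebra_simps)
    also have "{0,1,2::nat} = {0..<3}" by auto
    also have "(\<Sum>j\<in>{0..<3}. of_real (h 1 (int r - 1 + int i - (int j - 1) * int d)) *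
        of_real (h ?k (?n + (int j - 1) - (int c - 1) * int d ^ ?k))) = (Mi d m p i * Mw d m p \<sigma>) $$ (r, c)"
      using rc unfolding Mi_eq IH by (auto simp: scalar_prod_def intro!: sum.cong)
    finally show "Mw d m p (\<sigma> @ [i]) $$ (r, c) = ?R $$ (r, c)" unfolding Mw_snoc by simp
  qed
qed

lemma Mw_carrier [simp]: "set \<sigma> \<subseteq> {0..m} \<Longrightarrow> Mw d m p \<sigma> \<in> carrier_mat 3 3"
  by (simp add: Mw_eq)

lemma Mw_append:
  assumes "set u \<subseteq> {0..m}" "set v \<subseteq> {0..m}"
  shows "Mw d m p (u @ v) = Mw d m p v * Mw d m p u"
  using assms(2)
proof (induction v rule: rev_induct)
  case Nil
  have "Mw d m p [] = 1\<^sub>m 3" by (simp add: Mw_def aa_1 numeral_3_eq_3)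
  then show ?case using Mw_carrier[OF assms(1)] by simp
next
  case (snoc i v)
  have "Mi d m p i \<in> carrier_mat 3 3" by (simp add: Mi_eq)
  then show ?case
    using snoc assms(1) Mw_snoc[of "u @ v" i]
      assoc_mult_mat[OF _ Mw_carrier[of v] Mw_carrier[of u], of "Mi d m p i" 3] by (simp add: Mw_snoc)
qed

lemma Mw_pow:
  assumes "set \<sigma> \<subseteq> {0..m}"
  shows "Mw d m p \<sigma> ^\<^sub>m n = Mw d m p (concat (replicate n \<sigma>))"
proof (induction n)
  case 0
  then show ?case using Mw_carrier[OF assms] by (simp add: Mw_def aa_1 numeral_3_eq_3)
next
  case (Suc n)
  have "set (concat (replicate n \<sigma>)) \<subseteq> {0..m}" using assms by (auto split: if_splits)
  then show ?case using Suc assms by (simp add: Mw_append del: set_concat)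
qed

text \<open>Take an eigenvector for an eigenvalue of maximal modulus, and the row in which its entry
  is largest.\<close>

lemma spectral_radius_row_bound:
  fixes A :: "complex mat"
  assumes A: "A \<in> carrier_mat N N" and N: "N > 0"
  obtains r where "r < N" "spectral_radius A ^ n \<le> (\<Sum>c<N. norm ((A ^\<^sub>m n) $$ (r, c)))"
proof -
  obtain ev where ev: "ev \<in> spectrum A" "spectral_radius A = norm ev"
    using spectral_radius_mem_max(1)[OF A N] by auto
  then obtain v where v: "eigenvector A v ev" by (auto simp: spectrum_def eigenvalue_def)
  then have v': "v \<in> carrier_vec N" "v \<noteq> 0\<^sub>v N" using A by (auto simp: eigenvector_def)
  have pw: "(A ^\<^sub>m n) *\<^sub>v v = ev ^ n \<cdot>\<^sub>v v" using eigenvector_pow[OF A v] .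
  let ?S = "(\<lambda>i. norm (v $ i)) ` {..<N}"
  have "Max ?S \<in> ?S" using N by (intro Max_in) auto
  then obtain r where r: "r < N" "Max ?S = norm (v $ r)" by blast
  have r2: "norm (v $ i) \<le> norm (v $ r)" if "i < N" for i
    unfolding r(2)[symmetric] using that by (intro Max_ge) auto
  have pos: "norm (v $ r) > 0"
  proof (rule ccontr)
    assume "\<not> norm (v $ r) > 0"
    then have "v $ i = 0" if "i < N" for i using r2[OF that] by simp
    then have "v = 0\<^sub>v N" using v'(1) by (intro eq_vecI) auto
    then show False using v'(2) by simp
  qed
  have An: "A ^\<^sub>m n \<in> carrier_mat N N" using A by simp
  have "ev ^ n * v $ r = ((A ^\<^sub>m n) *\<^sub>v v) $ r" using pw r(1) v' by simp
  also have "\<dots> = (\<Sum>c<N. (A ^\<^sub>m n) $$ (r, c) * v $ c)"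
    using carrier_matD[OF An] r(1) carrier_vecD[OF v'(1)] by (simp add: scalar_prod_def atLeast0LessThan)
  finally have "norm (ev ^ n * v $ r) \<le> (\<Sum>c<N. norm ((A ^\<^sub>m n) $$ (r, c) * v $ c))"
    by (simp add: norm_sum)
  also have "\<dots> \<le> (\<Sum>c<N. norm ((A ^\<^sub>m n) $$ (r, c)) * norm (v $ r))"
    using r2 by (intro sum_mono) (auto simp: norm_mult intro!: mult_left_mono)
  finally have "norm ev ^ n * norm (v $ r) \<le> (\<Sum>c<N. norm ((A ^\<^sub>m n) $$ (r, c))) * norm (v $ r)"
    by (simp add: norm_mult norm_power sum_distrib_right)
  then have "spectral_radius A ^ n \<le> (\<Sum>c<N. norm ((A ^\<^sub>m n) $$ (r, c)))"
    using pos ev by simp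
  with r(1) show ?thesis by (rule that)
qed

text \<open>Dividing the matrix by \<open>t\<close> brings its spectral radius below 1, where the
  powers are bounded.\<close>

lemma spectral_radius_entry_bound:
  fixes A :: "complex mat"
  assumes A: "A \<in> carrier_mat N N" and N: "N > 0" and t: "spectral_radius A < t" "t > 0"
  obtains C where "\<And>n i j. i < N \<Longrightarrow> j < N \<Longrightarrow> norm ((A ^\<^sub>m n) $$ (i, j)) \<le> C * t ^ n"
proof -
  let ?c = "complex_of_real (1 / t)" let ?B = "?c \<cdot>\<^sub>m A"
  have B: "?B \<in> carrier_mat N N" using A by simp
  obtain ev where ev: "ev \<in> spectrum ?B" "spectral_radius ?B = norm ev"
    using spectral_radius_mem_max(1)[OF B N] by auto
  then obtain v where v: "v \<in> carrier_vec N" "v \<noteq> 0\<^sub>v N" "?B *\<^sub>v v = ev \<cdot>\<^sub>v v"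
    using A by (auto simp: spectrum_def eigenvalue_def eigenvector_def)
  have "A *\<^sub>v v = (of_real t * ev) \<cdot>\<^sub>v v"
  proof -
    have "A = of_real t \<cdot>\<^sub>m ?B" using t by (auto intro!: eq_matI)
    then have "A *\<^sub>v v = (of_real t \<cdot>\<^sub>m ?B) *\<^sub>v v" by simp
    also have "\<dots> = of_real t \<cdot>\<^sub>v (?B *\<^sub>v v)" using B v(1)
      by (intro eq_vecI) (auto simp: scalar_prod_def sum_distrib_left mult.assoc intro!: sum.cong)
    finally show ?thesis using v(3) by (simp add: smult_smult_assoc)
  qed
  then have "of_real t * ev \<in> spectrum A"
    using v A by (auto simp: spectrum_def eigenvalue_def eigenvector_def)
  then have "norm (of_real t * ev) \<le> spectral_radius A"
    by (intro spectral_radius_mem_max(2)[OF A N] imageI)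
  then have "t * norm ev \<le> spectral_radius A" using t(2) by (simp add: norm_mult)
  then have "t * norm ev < t * 1" using t(1) by linarith
  then have "norm ev < 1" using t(2) by (simp only: mult_less_cancel_left_pos)
  then have "spectral_radius ?B < 1" using ev by simp
  from spectral_radius_jnf_norm_bound_less_1_upper_triangular[OF B this]
  obtain C where C: "\<And>k. norm_bound (?B ^\<^sub>m k) C" by auto
  have pw: "?B ^\<^sub>m k = (?c ^ k) \<cdot>\<^sub>m (A ^\<^sub>m k)" for k
  proof (induction k)
    case 0
    show ?case using A by (auto intro!: eq_matI)
  next
    case (Suc k)
    have Ak: "A ^\<^sub>m k \<in> carrier_mat N N" using A by simp
    have "?B ^\<^sub>m Suc k = ((?c ^ k) \<cdot>\<^sub>m (A ^\<^sub>m k)) * (?c \<cdot>\<^sub>m A)" using Suc by simp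
    also have "\<dots> = (?c ^ Suc k) \<cdot>\<^sub>m (A ^\<^sub>m k * A)"
      unfolding mult_smult_assoc_mat[OF Ak smult_carrier_mat[OF A]] mult_smult_distrib[OF Ak A]
      by (intro eq_matI) auto
    finally show ?case by simp
  qed
  have "norm ((A ^\<^sub>m n) $$ (i, j)) \<le> C * t ^ n" if "i < N" "j < N" for n i j
  proof -
    have "norm ((?B ^\<^sub>m n) $$ (i, j)) \<le> C"
      using C[of n] that A unfolding norm_bound_def by auto
    then show ?thesis using that A t unfolding pw
      by (simp add: norm_mult norm_power norm_divide field_simps power_divide)
  qed
  then show ?thesis by (rule that)
qed

section \<open>Words beginning with \<open>b\<close> of extreme weight, from spectral radii\<close>

lemma spectral_radius_nonneg: "set \<sigma> \<subseteq> {0..m} \<Longrightarrow> spectral_radius (Mw d m p \<sigma>) \<ge> 0"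
  using spectral_radius_mem_max(1)[OF Mw_carrier, of \<sigma>] by auto

lemma concat_replicate_words:
  "\<sigma> \<in> words m k \<Longrightarrow> concat (replicate n \<sigma>) \<in> words m (k * n)"
  by (induction n) (auto simp: words_def)

lemma h_1: "i \<le> m \<Longrightarrow> h 1 (int i) = p i"
  unfolding H_1 by (simp add: pz_def)

lemma h_1_ge: "0 \<le> i \<Longrightarrow> i \<le> int m \<Longrightarrow> h 1 i \<ge> pmin"
  using h_1[of "nat i"] pmin_le[of "nat i"] by simp

lemma b_in_X: "int b \<in> X 1"
  by (simp add: X_def)

lemma X_Cons: "0 \<le> w \<Longrightarrow> w \<le> L k \<Longrightarrow> int b * int d ^ k + w \<in> X (1 + k)"
  using X_append[OF _ b_in_X] by simp

text \<open>Some row sum of the power of the matrix is at least the power of its spectral radius,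
  and consists of the three carry terms of one value. A leading \<open>b\<close> collects all three
  with factor at least \<open>pmin\<close>. A final letter undoes the shift belonging to the row,
  with another factor \<open>pmin\<close>; hence the two extra letters.\<close>

lemma growth_large:
  assumes \<sigma>: "\<sigma> \<in> words m k"
  shows "\<exists>w\<in>X (k * n + 2). h (k * n + 2) w \<ge> pmin\<^sup>2 * spectral_radius (Mw d m p \<sigma>) ^ n"
proof -
  define \<tau> where "\<tau> = concat (replicate n \<sigma>)"
  define K where "K = k * n"
  have \<tau>: "\<tau> \<in> words m K" using concat_replicate_words[OF \<sigma>] by (simp add: \<tau>_def K_def)
  then have len: "length \<tau> = K" and set: "set \<tau> \<subseteq> {0..m}" by (auto simp: words_def)
  have \<sigma>': "set \<sigma> \<subseteq> {0..m}" using \<sigma> by (simp add: words_def)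
  let ?\<rho> = "spectral_radius (Mw d m p \<sigma>)"
  obtain r where r: "r < 3" "?\<rho> ^ n \<le> (\<Sum>c<3. norm ((Mw d m p \<sigma> ^\<^sub>m n) $$ (r, c)))"
    using spectral_radius_row_bound[OF Mw_carrier[OF \<sigma>']] by (metis zero_less_numeral)
  define t where "t = val d \<tau> + (int r - 1)"
  have v: "0 \<le> val d \<tau>" "val d \<tau> \<le> L K" using val_range[OF \<tau>] by auto
  have t: "-1 \<le> t" "t \<le> L K + 1" using v r(1) by (auto simp: t_def)
  have "(\<Sum>c<3. norm ((Mw d m p \<sigma> ^\<^sub>m n) $$ (r, c))) = h K (t + int d ^ K) + h K t + h K (t - int d ^ K)"
    unfolding Mw_pow[OF \<sigma>'] \<tau>_def[symmetric] Mw_eq[OF set] using r(1) h_nonneg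
    by (simp add: numeral_3_eq_3 len t_def)
  with r have rn: "?\<rho> ^ n \<le> h K (t + int d ^ K) + h K t + h K (t - int d ^ K)" by simp
  have "h (1 + K) (int b * int d ^ K + t)
      = h 1 (int b - 1) * h K (t + int d ^ K) + h 1 (int b) * h K t + h 1 (int b + 1) * h K (t - int d ^ K)"
    by (rule h_split[OF t])
  also have "\<dots> \<ge> pmin * h K (t + int d ^ K) + pmin * h K t + pmin * h K (t - int d ^ K)"
    using b_pos b_le h_nonneg by (intro add_mono mult_right_mono h_1_ge) auto
  finally have "h (1 + K) (int b * int d ^ K + t) \<ge> pmin * (h K (t + int d ^ K) + h K t + h K (t - int d ^ K))"
    by (simp add: algebra_simps)
  with rn have 1: "h (1 + K) (int b * int d ^ K + t) \<ge> pmin * ?\<rho> ^ n"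
    using pmin_pos by (smt (verit) mult_left_mono)
  \<comment> \<open>The final letter with which the shifted value extends: \<open>?N * d + 0\<close>
    is also \<open>(?N - 1) * d + d\<close>, and \<open>?N * d + d\<close> is also
    \<open>(?N + 1) * d + 0\<close>. Both 0 and \<open>d\<close> are letters.\<close>
  define i where "i = (if r = 2 then d else 0)"
  let ?N = "int b * int d ^ K + val d \<tau>"
  have i: "i \<le> m" using md by (simp add: i_def)
  have split: "h ((1 + K) + 1) (?N * int d ^ 1 + int i) = h (1 + K) (?N - 1) * h 1 (int i + int d ^ 1)
    + h (1 + K) ?N * h 1 (int i) + h (1 + K) (?N + 1) * h 1 (int i - int d ^ 1)"
    using i by (intro h_split) (auto simp: Lv_Suc)
  have nn: "h j x * h j' y \<ge> 0" for j j' x y using h_nonneg by simp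
  consider "r = 0" | "r = 1" | "r = 2" using r(1) by linarith
  then have "h ((1 + K) + 1) (?N * int d ^ 1 + int i) \<ge> h (1 + K) (int b * int d ^ K + t) * pmin"
  proof cases
    case 1
    then have e: "int b * int d ^ K + t = ?N - 1" by (simp add: t_def)
    have "pmin \<le> h 1 (int i + int d ^ 1)" using 1 md by (intro h_1_ge) (auto simp: i_def)
    then have "h (1 + K) (?N - 1) * pmin \<le> h (1 + K) (?N - 1) * h 1 (int i + int d ^ 1)"
      using h_nonneg by (intro mult_left_mono)
    then show ?thesis
      using nn[of "1 + K" "?N - 1" 1 "int i + int d ^ 1"] nn[of "1 + K" ?N 1 "int i"]
        nn[of "1 + K" "?N + 1" 1 "int i - int d ^ 1"] unfolding split e by linarith
  next
    case 2
    then have e: "int b * int d ^ K + t = ?N" by (simp add: t_def)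
    have "pmin \<le> h 1 (int i)" using 2 md by (intro h_1_ge) (auto simp: i_def)
    then have "h (1 + K) (?N) * pmin \<le> h (1 + K) (?N) * h 1 (int i)"
      using h_nonneg by (intro mult_left_mono)
    then show ?thesis
      using nn[of "1 + K" "?N - 1" 1 "int i + int d ^ 1"] nn[of "1 + K" ?N 1 "int i"]
        nn[of "1 + K" "?N + 1" 1 "int i - int d ^ 1"] unfolding split e by linarith
  next
    case 3
    then have e: "int b * int d ^ K + t = ?N + 1" by (simp add: t_def)
    have "pmin \<le> h 1 (int i - int d ^ 1)" using 3 md by (intro h_1_ge) (auto simp: i_def)
    then have "h (1 + K) (?N + 1) * pmin \<le> h (1 + K) (?N + 1) * h 1 (int i - int d ^ 1)"
      using h_nonneg by (intro mult_left_mono)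
    then show ?thesis
      using nn[of "1 + K" "?N - 1" 1 "int i + int d ^ 1"] nn[of "1 + K" ?N 1 "int i"]
        nn[of "1 + K" "?N + 1" 1 "int i - int d ^ 1"] unfolding split e by linarith
  qed
  moreover have "h (1 + K) (int b * int d ^ K + t) * pmin \<ge> pmin * ?\<rho> ^ n * pmin"
    using 1 pmin_pos by (intro mult_right_mono) auto
  ultimately have "h (K + 2) (?N * int d + int i) \<ge> pmin\<^sup>2 * ?\<rho> ^ n"
    by (simp add: power2_eq_square mult_ac)
  moreover have "?N * int d ^ 1 + int i \<in> X ((1 + K) + 1)"
    using i by (intro X_append X_Cons v) (auto simp: Lv_Suc)
  ultimately show ?thesis unfolding K_def[symmetric] by (auto intro!: bexI[of _ "?N * int d + int i"])
qed

text \<open>With a leading \<open>b\<close>, the weight of the value is at most the sum of the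
  middle row of the power, whose entries are bounded by the spectral radius.\<close>

lemma growth_small:
  assumes \<sigma>: "\<sigma> \<in> words m k" and t: "spectral_radius (Mw d m p \<sigma>) < t" "t > 0"
  shows "\<exists>C. \<forall>n. \<exists>w\<in>X (k * n + 1). h (k * n + 1) w \<le> C * t ^ n"
proof -
  have \<sigma>': "set \<sigma> \<subseteq> {0..m}" using \<sigma> by (simp add: words_def)
  obtain C where C: "\<And>n i j. i < 3 \<Longrightarrow> j < 3 \<Longrightarrow> norm ((Mw d m p \<sigma> ^\<^sub>m n) $$ (i, j)) \<le> C * t ^ n"
    using spectral_radius_entry_bound[OF Mw_carrier[OF \<sigma>'] _ t] by (metis zero_less_numeral)
  have "\<exists>w\<in>X (k * n + 1). h (k * n + 1) w \<le> (3 * C) * t ^ n" for n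
  proof -
    define \<tau> where "\<tau> = concat (replicate n \<sigma>)"
    define K where "K = k * n"
    have \<tau>: "\<tau> \<in> words m K" using concat_replicate_words[OF \<sigma>] by (simp add: \<tau>_def K_def)
    then have len: "length \<tau> = K" and set: "set \<tau> \<subseteq> {0..m}" by (auto simp: words_def)
    let ?t = "val d \<tau>"
    have v: "0 \<le> ?t" "?t \<le> L K" using val_range[OF \<tau>] by auto
    have "\<bar>h K (?t - (int c - 1) * int d ^ K)\<bar> \<le> C * t ^ n" if "c < 3" for c
      using C[of 1 c n] that unfolding Mw_pow[OF \<sigma>'] \<tau>_def[symmetric] Mw_eq[OF set] by (simp add: len)
    from this[of 0] this[of 1] this[of 2]
    have e: "h K (?t + int d ^ K) \<le> C * t ^ n" "h K ?t \<le> C * t ^ n" "h K (?t - int d ^ K) \<le> C * t ^ n" by auto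
    have "h (1 + K) (int b * int d ^ K + ?t)
      = h 1 (int b - 1) * h K (?t + int d ^ K) + h 1 (int b) * h K ?t + h 1 (int b + 1) * h K (?t - int d ^ K)"
      using v by (intro h_split) auto
    also have "\<dots> \<le> 1 * h K (?t + int d ^ K) + 1 * h K ?t + 1 * h K (?t - int d ^ K)"
      using h_nonneg h_le1 by (intro add_mono mult_right_mono) auto
    finally have "h (1 + K) (int b * int d ^ K + ?t) \<le> 3 * C * t ^ n" using e by simp
    then show ?thesis using X_Cons[OF v] by (auto simp: K_def)
  qed
  then show ?thesis by blast
qed

text \<open>That \<open>\<alpha>\<close> exceeds \<open>alpha_low\<close> gives a word whose
  spectral radius beats \<open>d powr (- \<alpha>)\<close> per letter. Repeating the word
  \<open>n\<close> times multiplies this gain by \<open>n\<close>, while \<open>growth_large\<close>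
  costs a fixed constant.\<close>

lemma exists_large:
  assumes "alpha_low d m p < ereal \<alpha>"
  shows "\<exists>k\<ge>1. \<exists>w\<in>X k. ln (h k w) + \<alpha> * real k * ln (real d) > 0"
proof -
  have lnd: "ln (real d) > 0" using d3 by simp
  define x where "x = real d powr (-\<alpha>)"
  have x: "x > 0" by (simp add: x_def)
  let ?f = "\<lambda>k. ereal ((Max (spectral_radius ` Mw d m p ` words m k)) powr (1 / real k))"
  have "0 \<le> jsr d m p" unfolding jsr_def by (rule le_Limsup) auto
  have "ereal x < jsr d m p"
  proof (cases "jsr d m p")
    case (real j)
    then have j: "j > 0" "- ln j / ln (real d) < \<alpha>"
      using \<open>0 \<le> jsr d m p\<close> assms by (auto simp: alpha_low_def delta_log_def split: if_splits)
    then have "- \<alpha> * ln (real d) < ln j" using lnd by (simp add: field_simps)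
    then have "exp (- \<alpha> * ln (real d)) < j" using j(1) by (metis exp_less_mono exp_ln)
    then show ?thesis using real by (simp add: x_def powr_def)
  qed (use \<open>0 \<le> jsr d m p\<close> in auto)
  moreover have "jsr d m p \<le> ereal x" if "\<And>k. k \<ge> 1 \<Longrightarrow> ?f k \<le> ereal x"
    unfolding jsr_def by (rule Limsup_bounded) (rule eventually_at_top_linorderI[of 1], rule that)
  ultimately obtain k where k: "k \<ge> 1" "?f k > ereal x" by (meson not_le)
  have "replicate k 0 \<in> words m k" by (auto simp: words_def)
  then have "Max (spectral_radius ` Mw d m p ` words m k) \<in> spectral_radius ` Mw d m p ` words m k"
    by (intro Max_in) auto
  then obtain \<sigma> where \<sigma>: "\<sigma> \<in> words m k" "spectral_radius (Mw d m p \<sigma>) powr (1 / real k) > x"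
    using k(2) by auto
  define \<rho> where "\<rho> = spectral_radius (Mw d m p \<sigma>)"
  have "set \<sigma> \<subseteq> {0..m}" using \<sigma>(1) by (simp add: words_def)
  then have "\<rho> \<ge> 0" unfolding \<rho>_def by (rule spectral_radius_nonneg)
  have \<rho>: "\<rho> > 0" using \<sigma>(2) x \<open>\<rho> \<ge> 0\<close> by (cases "\<rho> = 0") (auto simp: \<rho>_def)
  have "ln x < ln (\<rho> powr (1 / real k))" using \<sigma>(2) x \<rho> unfolding \<rho>_def[symmetric]
    by (subst ln_less_cancel_iff) auto
  then have "- \<alpha> * ln (real d) < ln \<rho> / real k" using \<rho> by (simp add: x_def ln_powr)
  then have c0: "ln \<rho> + \<alpha> * real k * ln (real d) > 0" using k(1) by (simp add: field_simps)
  define c where "c = ln \<rho> + \<alpha> * real k * ln (real d)"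
  obtain n where n: "real n * c > - (2 * ln pmin + 2 * \<alpha> * ln (real d))"
    using reals_Archimedean3[OF c0] unfolding c_def by blast
  obtain w where w: "w \<in> X (k * n + 2)" "h (k * n + 2) w \<ge> pmin\<^sup>2 * \<rho> ^ n"
    using growth_large[OF \<sigma>(1)] unfolding \<rho>_def by blast
  have "2 * ln pmin + real n * ln \<rho> = ln (pmin\<^sup>2 * \<rho> ^ n)"
    using pmin_pos \<rho> by (simp add: ln_mult ln_realpow)
  also have "\<dots> \<le> ln (h (k * n + 2) w)" using w(2) pmin_pos \<rho> by (intro ln_mono) auto
  finally have "ln (h (k * n + 2) w) + \<alpha> * real (k * n + 2) * ln (real d)
     \<ge> real n * c + (2 * ln pmin + 2 * \<alpha> * ln (real d))"
    by (simp add: c_def algebra_simps)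
  then have "ln (h (k * n + 2) w) + \<alpha> * real (k * n + 2) * ln (real d) > 0" using n by linarith
  then show ?thesis using w(1) by (intro exI[of _ "k * n + 2"]) auto
qed

text \<open>As in \<open>exists_large\<close>, with a word nearly attaining the infimum in
  \<open>alpha_star\<close> and a rate \<open>t\<close> strictly between its spectral radius and
  \<open>d powr (- \<alpha>)\<close> per letter, so that repetition outweighs the constant
  \<open>C\<close>.\<close>

lemma exists_small:
  assumes "ereal \<alpha> < alpha_star d m p"
  shows "\<exists>k\<ge>1. \<exists>w\<in>X k. ln (h k w) + \<alpha> * real k * ln (real d) < 0"
proof -
  have lnd: "ln (real d) > 0" using d3 by simp
  define x where "x = real d powr (-\<alpha>)"
  have x: "x > 0" by (simp add: x_def)
  define S where "S = {spectral_radius (Mw d m p \<sigma>) powr (1 / real (length \<sigma>)) | \<sigma>.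
        \<sigma> \<noteq> [] \<and> set \<sigma> \<subseteq> {0..m} \<and> hd \<sigma> \<notin> {0, m}}"
  have "spectral_radius (Mw d m p [b]) powr (1 / real (length [b])) \<in> S"
    using b_pos b_le unfolding S_def by (intro CollectI exI[of _ "[b]"]) auto
  then have ne: "S \<noteq> {}" by blast
  have S0: "z \<ge> 0" if "z \<in> S" for z using that by (auto simp: S_def)
  have I0: "Inf S \<ge> 0" using ne S0 by (intro cInf_greatest) auto
  have "Inf S < x"
  \<comment> \<open>For infimum 0, \<open>alpha_star\<close> is infinite and the hypothesis gives no
    bound, but then \<open>x > 0\<close> is enough.\<close>
  proof (cases "Inf S = 0")
    case False
    then have "\<alpha> < - ln (Inf S) / ln (real d)"
      using assms unfolding alpha_star_def S_def[symmetric] delta_log_def by simp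
    then have "ln (Inf S) < - \<alpha> * ln (real d)" using lnd by (simp add: field_simps)
    then have "Inf S < exp (- \<alpha> * ln (real d))" using I0 False by (metis exp_less_mono exp_ln less_eq_real_def)
    then show ?thesis by (simp add: x_def powr_def)
  qed (use x in simp)
  then obtain z where "z \<in> S" "z < x" using ne cInf_lessD by blast
  then obtain \<sigma> where \<sigma>: "\<sigma> \<noteq> []" "set \<sigma> \<subseteq> {0..m}"
     "spectral_radius (Mw d m p \<sigma>) powr (1 / real (length \<sigma>)) < x" by (auto simp: S_def)
  define k where "k = length \<sigma>"
  define \<rho> where "\<rho> = spectral_radius (Mw d m p \<sigma>)"
  have k: "k \<ge> 1" using \<sigma>(1) by (simp add: k_def Suc_le_eq)
  have "\<rho> \<ge> 0" unfolding \<rho>_def using \<sigma>(2) by (rule spectral_radius_nonneg)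
  have \<rho>: "\<rho> < x powr real k"
  proof (cases "\<rho> = 0")
    case False
    have "(\<rho> powr (1 / real k)) powr real k < x powr real k"
      using \<sigma>(3) k by (intro powr_less_mono2) (auto simp: \<rho>_def k_def)
    then show ?thesis using False \<open>\<rho> \<ge> 0\<close> k by (simp add: powr_powr)
  qed (use x in simp)
  define t where "t = (\<rho> + x powr real k) / 2"
  have t: "\<rho> < t" "t < x powr real k" "t > 0" using \<rho> \<open>\<rho> \<ge> 0\<close> by (auto simp: t_def)
  have "ln t < ln (x powr real k)" using t(2,3) x by (subst ln_less_cancel_iff) auto
  then have c: "ln t + \<alpha> * real k * ln (real d) < 0" by (simp add: x_def ln_powr powr_powr algebra_simps)
  have \<sigma>w: "\<sigma> \<in> words m k" using \<sigma>(2) by (simp add: words_def k_def)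
  obtain C where C: "\<And>n. \<exists>w\<in>X (k * n + 1). h (k * n + 1) w \<le> C * t ^ n"
    using growth_small[OF \<sigma>w t(1)[unfolded \<rho>_def] t(3)] by blast
  define c where "c = - (ln t + \<alpha> * real k * ln (real d))"
  have "c > 0" using c by (simp add: c_def)
  obtain n where n: "real n * c > ln C + \<alpha> * ln (real d)"
    using reals_Archimedean3[OF \<open>c > 0\<close>] by blast
  obtain w where w: "w \<in> X (k * n + 1)" "h (k * n + 1) w \<le> C * t ^ n" using C by blast
  have hp: "h (k * n + 1) w > 0" using w(1) by (intro h_X_pos) auto
  then have "C > 0" using w(2) t(3) by (smt (verit) zero_less_power mult_nonpos_nonneg)
  have "ln (h (k * n + 1) w) \<le> ln (C * t ^ n)" using w(2) hp by (intro ln_mono) auto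
  also have "\<dots> = ln C + real n * ln t" using \<open>C > 0\<close> t(3) by (simp add: ln_mult ln_realpow)
  finally have "ln (h (k * n + 1) w) + \<alpha> * real (k * n + 1) * ln (real d)
     \<le> (ln C + \<alpha> * ln (real d)) - real n * c"
    by (simp add: c_def algebra_simps)
  then have "ln (h (k * n + 1) w) + \<alpha> * real (k * n + 1) * ln (real d) < 0" using n by linarith
  then show ?thesis using w(1) by (intro exI[of _ "k * n + 1"]) auto
qed

end

section \<open>Partition sums and pressure\<close>

text \<open>Fekete's lemma: take \<open>N\<close> nearly attaining the supremum and divide
  \<open>k\<close> by \<open>N\<close> with remainder. Indices start at 1 because
  \<open>X 0\<close>, with its truncated subtraction, is not a set of values of words.\<close>

lemma superadditive_ratio_limit:
  fixes a :: "nat \<Rightarrow> real"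
  assumes super: "\<And>j k. j \<ge> 1 \<Longrightarrow> k \<ge> 1 \<Longrightarrow> a j + a k \<le> a (j + k)"
    and bound: "\<And>k. k \<ge> 1 \<Longrightarrow> a k \<le> B * real k"
  obtains l where "(\<lambda>k. a k / real k) \<longlonglongrightarrow> l" "\<And>k. k \<ge> 1 \<Longrightarrow> a k / real k \<le> l"
proof -
  define S where "S = (\<lambda>k. a k / real k) ` {1..}"
  have bdd: "bdd_above S" unfolding S_def bdd_above_def
    using bound by (intro exI[of _ B]) (auto simp: field_simps)
  define l where "l = Sup S"
  have le: "a k / real k \<le> l" if "k \<ge> 1" for k
    unfolding l_def using that bdd by (intro cSup_upper) (auto simp: S_def)
  have "(\<lambda>k. a k / real k) \<longlonglongrightarrow> l"
  proof (rule LIMSEQ_I)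
    fix e :: real assume "e > 0"
    have "\<exists>x\<in>S. l - e / 2 < x"
      using \<open>e > 0\<close> bdd unfolding l_def by (subst less_cSup_iff[symmetric]) (auto simp: S_def)
    then obtain N where N: "N \<ge> 1" "a N / real N > l - e / 2" by (auto simp: S_def)
    define c where "c = (\<Sum>r<N. \<bar>a r\<bar>)"
    have c: "\<bar>a r\<bar> \<le> c" if "r < N" for r
      unfolding c_def using that by (intro member_le_sum) auto
    have c0: "c \<ge> 0" unfolding c_def by (intro sum_nonneg) auto
    have main: "a (t * N + r) \<ge> real t * a N - c" if "r < N" "t * N + r \<ge> 1" for t r
      using that
    proof (induction t)
      case 0
      then show ?case using c[of r] by auto
    next
      case (Suc t)
      show ?case
      proof (cases "t * N + r \<ge> 1")
        case True
        have "real (Suc t) * a N - c = a N + (real t * a N - c)" by (simp add: algebra_simps)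
        also have "\<dots> \<le> a N + a (t * N + r)" using Suc True by simp
        also have "\<dots> \<le> a (N + (t * N + r))" using super[OF N(1) True] .
        finally show ?thesis by (simp add: add.assoc)
      next
        \<comment> \<open>Superadditivity says nothing about the index 0, so the first step from 0
          to \<open>N\<close> is treated by hand.\<close>
        case False
        then have "t * N = 0" "r = 0" by linarith+
        then have "t = 0" using N(1) by auto
        then show ?thesis using c0 \<open>r = 0\<close> by simp
      qed
    qed
    define C where "C = \<bar>a N\<bar> + c"
    have low: "a k / real k \<ge> a N / real N - C / real k" if "k \<ge> 1" for k
    proof -
      have "k div N * N + k mod N = k" by simp
      then have ak: "a k \<ge> real (k div N) * a N - c"
        using main[of "k mod N" "k div N"] that N(1) by simp
      have kN: "real (k div N) * real N = real k - real (k mod N)"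
      proof -
        have "real (k div N * N + k mod N) = real k" by (simp only: div_mult_mod_eq)
        then show ?thesis unfolding of_nat_add of_nat_mult by linarith
      qed
      have "real (k div N) * a N = (real (k div N) * real N) * (a N / real N)"
        using N(1) by simp
      also have "\<dots> = (real k - real (k mod N)) * (a N / real N)"
        unfolding kN ..
      also have "\<dots> = real k * (a N / real N) - real (k mod N) / real N * a N"
        by (simp add: left_diff_distrib diff_divide_distrib)
      finally have eq: "real (k div N) * a N = real k * (a N / real N) - real (k mod N) / real N * a N" .
      have "real (k mod N) / real N * a N \<le> 1 * \<bar>a N\<bar>"
      proof -
        have "real (k mod N) / real N \<le> 1" using N(1) by (simp add: field_simps less_imp_le)
        then have "real (k mod N) / real N * \<bar>a N\<bar> \<le> 1 * \<bar>a N\<bar>" by (intro mult_right_mono) auto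
        moreover have "real (k mod N) / real N * a N \<le> real (k mod N) / real N * \<bar>a N\<bar>"
          by (intro mult_left_mono) auto
        ultimately show ?thesis by (rule order_trans[rotated])
      qed
      then have "a k \<ge> real k * (a N / real N) - C" using ak eq by (simp add: C_def)
      then have "(real k * (a N / real N) - C) / real k \<le> a k / real k"
        by (intro divide_right_mono) auto
      then show ?thesis using that by (simp add: diff_divide_distrib)
    qed
    obtain K where K: "real K * (e / 2) > C" using reals_Archimedean3[of "e / 2"] \<open>e > 0\<close> by auto
    show "\<exists>no. \<forall>n\<ge>no. norm (a n / real n - l) < e"
    proof (intro exI allI impI)
      fix n assume n: "n \<ge> K + 1"
      have "C < real n * (e / 2)"
      proof -
        have "real K * (e / 2) \<le> real n * (e / 2)" using n \<open>e > 0\<close> by (intro mult_right_mono) auto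
        then show ?thesis using K by linarith
      qed
      then have "C / real n < e / 2" using n by (simp add: field_simps)
      then show "norm (a n / real n - l) < e" using low[of n] le[of n] N(2) n by simp
    qed
  qed
  then show ?thesis using le by (rule that)
qed

context barrier_system
begin

definition Z :: "nat \<Rightarrow> real \<Rightarrow> real" where
  "Z k q = (\<Sum>w\<in>X k. h k w powr q)"

lemma ln_d_pos: "ln (real d) > 0"
  using d3 by simp

lemma X_nonempty: "X k \<noteq> {}"
  using Lv_nonneg[of d m "k - 1"] by (simp add: X_def)

lemma Z_pos: "k \<ge> 1 \<Longrightarrow> Z k q > 0"
proof -
  assume "k \<ge> 1"
  then have "h k w powr q > 0" if "w \<in> X k" for w using h_X_pos[of k w] that by simp
  then show ?thesis unfolding Z_def by (rule sum_pos[OF finite_X X_nonempty])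
qed

lemma inj_append:
  assumes "k \<ge> 1"
  shows "inj_on (\<lambda>(v, w). v * int d ^ k + w) (A \<times> X k)"
proof (rule inj_onI, clarsimp)
  fix v w v' w' assume "w \<in> X k" "w' \<in> X k" "v * int d ^ k + w = v' * int d ^ k + w'"
  from append_inj[OF assms this] show "v = v' \<and> w = w'" by blast
qed

lemma Z_super:
  assumes "j \<ge> 1" "k \<ge> 1"
  shows "Z j q * Z k q \<le> Z (j + k) q"
proof -
  have "Z j q * Z k q = (\<Sum>(v, w)\<in>X j \<times> X k. h j v powr q * h k w powr q)"
    by (simp add: Z_def sum_product sum.cartesian_product)
  also have "\<dots> = (\<Sum>(v, w)\<in>X j \<times> X k. h (j + k) (v * int d ^ k + w) powr q)"
    using assms by (intro sum.cong) (auto simp: h_barrier powr_mult h_nonneg)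
  also have "\<dots> = (\<Sum>u\<in>(\<lambda>(v, w). v * int d ^ k + w) ` (X j \<times> X k). h (j + k) u powr q)"
    by (subst sum.reindex[OF inj_append[OF assms(2)]]) (auto intro!: sum.cong)
  also have "\<dots> \<le> Z (j + k) q"
    unfolding Z_def using assms X_bounds by (intro sum_mono2) (auto intro!: X_append)
  finally show ?thesis .
qed

lemma card_X_le: "k \<ge> 1 \<Longrightarrow> real (card (X k)) \<le> real d ^ k"
proof -
  assume "k \<ge> 1"
  then obtain j where k: "k = Suc j" by (cases k) auto
  have "int (card (X k)) = L j + 1" using Lv_nonneg[of d m j] by (simp add: X_def k)
  also have "\<dots> \<le> 2 * int d ^ j" using L_le[of j] by simp
  also have "\<dots> \<le> int d * int d ^ j" using d3 by (intro mult_right_mono) auto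
  finally have "int (card (X k)) \<le> int d ^ k" by (simp add: k)
  then have "of_int (int (card (X k))) \<le> (of_int (int d ^ k) :: real)" by (rule of_int_le_iff[THEN iffD2])
  then show ?thesis by simp
qed

text \<open>A crude bound from \<open>pmin ^ k \<le> h k n \<le> 1\<close>, valid for both signs of
  \<open>q\<close>. It gives the linear bound on \<open>ln (Z k q)\<close> that Fekete's lemma asks
  for.\<close>

lemma powr_h_le:
  assumes "0 \<le> n" "n \<le> L k"
  shows "h k n powr q \<le> exp (real k * (\<bar>q\<bar> * (- ln pmin)))"
proof -
  have hp: "h k n > 0" using h_pos assms by simp
  have "ln (h k n) \<le> 0" using hp h_le1 by simp
  moreover have "ln (h k n) \<ge> real k * ln pmin"
  proof -
    have "ln (pmin ^ k) \<le> ln (h k n)" using h_ge[OF assms] pmin_pos by (intro ln_mono) auto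
    then show ?thesis using pmin_pos by (simp add: ln_realpow)
  qed
  ultimately have "q * ln (h k n) \<le> \<bar>q\<bar> * (- (real k * ln pmin))"
  proof (cases "q \<ge> 0")
    case True
    have "q * ln (h k n) \<le> q * (- (real k * ln pmin))"
      using True \<open>ln (h k n) \<le> 0\<close> \<open>ln (h k n) \<ge> real k * ln pmin\<close> by (intro mult_left_mono) linarith+
    then show ?thesis using True by simp
  next
    case False
    then have "q * ln (h k n) \<le> q * (real k * ln pmin)"
      using \<open>ln (h k n) \<ge> real k * ln pmin\<close> by (intro mult_left_mono_neg) auto
    then show ?thesis using False by simp
  qed
  then show ?thesis using hp by (simp add: powr_def mult_ac)
qed

lemma ln_Z_le:
  assumes "k \<ge> 1"
  shows "ln (Z k q) \<le> (ln (real d) + \<bar>q\<bar> * (- ln pmin)) * real k"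
proof -
  have "Z k q \<le> real (card (X k)) * exp (real k * (\<bar>q\<bar> * (- ln pmin)))"
    unfolding Z_def using X_bounds[OF assms] by (intro sum_bounded_above powr_h_le) auto
  also have "\<dots> \<le> real d ^ k * exp (real k * (\<bar>q\<bar> * (- ln pmin)))"
    using card_X_le[OF assms] by (intro mult_right_mono) auto
  finally have "ln (Z k q) \<le> ln (real d ^ k * exp (real k * (\<bar>q\<bar> * (- ln pmin))))"
    using Z_pos[OF assms] by (intro ln_mono) auto
  also have "\<dots> = (ln (real d) + \<bar>q\<bar> * (- ln pmin)) * real k"
    by (simp add: ln_mult ln_realpow algebra_simps)
  finally show ?thesis .
qed

lemma ln_Z_super: "j \<ge> 1 \<Longrightarrow> k \<ge> 1 \<Longrightarrow> ln (Z j q) + ln (Z k q) \<le> ln (Z (j + k) q)"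
  using Z_super[of j k q] Z_pos[of j q] Z_pos[of k q] ln_mono[of "Z j q * Z k q" "Z (j + k) q"] by (simp add: ln_mult)

definition P :: "real \<Rightarrow> real" where
  "P q = lim (\<lambda>k. ln (Z k q) / real k)"

lemma P_limit: "(\<lambda>k. ln (Z k q) / real k) \<longlonglongrightarrow> P q"
  and P_upper: "k \<ge> 1 \<Longrightarrow> ln (Z k q) / real k \<le> P q"
proof -
  obtain l where l: "(\<lambda>k. ln (Z k q) / real k) \<longlonglongrightarrow> l" "\<And>k. k \<ge> 1 \<Longrightarrow> ln (Z k q) / real k \<le> l"
    using superadditive_ratio_limit[of "\<lambda>k. ln (Z k q)", OF ln_Z_super ln_Z_le[of _ q]] by metis
  then have "P q = l" unfolding P_def by (simp add: limI)
  then show "(\<lambda>k. ln (Z k q) / real k) \<longlonglongrightarrow> P q" "k \<ge> 1 \<Longrightarrow> ln (Z k q) / real k \<le> P q"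
    using l by auto
qed

text \<open>Prepending \<open>b\<close> and taking the value is a bijection from
  \<open>\<Xi> (k - 1)\<close> onto \<open>X k\<close>.\<close>

lemma sum_representatives:
  assumes "representatives d m \<Xi>" "k \<ge> 1"
  shows "(\<Sum>\<sigma>\<in>\<Xi> (k - 1). eta d m p (b # \<sigma>) powr q) = Z k q"
proof -
  obtain j where k: "k = Suc j" using assms(2) by (cases k) auto
  let ?v = "\<lambda>\<sigma>. val d (b # \<sigma>)"
  have sub: "\<Xi> j \<subseteq> words m j" using assms(1) by (auto simp: representatives_def)
  have len: "length \<sigma> = j" if "\<sigma> \<in> \<Xi> j" for \<sigma> using sub that by (auto simp: words_def)
  have uniq: "\<exists>!\<sigma>'. \<sigma>' \<in> \<Xi> j \<and> val d \<sigma>' = val d \<sigma>" if "\<sigma> \<in> words m j" for \<sigma>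
  proof -
    have "piw d \<sigma>' = piw d \<sigma> \<longleftrightarrow> val d \<sigma>' = val d \<sigma>" if "\<sigma>' \<in> \<Xi> j" for \<sigma>'
      using \<open>\<sigma> \<in> words m j\<close> len[OF that] by (auto simp: piw_val words_def)
    moreover have "\<exists>!\<sigma>'. \<sigma>' \<in> \<Xi> j \<and> piw d \<sigma>' = piw d \<sigma>"
      using assms(1) that by (auto simp: representatives_def)
    ultimately show ?thesis by blast
  qed
  have inj: "inj_on ?v (\<Xi> j)"
  proof (rule inj_onI)
    fix x y assume xy: "x \<in> \<Xi> j" "y \<in> \<Xi> j" "?v x = ?v y"
    then have eq: "val d y = val d x" using len by simp
    have "x \<in> words m j" using xy(1) sub by (rule rev_subsetD)
    from the1_equality[OF uniq[OF this], of x] the1_equality[OF uniq[OF this], of y]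
    show "x = y" using xy(1,2) eq by simp
  qed
  have img: "?v ` \<Xi> j = X k"
  proof
    show "?v ` \<Xi> j \<subseteq> X k"
      using sub val_range[of _ m j d] len by (auto simp: X_def k)
    show "X k \<subseteq> ?v ` \<Xi> j"
    proof
      fix w assume "w \<in> X k"
      then have "0 \<le> w - int b * int d ^ j" "w - int b * int d ^ j \<le> L j" by (auto simp: X_def k)
      then obtain \<sigma> where \<sigma>: "\<sigma> \<in> words m j" "val d \<sigma> = w - int b * int d ^ j"
        using val_surj[of d m "w - int b * int d ^ j" j] md dpos(1) by (meson trans_le_add1)
      then obtain \<sigma>' where "\<sigma>' \<in> \<Xi> j" "val d \<sigma>' = w - int b * int d ^ j" using uniq[OF \<sigma>(1)] by auto
      then have "w = ?v \<sigma>'" using len by simp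
      then show "w \<in> ?v ` \<Xi> j" using \<open>\<sigma>' \<in> \<Xi> j\<close> by blast
    qed
  qed
  have "Z k q = (\<Sum>\<sigma>\<in>\<Xi> j. h k (?v \<sigma>) powr q)"
    unfolding Z_def img[symmetric] by (subst sum.reindex[OF inj]) simp
  also have "\<dots> = (\<Sum>\<sigma>\<in>\<Xi> j. eta d m p (b # \<sigma>) powr q)"
    using len by (intro sum.cong) (auto simp: eta_H k)
  finally show ?thesis by (simp add: k)
qed

lemma tau_hat_P:
  assumes "representatives d m \<Xi>"
  shows "tau_hat d m p \<Xi> b q = - P q / ln (real d)"
proof -
  have "(\<lambda>k. - (1 / ln (real d)) * (ln (Z k q) / real k)) \<longlonglongrightarrow> - (1 / ln (real d)) * P q"
    by (intro tendsto_intros P_limit)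
  moreover have "\<forall>\<^sub>F k in sequentially. - (1 / ln (real d)) * (ln (Z k q) / real k)
     = (- 1 / ln (real d)) * (1 / real k) * ln (\<Sum>\<sigma>\<in>\<Xi> (k - 1). eta d m p (b # \<sigma>) powr q)"
    by (rule eventually_at_top_linorderI[of 1]) (simp only: sum_representatives[OF assms], simp)
  ultimately have "(\<lambda>k. (- 1 / ln (real d)) * (1 / real k) * ln (\<Sum>\<sigma>\<in>\<Xi> (k - 1). eta d m p (b # \<sigma>) powr q))
     \<longlonglongrightarrow> - (1 / ln (real d)) * P q"
    by (rule Lim_transform_eventually)
  then show ?thesis unfolding tau_hat_def by (simp add: limI)
qed

end

section \<open>Typical lists and uniform growth\<close>

lemma sum_lists_Suc:
  fixes f :: "'a list \<Rightarrow> real"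
  shows "(\<Sum>xs | set xs \<subseteq> W \<and> length xs = Suc n. f xs)
    = (\<Sum>x\<in>W. \<Sum>xs | set xs \<subseteq> W \<and> length xs = n. f (x # xs))"
proof -
  have eq: "{xs. set xs \<subseteq> W \<and> length xs = Suc n}
      = (\<lambda>(x, xs). x # xs) ` (W \<times> {xs. set xs \<subseteq> W \<and> length xs = n})"
    by (auto simp: length_Suc_conv image_iff)
  have inj: "inj_on (\<lambda>(x, xs). x # xs) (W \<times> {xs. set xs \<subseteq> W \<and> length xs = n})"
    by (auto simp: inj_on_def)
  show ?thesis unfolding eq sum.reindex[OF inj]
    by (simp add: sum.cartesian_product case_prod_unfold)
qed

text \<open>Mass, mean and variance of a sum of \<open>n\<close> independent copies of
  \<open>Y\<close> with law \<open>\<pi>\<close>, with lists in place of a product space. The cross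
  terms vanish because \<open>Y\<close> is centred.\<close>

lemma list_moments:
  fixes \<pi> Y :: "'a \<Rightarrow> real"
  assumes one: "sum \<pi> W = 1" and mean: "(\<Sum>x\<in>W. \<pi> x * Y x) = 0"
  defines "V \<equiv> \<Sum>x\<in>W. \<pi> x * (Y x)\<^sup>2"
  shows "(\<Sum>xs | set xs \<subseteq> W \<and> length xs = n. prod_list (map \<pi> xs)) = 1"
    and "(\<Sum>xs | set xs \<subseteq> W \<and> length xs = n. prod_list (map \<pi> xs) * sum_list (map Y xs)) = 0"
    and "(\<Sum>xs | set xs \<subseteq> W \<and> length xs = n. prod_list (map \<pi> xs) * (sum_list (map Y xs))\<^sup>2) = real n * V"
proof -
  let ?A = "\<lambda>n. {xs. set xs \<subseteq> W \<and> length xs = n}"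
  let ?p = "\<lambda>xs. prod_list (map \<pi> xs)" let ?S = "\<lambda>xs. sum_list (map Y xs)"
  have A0: "?A 0 = {[]}" by auto
  have "(\<Sum>xs\<in>?A n. ?p xs) = 1 \<and> (\<Sum>xs\<in>?A n. ?p xs * ?S xs) = 0 \<and> (\<Sum>xs\<in>?A n. ?p xs * (?S xs)\<^sup>2) = real n * V"
  proof (induction n)
    case 0
    show ?case unfolding A0 by simp
  next
    case (Suc n)
    have 1: "(\<Sum>xs\<in>?A (Suc n). ?p xs) = (\<Sum>x\<in>W. \<pi> x * (\<Sum>xs\<in>?A n. ?p xs))"
      unfolding sum_lists_Suc by (simp add: sum_distrib_left)
    have "(\<Sum>xs\<in>?A (Suc n). ?p xs * ?S xs)
      = (\<Sum>x\<in>W. \<pi> x * Y x * (\<Sum>xs\<in>?A n. ?p xs) + \<pi> x * (\<Sum>xs\<in>?A n. ?p xs * ?S xs))"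
      unfolding sum_lists_Suc sum_distrib_left sum.distrib[symmetric]
      by (intro sum.cong refl) (simp add: distrib_left mult_ac)
    then have 2: "(\<Sum>xs\<in>?A (Suc n). ?p xs * ?S xs) = 0" using Suc mean by simp
    have "(\<Sum>xs\<in>?A (Suc n). ?p xs * (?S xs)\<^sup>2)
      = (\<Sum>x\<in>W. \<pi> x * (Y x)\<^sup>2 * (\<Sum>xs\<in>?A n. ?p xs) + 2 * \<pi> x * Y x * (\<Sum>xs\<in>?A n. ?p xs * ?S xs)
           + \<pi> x * (\<Sum>xs\<in>?A n. ?p xs * (?S xs)\<^sup>2))"
      unfolding sum_lists_Suc sum_distrib_left sum.distrib[symmetric]
      by (intro sum.cong refl) (simp add: algebra_simps power2_eq_square)
    also have "\<dots> = V + real n * V"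
      using Suc one unfolding V_def by (simp add: sum.distrib sum_distrib_right[symmetric])
    finally have 3: "(\<Sum>xs\<in>?A (Suc n). ?p xs * (?S xs)\<^sup>2) = real (Suc n) * V"
      by (simp add: algebra_simps)
    from 1 2 3 show ?case using Suc one by simp
  qed
  then show "(\<Sum>xs\<in>?A n. ?p xs) = 1" "(\<Sum>xs\<in>?A n. ?p xs * ?S xs) = 0"
    "(\<Sum>xs\<in>?A n. ?p xs * (?S xs)\<^sup>2) = real n * V" by auto
qed

text \<open>Tilt the counting measure by \<open>exp (q * D x) / G\<close>. The critical equation
  says that \<open>D\<close> is centred under this law, so the typical lists carry mass at least
  1/2. Each of them has mass at most \<open>exp (\<bar>q\<bar> * \<epsilon> * n) / G ^ n\<close>,
  which turns mass into a count.\<close>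

lemma card_typical_lists:
  fixes D :: "'a \<Rightarrow> real"
  assumes fin: "finite W" and ne: "W \<noteq> {}"
    and crit: "(\<Sum>x\<in>W. D x * exp (q * D x)) = 0"
    and \<epsilon>: "\<epsilon> > 0"
  defines "G \<equiv> \<Sum>x\<in>W. exp (q * D x)"
  obtains n0 where "\<And>n. n \<ge> n0 \<Longrightarrow>
    real (card {xs. set xs \<subseteq> W \<and> length xs = n \<and> \<bar>sum_list (map D xs)\<bar> \<le> \<epsilon> * real n})
      \<ge> G ^ n * exp (- \<bar>q\<bar> * \<epsilon> * real n) / 2"
proof -
  have G: "G > 0" unfolding G_def using fin ne by (intro sum_pos) auto
  define \<pi> where "\<pi> x = exp (q * D x) / G" for x
  define V where "V = (\<Sum>x\<in>W. \<pi> x * (D x)\<^sup>2)"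
  have one: "sum \<pi> W = 1" using G by (simp add: \<pi>_def sum_divide_distrib[symmetric] G_def)
  have mean: "(\<Sum>x\<in>W. \<pi> x * D x) = 0"
    using crit by (simp add: \<pi>_def sum_divide_distrib[symmetric] mult.commute)
  \<comment> \<open>For \<open>n > n0\<close> the variance \<open>n * V\<close> is at most half the
    square of \<open>\<epsilon> * n\<close>, so Chebyshev leaves at most half the mass
    atypical.\<close>
  obtain n0 :: nat where n0: "real n0 * \<epsilon>\<^sup>2 > 2 * V"
    using reals_Archimedean3[of "\<epsilon>\<^sup>2"] \<epsilon> by auto
  show ?thesis
  proof (rule that)
    fix n assume n: "n \<ge> n0 + 1"
    let ?A = "{xs. set xs \<subseteq> W \<and> length xs = n}"
    let ?T = "{xs. set xs \<subseteq> W \<and> length xs = n \<and> \<bar>sum_list (map D xs)\<bar> \<le> \<epsilon> * real n}"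
    let ?p = "\<lambda>xs. prod_list (map \<pi> xs)" let ?S = "\<lambda>xs. sum_list (map D xs)"
    have finA: "finite ?A" using finite_lists_length_eq[OF fin] .
    have p0: "?p xs \<ge> 0" for xs using G by (intro prod_list_nonneg) (auto simp: \<pi>_def)
    have pe: "?p xs = exp (q * ?S xs) / G ^ length xs" for xs
      by (induction xs) (auto simp: \<pi>_def exp_add algebra_simps)
    have e2: "(\<epsilon> * real n)\<^sup>2 > 0" using \<epsilon> n by simp
    have "(\<epsilon> * real n)\<^sup>2 * (\<Sum>xs\<in>?A - ?T. ?p xs) \<le> (\<Sum>xs\<in>?A - ?T. ?p xs * (?S xs)\<^sup>2)"
      unfolding sum_distrib_left
    proof (rule sum_mono)
      fix xs assume "xs \<in> ?A - ?T"
      then have "\<epsilon> * real n \<le> \<bar>?S xs\<bar>" by auto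
      then have "(\<epsilon> * real n)\<^sup>2 \<le> \<bar>?S xs\<bar>\<^sup>2" using \<epsilon> by (intro power_mono) auto
      then have "(\<epsilon> * real n)\<^sup>2 * ?p xs \<le> (?S xs)\<^sup>2 * ?p xs" using p0 by (intro mult_right_mono) auto
      then show "(\<epsilon> * real n)\<^sup>2 * ?p xs \<le> ?p xs * (?S xs)\<^sup>2" by (simp add: mult.commute)
    qed
    also have "\<dots> \<le> (\<Sum>xs\<in>?A. ?p xs * (?S xs)\<^sup>2)"
      using finA p0 by (intro sum_mono2) auto
    also have "\<dots> = real n * V" using list_moments(3)[OF one mean] by (simp add: V_def)
    finally have "(\<epsilon> * real n)\<^sup>2 * (\<Sum>xs\<in>?A - ?T. ?p xs) \<le> real n * V" .
    moreover have "2 * (real n * V) \<le> (\<epsilon> * real n)\<^sup>2"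
    proof -
      have "real n0 * \<epsilon>\<^sup>2 \<le> real n * \<epsilon>\<^sup>2" using n by (intro mult_right_mono) auto
      then have "real n * (2 * V) \<le> real n * (real n * \<epsilon>\<^sup>2)" using n0 by (intro mult_left_mono) auto
      then show ?thesis by (simp add: power2_eq_square algebra_simps)
    qed
    ultimately have "(\<epsilon> * real n)\<^sup>2 * (2 * (\<Sum>xs\<in>?A - ?T. ?p xs)) \<le> (\<epsilon> * real n)\<^sup>2 * 1" by linarith
    then have "2 * (\<Sum>xs\<in>?A - ?T. ?p xs) \<le> 1" using e2 by (simp only: mult_le_cancel_left_pos)
    moreover have "(\<Sum>xs\<in>?A. ?p xs) = (\<Sum>xs\<in>?A - ?T. ?p xs) + (\<Sum>xs\<in>?T. ?p xs)"
      using finA by (intro sum.subset_diff) auto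
    moreover have "(\<Sum>xs\<in>?A. ?p xs) = 1" by (rule list_moments(1)[OF one mean])
    ultimately have half: "1 / 2 \<le> (\<Sum>xs\<in>?T. ?p xs)" by linarith
    also have "\<dots> \<le> real (card ?T) * (exp (\<bar>q\<bar> * \<epsilon> * real n) / G ^ n)"
    proof (rule sum_bounded_above)
      fix xs assume xs: "xs \<in> ?T"
      have "q * ?S xs \<le> \<bar>q\<bar> * \<bar>?S xs\<bar>" by (simp add: abs_mult[symmetric])
      also have "\<dots> \<le> \<bar>q\<bar> * (\<epsilon> * real n)" using xs by (intro mult_left_mono) auto
      finally show "?p xs \<le> exp (\<bar>q\<bar> * \<epsilon> * real n) / G ^ n"
        using xs G unfolding pe by (auto intro!: divide_right_mono)
    qed
    finally have "G ^ n / 2 \<le> real (card ?T) * exp (\<bar>q\<bar> * \<epsilon> * real n)" using G by (simp add: field_simps)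
    then have "G ^ n / 2 * exp (- (\<bar>q\<bar> * \<epsilon> * real n))
       \<le> real (card ?T) * exp (\<bar>q\<bar> * \<epsilon> * real n) * exp (- (\<bar>q\<bar> * \<epsilon> * real n))"
      by (intro mult_right_mono) auto
    then show "real (card ?T) \<ge> G ^ n * exp (- \<bar>q\<bar> * \<epsilon> * real n) / 2"
      by (simp add: mult.assoc exp_add[symmetric])
  qed
qed

text \<open>Since \<open>D\<close> takes both signs, the sum of the exponentials tends to infinity
  in both directions of \<open>q\<close>; its minimum is a critical point.\<close>

lemma exp_sum_critical_point:
  fixes D :: "'a \<Rightarrow> real"
  assumes fin: "finite W" and u: "u \<in> W" "D u > 0" and v: "v \<in> W" "D v < 0"
  obtains q where "(\<Sum>x\<in>W. D x * exp (q * D x)) = 0"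
proof -
  define g where "g q = (\<Sum>x\<in>W. exp (q * D x))" for q
  have ge: "g q \<ge> exp (q * D x)" if "x \<in> W" for q x
    unfolding g_def using that fin by (intro member_le_sum) auto
  have g1: "q * D x \<le> ln (g 0)" if "x \<in> W" "g q \<le> g 0" for q x
  proof -
    have "exp (q * D x) \<le> g 0" using ge that by (meson order_trans)
    then have "ln (exp (q * D x)) \<le> ln (g 0)" by (intro ln_mono) auto
    then show ?thesis by simp
  qed
  \<comment> \<open>Where \<open>g\<close> is at most \<open>g 0\<close>, the summand of
    \<open>u\<close> alone bounds \<open>q\<close> from above and that of \<open>v\<close> from
    below.\<close>
  let ?I = "{ln (g 0) / D v .. ln (g 0) / D u}"
  have in_I: "q \<in> ?I" if "g q \<le> g 0" for q
    using g1[OF u(1) that] g1[OF v(1) that] u(2) v(2) by (auto simp: field_simps)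
  have cont: "continuous_on ?I g" unfolding g_def by (intro continuous_intros)
  obtain q where q: "q \<in> ?I" "\<And>y. y \<in> ?I \<Longrightarrow> g q \<le> g y"
    using continuous_attains_inf[OF compact_Icc _ cont] in_I[of 0] by blast
  have min: "g q \<le> g y" for y
    using q(2)[of y] q(2)[of 0] in_I[of y] in_I[of 0] by (cases "g y \<le> g 0") auto
  have "(g has_field_derivative (\<Sum>x\<in>W. D x * exp (q * D x))) (at q)"
    unfolding g_def by (auto intro!: derivative_eq_intros simp: mult.commute)
  from DERIV_local_min[OF this, of 1] min have "(\<Sum>x\<in>W. D x * exp (q * D x)) = 0" by simp
  then show ?thesis by (rule that)
qed

section \<open>Weights normalised at the level \<alpha>\<close>

locale barrier_level = barrier_system +
  fixes \<alpha> :: real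
  assumes large: "\<exists>k\<ge>1. \<exists>w\<in>X k. ln (h k w) + \<alpha> * real k * ln (real d) > 0"
    and small: "\<exists>k\<ge>1. \<exists>w\<in>X k. ln (h k w) + \<alpha> * real k * ln (real d) < 0"
begin

definition D :: "nat \<Rightarrow> int \<Rightarrow> real" where
  "D k w = ln (h k w) + \<alpha> * real k * ln (real d)"

definition g :: "nat \<Rightarrow> real \<Rightarrow> real" where
  "g k q = (\<Sum>w\<in>X k. exp (q * D k w))"

text \<open>The exponential growth rate of \<open>g\<close>. Divided by \<open>ln d\<close> it is
  \<open>q * \<alpha>\<close> minus \<open>tau_hat\<close> at \<open>q\<close>, the quantity
  minimised in the Legendre transform.\<close>

definition \<Lambda> :: "real \<Rightarrow> real" where
  "\<Lambda> q = q * \<alpha> * ln (real d) + P q"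

lemma D_append:
  assumes "k \<ge> 1" "w \<in> X k" "h j v > 0"
  shows "D (j + k) (v * int d ^ k + w) = D j v + D k w"
  unfolding D_def h_barrier[OF assms(1,2)]
  using h_X_pos[OF assms(1,2)] assms(3) by (simp add: ln_mult distrib_left distrib_right)

lemma g_Z: "k \<ge> 1 \<Longrightarrow> g k q = exp (q * \<alpha> * real k * ln (real d)) * Z k q"
  unfolding g_def Z_def sum_distrib_left
proof (rule sum.cong[OF refl])
  fix w assume "k \<ge> 1" "w \<in> X k"
  then have "h k w > 0" by (rule h_X_pos)
  then show "exp (q * D k w) = exp (q * \<alpha> * real k * ln (real d)) * h k w powr q"
    by (simp add: D_def powr_def exp_add[symmetric] distrib_left mult_ac add.commute)
qed

lemma ln_g: "k \<ge> 1 \<Longrightarrow> ln (g k q) = q * \<alpha> * real k * ln (real d) + ln (Z k q)"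
  using Z_pos[of k q] by (simp add: g_Z ln_mult)

text \<open>Concatenation of words of length \<open>N\<close>, at the level of their values.\<close>

definition cat :: "nat \<Rightarrow> int list \<Rightarrow> int" where
  "cat N xs = foldl (\<lambda>a w. a * int d ^ N + w) 0 xs"

lemma cat_snoc: "cat N (xs @ [w]) = cat N xs * int d ^ N + w"
  by (simp add: cat_def)

lemma cat_Nil: "cat N [] = 0"
  by (simp add: cat_def)

text \<open>Each block begins with \<open>b\<close>, so weights multiply and \<open>D\<close> adds
  up. The empty list is excluded in the last part because its value 0 lies in no
  \<open>X k\<close>.\<close>

lemma cat_props:
  assumes N: "N \<ge> 1" and xs: "set xs \<subseteq> X N"
  shows "h (N * length xs) (cat N xs) > 0"
    and "D (N * length xs) (cat N xs) = sum_list (map (D N) xs)"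
    and "xs \<noteq> [] \<Longrightarrow> cat N xs \<in> X (N * length xs)"
proof -
  have "h (N * length xs) (cat N xs) > 0 \<and> D (N * length xs) (cat N xs) = sum_list (map (D N) xs)
      \<and> (xs \<noteq> [] \<longrightarrow> cat N xs \<in> X (N * length xs))"
    using xs
  proof (induction xs rule: rev_induct)
    case Nil
    then show ?case by (simp add: cat_Nil H_0 D_def)
  next
    case (snoc w xs)
    then have w: "w \<in> X N" and IH: "h (N * length xs) (cat N xs) > 0"
      "D (N * length xs) (cat N xs) = sum_list (map (D N) xs)"
      "xs \<noteq> [] \<Longrightarrow> cat N xs \<in> X (N * length xs)" by auto
    have len: "N * length (xs @ [w]) = N * length xs + N" by simp
    have "cat N (xs @ [w]) \<in> X (N * length xs + N)"
    proof (cases "xs = []")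
      case True
      then show ?thesis using w cat_snoc[of N "[]" w] by (simp add: cat_Nil)
    next
      case False
      then have "N * length xs \<ge> 1" using N by (simp add: Suc_le_eq)
      then show ?thesis using IH(3)[OF False] X_bounds[OF N w] unfolding cat_snoc by (intro X_append) auto
    qed
    moreover have "h (N * length xs + N) (cat N (xs @ [w])) > 0"
      unfolding cat_snoc h_barrier[OF N w] using IH(1) h_X_pos[OF N w] by simp
    moreover have "D (N * length xs + N) (cat N (xs @ [w])) = sum_list (map (D N) (xs @ [w]))"
      unfolding cat_snoc D_append[OF N w IH(1)] IH(2) by simp
    ultimately show ?case unfolding len by blast
  qed
  then show "h (N * length xs) (cat N xs) > 0" "D (N * length xs) (cat N xs) = sum_list (map (D N) xs)"
    "xs \<noteq> [] \<Longrightarrow> cat N xs \<in> X (N * length xs)" by auto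
qed

lemma cat_inj:
  assumes N: "N \<ge> 1" and "set xs \<subseteq> X N" "set ys \<subseteq> X N" "length xs = length ys" "cat N xs = cat N ys"
  shows "xs = ys"
  using assms(2-)
proof (induction xs arbitrary: ys rule: rev_induct)
  case Nil
  then show ?case by simp
next
  case (snoc w xs)
  obtain w' zs where ys: "ys = zs @ [w']" using snoc.prems(3) by (cases ys rule: rev_cases) auto
  have "cat N xs * int d ^ N + w = cat N zs * int d ^ N + w'"
    using snoc.prems(4) unfolding ys cat_snoc .
  then have "cat N xs = cat N zs" "w = w'"
    using append_inj[OF N, of w w'] snoc.prems(1,2) ys by auto
  then show ?case using snoc.IH[of zs] snoc.prems ys by simp
qed

lemma D_power:
  assumes "k \<ge> 1" "w \<in> X k" "n \<ge> 1"
  shows "\<exists>w'\<in>X (k * n). D (k * n) w' = real n * D k w"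
  using cat_props[OF assms(1), of "replicate n w"] assms
  by (intro bexI[of _ "cat k (replicate n w)"]) (auto simp: sum_list_replicate)

text \<open>A \<open>k\<close>-fold power of a word of length \<open>j\<close> and a
  \<open>j\<close>-fold power of one of length \<open>k\<close> have equal length, and powers keep
  the sign of \<open>D\<close>.\<close>

lemma common_length:
  obtains N u v where "N \<ge> 1" "u \<in> X N" "D N u > 0" "v \<in> X N" "D N v < 0"
proof -
  obtain j u where u: "j \<ge> 1" "u \<in> X j" "D j u > 0" using large unfolding D_def by blast
  obtain k v where v: "k \<ge> 1" "v \<in> X k" "D k v < 0" using small unfolding D_def by blast
  obtain u' where u': "u' \<in> X (j * k)" "D (j * k) u' = real k * D j u" using D_power[OF u(1,2) v(1)] by blast
  obtain v' where v': "v' \<in> X (k * j)" "D (k * j) v' = real j * D k v" using D_power[OF v(1,2) u(1)] by blast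
  show ?thesis
  proof (rule that)
    show "j * k \<ge> 1" using u(1) v(1) by (simp add: Suc_le_eq)
    show "u' \<in> X (j * k)" "v' \<in> X (j * k)" using u'(1) v'(1) by (auto simp: mult.commute)
    show "D (j * k) u' > 0" using u'(2) u(3) v(1) by simp
    show "D (j * k) v' < 0" using v'(2) v(3) u(1) by (simp add: mult.commute mult_pos_neg)
  qed
qed

lemma g_ge:
  assumes "w \<in> X k"
  shows "ln (g k q) \<ge> q * D k w"
proof -
  have "exp (q * D k w) \<le> g k q" unfolding g_def using assms by (intro member_le_sum) auto
  then have "ln (exp (q * D k w)) \<le> ln (g k q)" by (intro ln_mono) auto
  then show ?thesis by simp
qed

text \<open>For either sign of \<open>q\<close>, one of \<open>u\<close>, \<open>v\<close> has
  \<open>q * D \<ge> 0\<close>, and its summand alone makes \<open>g\<close> at least 1.\<close>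

lemma \<Lambda>_nonneg: "\<Lambda> q \<ge> 0"
proof -
  obtain N u v where N: "N \<ge> 1" "u \<in> X N" "D N u > 0" "v \<in> X N" "D N v < 0" by (rule common_length)
  have "ln (g N q) \<ge> 0"
  proof (cases "q \<ge> 0")
    case True
    then show ?thesis using g_ge[OF N(2), of q] N(3) by (smt (verit) mult_nonneg_nonneg)
  next
    case False
    then show ?thesis using g_ge[OF N(4), of q] N(5) by (smt (verit) mult_neg_neg)
  qed
  moreover have "ln (Z N q) \<le> P q * real N" using P_upper[OF N(1), of q] N(1) by (simp add: field_simps)
  ultimately have "0 \<le> \<Lambda> q * real N" unfolding ln_g[OF N(1)] \<Lambda>_def by (simp add: algebra_simps)
  then show ?thesis using N(1) by (simp add: zero_le_mult_iff)
qed

text \<open>Dini's theorem along the lengths \<open>M * 2 ^ n\<close>, on which the normalised logarithms increase.\<close>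

lemma uniform_growth:
  assumes c: "\<And>q. c < \<Lambda> q"
  obtains N u v where "N \<ge> 1" "u \<in> X N" "D N u > 0" "v \<in> X N" "D N v < 0"
    "\<And>q. ln (g N q) \<ge> c * real N"
proof -
  obtain M u v where M: "M \<ge> 1" "u \<in> X M" "D M u > 0" "v \<in> X M" "D M v < 0" by (rule common_length)
  define f where "f n q = ln (g (M * 2 ^ n) q) / real (M * 2 ^ n)" for n q
  have M2: "M * 2 ^ n \<ge> 1" for n using M(1) by (simp add: Suc_le_eq)
  have f_eq: "f n q = q * \<alpha> * ln (real d) + ln (Z (M * 2 ^ n) q) / real (M * 2 ^ n)" for n q
    unfolding f_def ln_g[OF M2] using M2[of n] M(1) by (simp add: field_simps)
  have mono1: "f n q \<le> f (Suc n) q" for n q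
  proof -
    let ?K = "M * 2 ^ n"
    have K: "M * 2 ^ Suc n = ?K + ?K" by simp
    have "ln (Z ?K q) / real ?K = (ln (Z ?K q) + ln (Z ?K q)) / real (?K + ?K)"
      using M(1) by simp
    also have "\<dots> \<le> ln (Z (?K + ?K) q) / real (?K + ?K)"
      using ln_Z_super[OF M2[of n] M2[of n], of q] by (intro divide_right_mono) auto
    finally show ?thesis unfolding f_eq K by simp
  qed
  have mono: "f n q \<le> f n' q" if "n \<le> n'" for n n' q
    using lift_Suc_mono_le[of "\<lambda>n. f n q"] mono1 that by blast
  have lim: "(\<lambda>n. f n q) \<longlonglongrightarrow> \<Lambda> q" for q
  proof -
    have "strict_mono (\<lambda>n. M * 2 ^ n)" using M(1) by (auto simp: strict_mono_def)
    from LIMSEQ_subseq_LIMSEQ[OF P_limit this, of q]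
    show ?thesis unfolding f_eq \<Lambda>_def by (intro tendsto_add tendsto_const) (simp add: o_def)
  qed
  have cont: "isCont (f n) q" for n q
  proof -
    have "g (M * 2 ^ n) q > 0" using Z_pos[OF M2[of n], of q] g_Z[OF M2[of n], of q] by simp
    then show ?thesis unfolding f_def[abs_def] g_def
      using M2[of n] by (intro continuous_intros) (auto simp: g_def)
  qed
  have "\<exists>n. \<forall>q. f n q \<ge> c"
  proof (rule ccontr)
    assume "\<nexists>n. \<forall>q. f n q \<ge> c"
    then obtain Q where Q: "\<And>n. f n (Q n) < c" by (metis not_le)
    \<comment> \<open>By monotonicity each \<open>Q n\<close> is already bad at length
      \<open>M\<close>, where \<open>u\<close> and \<open>v\<close> confine it to a compact
      interval.\<close>
    have Q0: "f 0 (Q n) < c" for n using mono[of 0 n "Q n"] Q[of n] by simp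
    have bnd: "Q n * D M w < c * real M" if "w \<in> X M" for n w
    proof -
      have "ln (g M (Q n)) < c * real M" using Q0[of n] M(1) by (simp add: f_def field_simps)
      then show ?thesis using g_ge[OF that, of "Q n"] by linarith
    qed
    have "Q n \<in> {c * real M / D M v .. c * real M / D M u}" for n
      using bnd[OF M(2), of n] bnd[OF M(4), of n] M(3,5) by (auto simp: field_simps less_imp_le)
    then obtain l r where lr: "strict_mono r" "(Q \<circ> r) \<longlonglongrightarrow> l"
      using compact_imp_seq_compact[OF compact_Icc] unfolding seq_compact_def by metis
    \<comment> \<open>For fixed \<open>n\<close>, late members of the subsequence are bad at an
      index above \<open>n\<close>, hence at \<open>n\<close>. Continuity passes this to the limit
      point \<open>l\<close>, contradicting \<open>c < \<Lambda> l\<close>.\<close>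
    have "f n l \<le> c" for n
    proof (rule LIMSEQ_le_const2)
      show "(\<lambda>j. f n ((Q \<circ> r) j)) \<longlonglongrightarrow> f n l" using cont lr(2) by (rule isCont_tendsto_compose)
      have "f n ((Q \<circ> r) j) \<le> c" if "j \<ge> n" for j
      proof -
        have "n \<le> r j" using seq_suble[OF lr(1), of j] that by simp
        then show ?thesis using mono[of n "r j" "Q (r j)"] Q[of "r j"] by simp
      qed
      then show "\<exists>N. \<forall>j\<ge>N. f n ((Q \<circ> r) j) \<le> c" by blast
    qed
    then have "\<Lambda> l \<le> c" by (intro LIMSEQ_le_const2[OF lim]) blast
    then show False using c[of l] by simp
  qed
  then obtain n where n: "\<And>q. f n q \<ge> c" by blast
  obtain u' where u': "u' \<in> X (M * 2 ^ n)" "D (M * 2 ^ n) u' = real (2 ^ n) * D M u"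
    using D_power[OF M(1,2), of "2 ^ n"] by auto
  obtain v' where v': "v' \<in> X (M * 2 ^ n)" "D (M * 2 ^ n) v' = real (2 ^ n) * D M v"
    using D_power[OF M(1,4), of "2 ^ n"] by auto
  show ?thesis
  proof (rule that[OF M2 u'(1) _ v'(1)])
    show "D (M * 2 ^ n) u' > 0" "D (M * 2 ^ n) v' < 0"
      using u'(2) v'(2) M(3,5) by (auto simp: mult_pos_neg)
    show "c * real (M * 2 ^ n) \<le> ln (g (M * 2 ^ n) q)" for q
      using n[of q] M2[of n] M(1) by (simp add: f_def field_simps)
  qed
qed

end

section \<open>The self-similar measure\<close>

context barrier_system
begin

definition \<xi> :: real where "\<xi> = real m / (real d - 1)"

lemma L_xi: "real_of_int (L k) = \<xi> * (real d ^ k - 1)"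
proof -
  have "real_of_int ((int d - 1) * L k) = real_of_int (int m * (int d ^ k - 1))"
    unfolding Lv_closed ..
  then show ?thesis using d3 by (simp add: \<xi>_def field_simps)
qed

text \<open>Relative to its own cell \<open>{0..\<xi>}\<close>, a point whose expansion goes on with
  \<open>b\<close> lies between \<open>b / d\<close> and \<open>(b + \<xi>) / d\<close>. The last
  two inequalities keep this window off the neighbouring cells, which end at
  \<open>\<xi> - 1\<close> and start at 1.\<close>

lemma xi_bounds: "1 < \<xi>" "\<xi> < 2" "(real b + \<xi>) / real d < 1" "\<xi> - 1 < real b / real d"
proof -
  have d1: "real d - 1 > 0" using d3 by simp
  show "1 < \<xi>" unfolding \<xi>_def using md d1 by (simp add: field_simps)
  show "\<xi> < 2" unfolding \<xi>_def using m_less d1 by (simp add: field_simps)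
  have "real_of_int ((int d - 1) * int b + int m) < real_of_int (int d * (int d - 1))"
    using bar1 by (simp only: of_int_less_iff)
  then show "(real b + \<xi>) / real d < 1" unfolding \<xi>_def using d1 by (simp add: field_simps)
  have "real_of_int (int m * int d) < real_of_int ((int b + int d) * (int d - 1))"
    using bar2 by (simp only: of_int_less_iff)
  then show "\<xi> - 1 < real b / real d" unfolding \<xi>_def using d1 by (simp add: field_simps)
qed

end

locale barrier_measure = barrier_system +
  fixes \<mu> :: "real measure"
  assumes sets_mu: "sets \<mu> = sets borel" and mu_prob: "emeasure \<mu> (space \<mu>) = 1"
    and mu_compact: "\<exists>K. compact K \<and> emeasure \<mu> K = 1"
    and mu_ss: "\<forall>A\<in>sets borel. emeasure \<mu> A =
        (\<Sum>i\<le>m. ennreal (p i) * emeasure \<mu> ((\<lambda>x. real d * x - real i) ` A))"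
begin

sublocale finite_measure \<mu>
  by (rule finite_measureI) (simp add: mu_prob)

lemma space_mu: "space \<mu> = UNIV"
  using sets_eq_imp_space_eq[OF sets_mu] by simp

lemma affine_image_borel:
  fixes A :: "real set"
  assumes "A \<in> sets borel" "r > 0"
  shows "(\<lambda>x. r * x - c) ` A \<in> sets borel"
proof -
  have "(\<lambda>x. r * x - c) ` A = (\<lambda>y. (y + c) / r) -` A \<inter> space borel"
    using assms(2) by (auto simp: image_iff field_simps intro!: bexI[of _ "(_ + c) / r"])
  also have "\<dots> \<in> sets borel"
    using assms(1) by (intro measurable_sets[of _ borel borel]) auto
  finally show ?thesis .
qed

lemma measure_ss:
  assumes "A \<in> sets borel"
  shows "measure \<mu> A = (\<Sum>i\<le>m. p i * measure \<mu> ((\<lambda>x. real d * x - real i) ` A))"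
proof -
  have "ennreal (measure \<mu> A) = (\<Sum>i\<le>m. ennreal (p i) * ennreal (measure \<mu> ((\<lambda>x. real d * x - real i) ` A)))"
    using mu_ss assms by (simp add: emeasure_eq_measure[symmetric])
  also have "\<dots> = (\<Sum>i\<le>m. ennreal (p i * measure \<mu> ((\<lambda>x. real d * x - real i) ` A)))"
    using ppos by (intro sum.cong refl) (simp add: ennreal_mult less_imp_le)
  also have "\<dots> = ennreal (\<Sum>i\<le>m. p i * measure \<mu> ((\<lambda>x. real d * x - real i) ` A))"
    using ppos by (intro sum_ennreal) (simp add: less_imp_le)
  finally show ?thesis
    using ppos by (subst (asm) ennreal_inj) (auto intro!: sum_nonneg simp: less_imp_le)
qed

lemma measure_words:
  assumes "A \<in> sets borel"
  shows "measure \<mu> A = (\<Sum>\<sigma>\<in>words m k. pw p \<sigma> * measure \<mu> ((\<lambda>x. real d ^ k * x - real_of_int (val d \<sigma>)) ` A))"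
  using assms
proof (induction k arbitrary: A)
  case 0
  then show ?case by simp
next
  case (Suc k)
  have inj: "inj_on (\<lambda>(x, xs). x # xs) ({0..m} \<times> words m k)"
    by (auto simp: inj_on_def)
  have "measure \<mu> A = (\<Sum>i\<le>m. p i * measure \<mu> ((\<lambda>x. real d * x - real i) ` A))"
    using Suc.prems by (rule measure_ss)
  also have "\<dots> = (\<Sum>i\<le>m. \<Sum>\<sigma>\<in>words m k. pw p (i # \<sigma>) *
      measure \<mu> ((\<lambda>x. real d ^ Suc k * x - real_of_int (val d (i # \<sigma>))) ` A))"
  proof (rule sum.cong[OF refl])
    fix i
    have "(\<lambda>x. real d * x - real i) ` A \<in> sets borel"
      using Suc.prems by (intro affine_image_borel) auto
    from Suc.IH[OF this]
    have "p i * measure \<mu> ((\<lambda>x. real d * x - real i) ` A) = (\<Sum>\<sigma>\<in>words m k. p i * (pw p \<sigma> *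
      measure \<mu> ((\<lambda>x. real d ^ k * x - real_of_int (val d \<sigma>)) ` (\<lambda>x. real d * x - real i) ` A)))"
      by (simp add: sum_distrib_left)
    also have "\<dots> = (\<Sum>\<sigma>\<in>words m k. pw p (i # \<sigma>) *
      measure \<mu> ((\<lambda>x. real d ^ Suc k * x - real_of_int (val d (i # \<sigma>))) ` A))"
    proof (rule sum.cong[OF refl])
      fix \<sigma> assume "\<sigma> \<in> words m k"
      then have "length \<sigma> = k" by (simp add: words_def)
      then have "(\<lambda>x. real d ^ k * x - real_of_int (val d \<sigma>)) ` (\<lambda>x. real d * x - real i) ` A
        = (\<lambda>x. real d ^ Suc k * x - real_of_int (val d (i # \<sigma>))) ` A"
        unfolding image_image by (intro image_cong refl) (simp add: algebra_simps)
      then show "p i * (pw p \<sigma> * measure \<mu> ((\<lambda>x. real d ^ k * x - real_of_int (val d \<sigma>)) ` (\<lambda>x. real d * x - real i) ` A))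
        = pw p (i # \<sigma>) * measure \<mu> ((\<lambda>x. real d ^ Suc k * x - real_of_int (val d (i # \<sigma>))) ` A)"
        by simp
    qed
    finally show "p i * measure \<mu> ((\<lambda>x. real d * x - real i) ` A) = \<dots>" by simp
  qed
  also have "\<dots> = (\<Sum>\<sigma>\<in>words m (Suc k). pw p \<sigma> *
      measure \<mu> ((\<lambda>x. real d ^ Suc k * x - real_of_int (val d \<sigma>)) ` A))"
    unfolding words_Suc by (subst sum.reindex[OF inj])
      (simp add: sum.cartesian_product case_prod_unfold atLeast0AtMost)
  finally show ?case .
qed

lemma measure_cells:
  assumes "A \<in> sets borel"
  shows "measure \<mu> A = (\<Sum>n=0..L k. h k n * measure \<mu> ((\<lambda>x. real d ^ k * x - real_of_int n) ` A))"
  unfolding measure_words[OF assms, of k] by (rule sum_pw_words)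

text \<open>The compact carrier gives some bound \<open>R\<close>. Points farther than
  \<open>e\<close> from \<open>{0..\<xi>}\<close> are sent beyond \<open>R\<close> by every
  magnification by a large enough \<open>d ^ k\<close>, so they have no mass; then \<open>e\<close>
  runs through a null sequence.\<close>

lemma measure_outside: "measure \<mu> (- {0..\<xi>}) = 0"
proof -
  obtain K where K: "compact K" "emeasure \<mu> K = 1" using mu_compact by blast
  obtain R where R: "R > 0" "\<And>x. x \<in> K \<Longrightarrow> \<bar>x\<bar> \<le> R"
    using compact_imp_bounded[OF K(1)] unfolding bounded_pos by auto
  have KS: "K \<in> sets \<mu>" unfolding sets_mu using K(1) by (simp add: compact_imp_closed)
  have "measure \<mu> (space \<mu> - K) = 0"
    unfolding finite_measure_compl[OF KS] using K(2) mu_prob by (simp add: measure_def)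
  then have R0: "measure \<mu> A = 0" if "\<And>x. x \<in> A \<Longrightarrow> \<bar>x\<bar> > R" for A
  proof -
    have "A \<subseteq> space \<mu> - K" using that R(2) by (fastforce simp: space_mu)
    then have "measure \<mu> A \<le> measure \<mu> (space \<mu> - K)"
      using KS by (intro finite_measure_mono) auto
    then show ?thesis using \<open>measure \<mu> (space \<mu> - K) = 0\<close> measure_nonneg[of \<mu> A] by linarith
  qed
  have e0: "{..<-e} \<union> {\<xi> + e<..} \<in> null_sets \<mu>" if "e > 0" for e
  proof -
    let ?A = "{..<-e} \<union> {\<xi> + e<..}"
    have A: "?A \<in> sets borel" by simp
    obtain k where k: "R / e < real d ^ k"
      using real_arch_pow[of "real d" "R / e"] d3 by auto
    then have Re: "R < e * real d ^ k" using that by (simp add: field_simps)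
    have "measure \<mu> ?A = (\<Sum>n=0..L k. h k n * measure \<mu> ((\<lambda>x. real d ^ k * x - real_of_int n) ` ?A))"
      by (rule measure_cells[OF A])
    also have "\<dots> = 0"
    proof (intro sum.neutral ballI)
      fix n assume n: "n \<in> {0..L k}"
      have "real_of_int n \<le> real_of_int (L k)" using n by simp
      also have "\<dots> \<le> \<xi> * real d ^ k" unfolding L_xi using xi_bounds by (simp add: algebra_simps)
      finally have nx: "real_of_int n \<le> \<xi> * real d ^ k" .
      have "measure \<mu> ((\<lambda>x. real d ^ k * x - real_of_int n) ` ?A) = 0"
      proof (rule R0)
        fix y assume "y \<in> (\<lambda>x. real d ^ k * x - real_of_int n) ` ?A"
        then obtain x where x: "y = real d ^ k * x - real_of_int n" "x < -e \<or> x > \<xi> + e" by auto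
        from x(2) show "\<bar>y\<bar> > R"
        proof
          assume "x < - e"
          then have "real d ^ k * x < real d ^ k * (- e)" by (intro mult_strict_left_mono) auto
          moreover have "real_of_int n \<ge> 0" using n by simp
          ultimately have "y < - (e * real d ^ k)" unfolding x(1) by (simp add: mult.commute)
          then show ?thesis using Re by linarith
        next
          assume "x > \<xi> + e"
          then have "real d ^ k * x > real d ^ k * (\<xi> + e)" by (intro mult_strict_left_mono) auto
          then have "y > e * real d ^ k" unfolding x(1) using nx by (simp add: algebra_simps)
          then show ?thesis using Re by linarith
        qed
      qed
      then show "h k n * measure \<mu> ((\<lambda>x. real d ^ k * x - real_of_int n) ` ?A) = 0" by simp
    qed
    finally show ?thesis using A by (intro null_setsI) (auto simp: emeasure_eq_measure sets_mu)
  qed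
  have "(\<Union>n::nat. {..<- (1 / real (Suc n))} \<union> {\<xi> + 1 / real (Suc n)<..}) \<in> null_sets \<mu>"
    by (intro null_sets_UN e0) auto
  moreover have "(\<Union>n::nat. {..<- (1 / real (Suc n))} \<union> {\<xi> + 1 / real (Suc n)<..}) = - {0..\<xi>}"
  proof (intro equalityI subsetI)
    fix x assume "x \<in> - {0..\<xi>}"
    then have "max (- x) (x - \<xi>) > 0" by auto
    then obtain n :: nat where n: "inverse (real (Suc n)) < max (- x) (x - \<xi>)"
      using reals_Archimedean by blast
    then have "x < - (1 / real (Suc n)) \<or> x > \<xi> + 1 / real (Suc n)"
      by (auto simp: max_def inverse_eq_divide split: if_splits)
    then show "x \<in> (\<Union>n::nat. {..<- (1 / real (Suc n))} \<union> {\<xi> + 1 / real (Suc n)<..})" by blast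
  next
    fix x assume "x \<in> (\<Union>n::nat. {..<- (1 / real (Suc n))} \<union> {\<xi> + 1 / real (Suc n)<..})"
    then obtain n :: nat where "x < - (1 / real (Suc n)) \<or> x > \<xi> + 1 / real (Suc n)" by auto
    moreover have "1 / real (Suc n) > 0" by simp
    ultimately have "x < 0 \<or> \<xi> < x" by linarith
    then show "x \<in> - {0..\<xi>}" by auto
  qed
  ultimately show ?thesis by (simp add: null_sets_def measure_def)
qed

lemma measure_inside:
  assumes "A \<in> sets borel" "{0..\<xi>} \<subseteq> A"
  shows "measure \<mu> A = 1"
proof -
  have "measure \<mu> (- A) \<le> measure \<mu> (- {0..\<xi>})"
    using assms by (intro finite_measure_mono) (auto simp: sets_mu)
  then have "measure \<mu> (space \<mu> - A) = 0"
    unfolding measure_outside space_mu Compl_eq_Diff_UNIV[symmetric]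
    using measure_nonneg[of \<mu> "- A"] by linarith
  moreover have "measure \<mu> (space \<mu>) = 1" using mu_prob by (simp add: measure_def)
  ultimately show ?thesis using assms(1) by (simp add: finite_measure_compl sets_mu)
qed

lemma measure_disjoint:
  assumes "A \<inter> {0..\<xi>} = {}"
  shows "measure \<mu> A = 0"
proof -
  have "measure \<mu> A \<le> measure \<mu> (- {0..\<xi>})"
    using assms by (intro finite_measure_mono) (auto simp: sets_mu)
  then show ?thesis using measure_outside measure_nonneg[of \<mu> A] by linarith
qed

text \<open>The cell of \<open>n\<close> at level \<open>k\<close> reaches from
  \<open>n / d ^ k\<close> to \<open>(n + \<xi>) / d ^ k\<close>. If \<open>A\<close> contains it,
  the magnified copy of \<open>A\<close> contains \<open>{0..\<xi>}\<close> and has full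
  mass.\<close>

lemma measure_ge_cell:
  assumes A: "A \<in> sets borel"
    and sub: "\<And>y. 0 \<le> y \<Longrightarrow> y \<le> \<xi> \<Longrightarrow> (real_of_int n + y) / real d ^ k \<in> A"
  shows "h k n \<le> measure \<mu> A"
proof (cases "n \<in> {0..L k}")
  case True
  let ?B = "(\<lambda>x. real d ^ k * x - real_of_int n) ` A"
  have "{0..\<xi>} \<subseteq> ?B"
  proof
    fix y assume "y \<in> {0..\<xi>}"
    then have "(real_of_int n + y) / real d ^ k \<in> A" using sub by simp
    moreover have "y = real d ^ k * ((real_of_int n + y) / real d ^ k) - real_of_int n" by simp
    ultimately show "y \<in> ?B" by blast
  qed
  then have "measure \<mu> ?B = 1" using A by (intro measure_inside affine_image_borel) auto
  then have "h k n = h k n * measure \<mu> ?B" by simp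
  also have "\<dots> \<le> measure \<mu> A"
    unfolding measure_cells[OF A, of k] using True h_nonneg
    by (intro member_le_sum[of n "{0..L k}" "\<lambda>n. h k n * measure \<mu> ((\<lambda>x. real d ^ k * x - real_of_int n) ` A)"]) auto
  finally show ?thesis .
next
  case False
  then have "h k n = 0" by (intro H_outside) auto
  then show ?thesis by simp
qed

text \<open>A cell that misses \<open>A\<close> contributes nothing, and any other at most its
  weight.\<close>

lemma measure_le_cells:
  assumes A: "A \<in> sets borel" and S: "finite S"
    and sub: "\<And>n y. n \<notin> S \<Longrightarrow> 0 \<le> y \<Longrightarrow> y \<le> \<xi> \<Longrightarrow> (real_of_int n + y) / real d ^ k \<notin> A"
  shows "measure \<mu> A \<le> (\<Sum>n\<in>S. h k n)"
proof -
  let ?f = "\<lambda>n. h k n * measure \<mu> ((\<lambda>x. real d ^ k * x - real_of_int n) ` A)"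
  have "measure \<mu> A = sum ?f {0..L k}" by (rule measure_cells[OF A])
  also have "\<dots> = sum ?f ({0..L k} \<inter> S)"
  proof (rule sum.mono_neutral_right)
    show "\<forall>n\<in>{0..L k} - {0..L k} \<inter> S. ?f n = 0"
    proof
      fix n assume n: "n \<in> {0..L k} - {0..L k} \<inter> S"
      have "(\<lambda>x. real d ^ k * x - real_of_int n) ` A \<inter> {0..\<xi>} = {}"
      proof (rule ccontr)
        assume "(\<lambda>x. real d ^ k * x - real_of_int n) ` A \<inter> {0..\<xi>} \<noteq> {}"
        then obtain x where x: "x \<in> A" "0 \<le> real d ^ k * x - real_of_int n" "real d ^ k * x - real_of_int n \<le> \<xi>"
          by auto
        then show False using sub[of n "real d ^ k * x - real_of_int n"] n by simp
      qed
      then show "?f n = 0" by (simp add: measure_disjoint)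
    qed
  qed auto
  also have "\<dots> \<le> (\<Sum>n\<in>{0..L k} \<inter> S. h k n)"
  proof (rule sum_mono)
    fix n
    have "measure \<mu> ((\<lambda>x. real d ^ k * x - real_of_int n) ` A) \<le> measure \<mu> (space \<mu>)"
      by (rule bounded_measure)
    also have "\<dots> = 1" using mu_prob by (simp add: measure_def)
    finally show "?f n \<le> h k n" using h_nonneg by (simp add: mult_left_le)
  qed
  also have "\<dots> \<le> (\<Sum>n\<in>S. h k n)" using S h_nonneg by (intro sum_mono2) auto
  finally show ?thesis .
qed

end

section \<open>Scales and digit sets\<close>

text \<open>Division by \<open>ln r\<close>, which is unbounded as \<open>r\<close> tends to 0,
  makes a bounded error vanish.\<close>

lemma has_local_dimI:
  assumes "\<forall>\<^sub>F r in at_right 0. \<bar>ln (measure \<mu> (ball x r)) - \<alpha> * ln r\<bar> \<le> C"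
  shows "has_local_dim \<mu> x \<alpha>"
proof -
  have "filterlim (\<lambda>r::real. - ln r) at_top (at_right 0)"
    using ln_at_0 by (simp add: filterlim_uminus_at_top)
  then have lim: "((\<lambda>r::real. C / (- ln r)) \<longlongrightarrow> 0) (at_right 0)"
    by (intro tendsto_divide_0[OF tendsto_const] filterlim_at_top_imp_at_infinity)
  have "\<forall>\<^sub>F r::real in at_right 0. r < 1"
    by (rule eventually_at_right_less[THEN eventually_mono, THEN eventually_rev_mp])
       (auto simp: eventually_at_right_field intro!: exI[of _ 1])
  moreover have "\<forall>\<^sub>F r::real in at_right 0. 0 < r" by (rule eventually_at_right_less)
  ultimately have "\<forall>\<^sub>F r in at_right 0. norm (ln (measure \<mu> (ball x r)) / ln r - \<alpha>) \<le> C / (- ln r)"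
    using assms
  proof eventually_elim
    case (elim r)
    then have "ln r < 0" by simp
    then have "norm (ln (measure \<mu> (ball x r)) / ln r - \<alpha>) = \<bar>ln (measure \<mu> (ball x r)) - \<alpha> * ln r\<bar> / (- ln r)"
      by (simp add: field_simps abs_div_pos[symmetric] abs_divide[symmetric])
    also have "\<dots> \<le> C / (- ln r)" using elim \<open>ln r < 0\<close> by (intro divide_right_mono) auto
    finally show ?case .
  qed
  then have "((\<lambda>r. ln (measure \<mu> (ball x r)) / ln r - \<alpha>) \<longlongrightarrow> 0) (at_right 0)"
    using lim by (rule Lim_null_comparison)
  then show ?thesis unfolding has_local_dim_def by (simp add: LIM_zero_iff)
qed

text \<open>Geometric scales suffice: rounding puts \<open>r\<close> between some
  \<open>r1 / q ^ j\<close> and \<open>r0 / q ^ i\<close> whose logarithms differ from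
  \<open>ln r\<close> by a bounded amount. Two radii occur because balls that swallow a cell are
  larger than balls that avoid its neighbours.\<close>

lemma ln_scale_comparison:
  fixes M :: "real \<Rightarrow> real"
  assumes q: "q > 1" and r0: "r0 > 0" "r1 > 0"
    and mono: "\<And>r r'. r \<le> r' \<Longrightarrow> M r \<le> M r'"
    and low: "\<And>j. exp (- R - \<alpha> * real j * ln q) \<le> M (r1 / q ^ j)"
    and up: "\<And>j. M (r0 / q ^ j) \<le> exp (R - \<alpha> * real j * ln q)"
  shows "\<exists>C. \<forall>\<^sub>F r in at_right 0. \<bar>ln (M r) - \<alpha> * ln r\<bar> \<le> C"
proof -
  have lq: "ln q > 0" using q by simp
  have powq: "r / q ^ j = exp (ln r - real j * ln q)" if "r > 0" for r j
    using q that by (simp add: exp_diff exp_of_nat_mult)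
  define C where "C = R + \<bar>\<alpha>\<bar> * (\<bar>ln r0\<bar> + \<bar>ln r1\<bar> + ln q)"
  have "\<bar>ln (M r) - \<alpha> * ln r\<bar> \<le> C" if r: "0 < r" "r < r0" "r < r1" for r
  proof -
    define i where "i = nat \<lfloor>(ln r0 - ln r) / ln q\<rfloor>"
    define j where "j = nat \<lceil>(ln r1 - ln r) / ln q\<rceil>"
    have i1: "0 \<le> (ln r0 - ln r) / ln q" using r r0 lq by simp
    have i: "real i \<le> (ln r0 - ln r) / ln q" "(ln r0 - ln r) / ln q \<le> real i + 1"
      unfolding i_def using i1 by simp_all
    have j1: "0 \<le> (ln r1 - ln r) / ln q" using r r0 lq by simp
    have j: "real j \<ge> (ln r1 - ln r) / ln q" "(ln r1 - ln r) / ln q \<ge> real j - 1"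
      unfolding j_def using j1 by simp_all
    have i': "real i * ln q \<le> ln r0 - ln r" "ln r0 - ln r \<le> real i * ln q + ln q"
      using i lq by (simp_all add: field_simps)
    have j': "real j * ln q \<ge> ln r1 - ln r" "ln r1 - ln r \<ge> real j * ln q - ln q"
      using j lq by (simp_all add: field_simps)
    have "r = exp (ln r)" using r by simp
    also have "\<dots> \<le> r0 / q ^ i" unfolding powq[OF r0(1)] using i' by simp
    finally have ub: "M r \<le> exp (R - \<alpha> * real i * ln q)" using mono up order_trans by blast
    have "r1 / q ^ j \<le> exp (ln r)" unfolding powq[OF r0(2)] using j' by simp
    also have "\<dots> = r" using r by simp
    finally have lb: "exp (- R - \<alpha> * real j * ln q) \<le> M r" using mono low order_trans by blast
    have pos: "M r > 0" using lb exp_gt_zero by (rule less_le_trans[rotated])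
    have "ln (M r) \<le> ln (exp (R - \<alpha> * real i * ln q))" using ub pos by (intro ln_mono) auto
    then have U: "ln (M r) \<le> R - \<alpha> * (real i * ln q)" by (simp add: mult.assoc)
    have "ln (exp (- R - \<alpha> * real j * ln q)) \<le> ln (M r)" using lb by (intro ln_mono) auto
    then have Lw: "ln (M r) \<ge> - R - \<alpha> * (real j * ln q)" by (simp add: mult.assoc)
    have "\<bar>\<alpha> * (real i * ln q + ln r)\<bar> \<le> \<bar>\<alpha>\<bar> * (\<bar>ln r0\<bar> + \<bar>ln r1\<bar> + ln q)"
      unfolding abs_mult using i' by (intro mult_left_mono) linarith+
    moreover have "\<bar>\<alpha> * (real j * ln q + ln r)\<bar> \<le> \<bar>\<alpha>\<bar> * (\<bar>ln r0\<bar> + \<bar>ln r1\<bar> + ln q)"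
      unfolding abs_mult using j' by (intro mult_left_mono) linarith+
    ultimately show ?thesis using U Lw unfolding C_def distrib_left[of \<alpha>] by linarith
  qed
  then have "\<forall>\<^sub>F r in at_right 0. \<bar>ln (M r) - \<alpha> * ln r\<bar> \<le> C"
    using r0 by (auto simp: eventually_at_right_field intro!: exI[of _ "min r0 r1"])
  then show ?thesis by blast
qed

section \<open>Points and alphabets built from blocks beginning with \<open>b\<close>\<close>

context barrier_system
begin

text \<open>The cells of \<open>n j\<close> are nested, and \<open>x\<close> is the limit of their
  left ends. As every block begins with \<open>b\<close>, the position of \<open>x\<close> relative
  to each cell falls into the window of \<open>xi_bounds\<close>.\<close>

lemma nested_point:
  assumes blk: "blk \<ge> 1" and w: "\<And>j. w j \<in> X blk"
    and n0: "n 0 = 0" and nS: "\<And>j. n (Suc j) = n j * int d ^ blk + w j"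
  shows "\<exists>x. \<forall>j. real b / real d \<le> x * real d ^ (blk * j) - real_of_int (n j)
    \<and> x * real d ^ (blk * j) - real_of_int (n j) \<le> (real b + \<xi>) / real d"
proof -
  define q where "q = real d ^ blk"
  have q: "q > 0" by (simp add: q_def)
  have nS': "real_of_int (n (Suc j)) = real_of_int (n j) * q + real_of_int (w j)" for j
    unfolding nS by (simp add: q_def)
  define s where "s j = real_of_int (n j) / q ^ j" for j
  define u where "u j = (real_of_int (n j) + \<xi>) / q ^ j" for j
  have w0: "0 \<le> real_of_int (w j)" for j using X_bounds(1)[OF blk w] by simp
  have w1: "real_of_int (w j) \<le> \<xi> * (q - 1)" for j
    using X_bounds(2)[OF blk w, of j] unfolding q_def L_xi[symmetric] by simp
  have "s j \<le> s (Suc j)" for j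
  proof -
    have "s j = real_of_int (n j) * q / q ^ Suc j" using q by (simp add: s_def)
    also have "\<dots> \<le> s (Suc j)" unfolding s_def nS' using q w0 by (intro divide_right_mono) auto
    finally show ?thesis .
  qed
  then have inc: "incseq s" by (rule incseq_SucI)
  have "u (Suc j) \<le> u j" for j
  proof -
    have "u (Suc j) \<le> (real_of_int (n j) + \<xi>) * q / q ^ Suc j"
      unfolding u_def nS' using q w1[of j] by (intro divide_right_mono) (auto simp: algebra_simps)
    also have "\<dots> = u j" using q by (simp add: u_def)
    finally show ?thesis .
  qed
  then have dec: "decseq u" by (rule decseq_SucI)
  have su: "s j \<le> u j" for j unfolding s_def u_def using q xi_bounds by (intro divide_right_mono) auto
  have "s j \<le> u 0" for j using su[of j] decseqD[OF dec, of 0 j] by simp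
  then obtain x where x: "s \<longlonglongrightarrow> x" "\<And>i. s i \<le> x"
    using incseq_convergent[OF inc, of "u 0"] by blast
  have xu: "x \<le> u j" for j
  proof (rule LIMSEQ_le_const2[OF x(1)], intro exI allI impI)
    fix i assume "j \<le> i"
    then show "s i \<le> u j" using su[of i] decseqD[OF dec, of j i] by simp
  qed
  define z where "z j = x * q ^ j - real_of_int (n j)" for j
  have z: "0 \<le> z j" "z j \<le> \<xi>" for j
    using x(2)[of j] xu[of j] q unfolding z_def s_def u_def by (simp_all add: field_simps)
  \<comment> \<open>Magnifying the relative position by one block splits off the next block
    \<open>w j\<close>; its leading \<open>b\<close> then confines \<open>z j\<close>.\<close>
  have zS: "z j * q = real_of_int (w j) + z (Suc j)" for j
    unfolding z_def nS' by (simp add: algebra_simps)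
  obtain l where l: "blk = Suc l" using blk by (cases blk) auto
  let ?E = "real d ^ l"
  have qE: "q = real d * ?E" "?E > 0" by (simp_all add: q_def l)
  have "real b / real d \<le> z j \<and> z j \<le> (real b + \<xi>) / real d" for j
  proof
    have "int b * int d ^ l \<le> w j" "w j \<le> int b * int d ^ l + L l" using w[of j] by (auto simp: X_def l)
    then have "real_of_int (int b * int d ^ l) \<le> real_of_int (w j)"
       "real_of_int (w j) \<le> real_of_int (int b * int d ^ l + L l)" by (simp_all only: of_int_le_iff)
    then have wj: "real b * ?E \<le> real_of_int (w j)" "real_of_int (w j) \<le> real b * ?E + \<xi> * (?E - 1)"
      by (simp_all add: L_xi)
    have "real b * ?E \<le> (z j * real d) * ?E"
      using zS[of j] z(1)[of "Suc j"] wj(1) unfolding qE by (simp add: mult.assoc)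
    then have "real b \<le> z j * real d" using qE(2) by (simp only: mult_le_cancel_right_pos)
    then show "real b / real d \<le> z j" by (simp add: field_simps)
    have "(z j * real d) * ?E \<le> (real b + \<xi>) * ?E"
      using zS[of j] z(2)[of "Suc j"] wj(2) unfolding qE by (simp add: algebra_simps)
    then have "z j * real d \<le> real b + \<xi>" using qE(2) by (simp only: mult_le_cancel_right_pos)
    then show "z j \<le> (real b + \<xi>) / real d" by (simp add: field_simps)
  qed
  then show ?thesis unfolding z_def q_def by (auto simp: power_mult)
qed

end

context barrier_level
begin

text \<open>Typical lists of blocks of length \<open>N\<close> give about
  \<open>exp (c * N * n)\<close> words. Appending \<open>r\<close> copies of \<open>u\<close> or of
  \<open>v\<close> fixes the sign of \<open>D\<close>; both operations are injective on the same
  lists, so the two alphabets have equal size.\<close>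

lemma digit_sets:
  assumes a: "a \<ge> 0" and ac: "a = 0 \<or> (a < c \<and> (\<forall>q. c < \<Lambda> q))"
  obtains blk A B where "blk \<ge> 1" "A \<subseteq> X blk" "B \<subseteq> X blk" "card A = card B" "A \<noteq> {}"
    "real (card A) \<ge> exp (a * real blk)" "\<And>w. w \<in> A \<Longrightarrow> D blk w \<ge> 0" "\<And>w. w \<in> B \<Longrightarrow> D blk w \<le> 0"
proof (cases "a = 0")
  \<comment> \<open>At rate 0 one letter per alphabet suffices. This case yields a point of the
    level set even if the Legendre transform is 0.\<close>
  case True
  obtain N u v where N: "N \<ge> 1" "u \<in> X N" "D N u > 0" "v \<in> X N" "D N v < 0" by (rule common_length)
  show ?thesis by (rule that[of N "{u}" "{v}"]) (use N True in auto)
next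
  case False
  then have ac: "a < c" "\<And>q. c < \<Lambda> q" using ac by auto
  obtain N u v where N: "N \<ge> 1" "u \<in> X N" "D N u > 0" "v \<in> X N" "D N v < 0"
    and G: "\<And>q. ln (g N q) \<ge> c * real N" using uniform_growth[OF ac(2)] by metis
  obtain q where q: "(\<Sum>x\<in>X N. D N x * exp (q * D N x)) = 0"
    using exp_sum_critical_point[of "X N" u "D N" v] N by auto
  define \<delta> where "\<delta> = min (D N u) (- D N v)"
  have \<delta>: "\<delta> > 0" "\<delta> \<le> D N u" "\<delta> \<le> - D N v" using N by (auto simp: \<delta>_def)
  \<comment> \<open>Per block of the list, tilting loses \<open>\<bar>q\<bar> * \<epsilon>\<close>
    in the exponent, and the correction adds about \<open>\<epsilon> / \<delta>\<close> blocks that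
    must pay \<open>N * a\<close> each. With this \<open>K\<close> both losses use at most half of
    the surplus \<open>N * (c - a)\<close>.\<close>
  define K where "K = \<bar>q\<bar> + real N * a / \<delta> + 1"
  have K: "K > 0" using a \<delta> by (simp add: K_def add_nonneg_pos)
  define \<epsilon> where "\<epsilon> = real N * (c - a) / (2 * K)"
  have \<epsilon>: "\<epsilon> > 0" using N(1) ac(1) K by (simp add: \<epsilon>_def)
  have \<epsilon>K: "\<epsilon> * (\<bar>q\<bar> + real N * a / \<delta>) \<le> real N * (c - a) / 2"
  proof -
    have "\<epsilon> * (\<bar>q\<bar> + real N * a / \<delta>) \<le> \<epsilon> * K" using \<epsilon> by (simp add: K_def)
    also have "\<dots> = real N * (c - a) / 2" using K by (simp add: \<epsilon>_def)
    finally show ?thesis .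
  qed
  obtain n0 where n0: "\<And>n. n \<ge> n0 \<Longrightarrow>
    real (card {xs. set xs \<subseteq> X N \<and> length xs = n \<and> \<bar>sum_list (map (D N) xs)\<bar> \<le> \<epsilon> * real n})
      \<ge> (\<Sum>x\<in>X N. exp (q * D N x)) ^ n * exp (- \<bar>q\<bar> * \<epsilon> * real n) / 2"
    using card_typical_lists[OF finite_X X_nonempty q \<epsilon>] by blast
  have "real N * (c - a) / 2 > 0" using N(1) ac(1) by simp
  \<comment> \<open>The other half of the surplus absorbs the factor 1/2 from Chebyshev and the one
    block added by rounding up \<open>r\<close>.\<close>
  then obtain n1 :: nat where n1: "real n1 * (real N * (c - a) / 2) > ln 2 + real N * a"
    using reals_Archimedean3 by blast
  define n where "n = max (max n0 n1) 1"
  have n: "n \<ge> n0" "n \<ge> n1" "n \<ge> 1" by (auto simp: n_def)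
  have "real n1 * (real N * (c - a) / 2) \<le> real n * (real N * (c - a) / 2)"
    using n(2) N(1) ac(1) by (intro mult_right_mono) auto
  with n1 have nn: "real n * (real N * (c - a) / 2) > ln 2 + real N * a" by linarith
  \<comment> \<open>Enough copies that \<open>r * \<delta>\<close> outweighs the deviation
    \<open>\<epsilon> * n\<close>.\<close>
  define r where "r = nat \<lceil>\<epsilon> * real n / \<delta>\<rceil>"
  have r0: "0 \<le> \<epsilon> * real n / \<delta>" using \<epsilon> \<delta> by simp
  have r1: "\<epsilon> * real n / \<delta> \<le> real r" "real r \<le> \<epsilon> * real n / \<delta> + 1"
    unfolding r_def using r0 by simp_all
  have r\<delta>: "\<epsilon> * real n \<le> real r * \<delta>" using r1(1) \<delta>(1) by (simp add: field_simps)
  define T where "T = {xs. set xs \<subseteq> X N \<and> length xs = n \<and> \<bar>sum_list (map (D N) xs)\<bar> \<le> \<epsilon> * real n}"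
  define blk where "blk = N * (n + r)"
  let ?F = "\<lambda>w xs. cat N (xs @ replicate r w)"
  have F: "?F w xs \<in> X blk" "D blk (?F w xs) = sum_list (map (D N) xs) + real r * D N w"
    if "w \<in> X N" "xs \<in> T" for w xs
  proof -
    have s: "set (xs @ replicate r w) \<subseteq> X N" using that by (auto simp: T_def)
    have len: "N * length (xs @ replicate r w) = blk" using that by (simp add: T_def blk_def)
    have "xs @ replicate r w \<noteq> []" using that n(3) by (auto simp: T_def)
    then show "?F w xs \<in> X blk" using cat_props(3)[OF N(1) s] unfolding len by blast
    show "D blk (?F w xs) = sum_list (map (D N) xs) + real r * D N w"
      using cat_props(2)[OF N(1) s] unfolding len by (simp add: sum_list_replicate)
  qed
  have inj: "inj_on (?F w) T" if "w \<in> X N" for w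
  proof (rule inj_onI)
    fix xs ys assume xy: "xs \<in> T" "ys \<in> T" "?F w xs = ?F w ys"
    have "xs @ replicate r w = ys @ replicate r w"
      by (rule cat_inj[OF N(1) _ _ _ xy(3)]) (use xy that in \<open>auto simp: T_def\<close>)
    then show "xs = ys" by simp
  qed
  have cT: "real (card T) \<ge> exp (a * real blk)"
  proof -
    have gpos: "g N q > 0" using Z_pos[OF N(1), of q] g_Z[OF N(1), of q] by simp
    have "a * real blk \<le> real N * a * real n + real N * a * (\<epsilon> * real n / \<delta> + 1)"
    proof -
      have "real N * a * real r \<le> real N * a * (\<epsilon> * real n / \<delta> + 1)"
        using r1(2) a by (intro mult_left_mono) auto
      then show ?thesis by (simp add: blk_def algebra_simps)
    qed
    also have "\<dots> \<le> real n * ln (g N q) - \<bar>q\<bar> * \<epsilon> * real n - ln 2"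
    proof -
      have 1: "real n * (\<epsilon> * (\<bar>q\<bar> + real N * a / \<delta>)) \<le> real n * (real N * (c - a) / 2)"
        using \<epsilon>K by (intro mult_left_mono) auto
      have 2: "real n * (c * real N) \<le> real n * ln (g N q)" using G by (intro mult_left_mono) auto
      have 3: "real n * (\<epsilon> * (\<bar>q\<bar> + real N * a / \<delta>)) = \<bar>q\<bar> * \<epsilon> * real n + real N * a * (\<epsilon> * real n / \<delta>)"
        using \<delta> by (simp add: field_simps)
      have 4: "real n * (real N * (c - a) / 2) + real n * (real N * (c - a) / 2) = real n * (c * real N) - real N * a * real n"
        by (simp add: field_simps)
      show ?thesis using 1 2 3 4 nn unfolding distrib_left[of "real N * a"] by linarith
    qed
    finally have "exp (a * real blk) \<le> exp (real n * ln (g N q) - \<bar>q\<bar> * \<epsilon> * real n - ln 2)" by simp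
    also have "\<dots> = g N q ^ n * exp (- \<bar>q\<bar> * \<epsilon> * real n) / 2"
      using gpos by (simp add: exp_diff exp_add exp_of_nat_mult exp_minus field_simps)
    also have "\<dots> \<le> real (card T)" using n0[OF n(1)] unfolding T_def g_def .
    finally show ?thesis .
  qed
  show ?thesis
  proof (rule that[of blk "?F u ` T" "?F v ` T"])
    show "blk \<ge> 1" using N(1) n(3) by (simp add: blk_def Suc_le_eq)
    show "?F u ` T \<subseteq> X blk" "?F v ` T \<subseteq> X blk" using F(1) N by auto
    show "card (?F u ` T) = card (?F v ` T)" using inj N by (simp add: card_image)
    show "?F u ` T \<noteq> {}" using cT exp_gt_zero[of "a * real blk"] by auto
    show "real (card (?F u ` T)) \<ge> exp (a * real blk)" using cT inj N by (simp add: card_image)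
    show "D blk w \<ge> 0" if wT: "w \<in> ?F u ` T" for w
    proof -
      obtain xs where xs: "xs \<in> T" "w = ?F u xs" using wT by blast
      have "real r * \<delta> \<le> real r * D N u" using \<delta> by (intro mult_left_mono) auto
      then show ?thesis using F(2)[OF N(2) xs(1)] xs r\<delta> by (auto simp: T_def)
    qed
    show "D blk w \<le> 0" if wT: "w \<in> ?F v ` T" for w
    proof -
      obtain xs where xs: "xs \<in> T" "w = ?F v xs" using wT by blast
      have "real r * \<delta> \<le> real r * (- D N v)" using \<delta> by (intro mult_left_mono) auto
      then show ?thesis using F(2)[OF N(4) xs(1)] xs r\<delta> by (auto simp: T_def)
    qed
  qed
qed

end

section \<open>Hausdorff measure and Moran trees\<close>

text \<open>Covers are not restricted in diameter: for \<open>s > 0\<close> a small sum already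
  forces every set of the cover to be small.\<close>

definition hnull :: "real \<Rightarrow> real set \<Rightarrow> bool" where
  "hnull s E \<longleftrightarrow> (\<forall>e>0. \<exists>U :: nat \<Rightarrow> real set. E \<subseteq> (\<Union>i. U i) \<and> (\<forall>i. bounded (U i)) \<and>
     (\<Sum>i. ennreal (diameter (U i) powr s)) \<le> ennreal e)"

lemma hnull_subset: "hnull s E \<Longrightarrow> F \<subseteq> E \<Longrightarrow> hnull s F"
  unfolding hnull_def by (meson order_trans)

lemma hnull_UN:
  assumes "\<And>i::nat. hnull s (E i)"
  shows "hnull s (\<Union>i. E i)"
  unfolding hnull_def
proof (intro allI impI)
  fix e :: real assume "e > 0"
  have "\<forall>i. \<exists>U :: nat \<Rightarrow> real set. E i \<subseteq> (\<Union>j. U j) \<and> (\<forall>j. bounded (U j)) \<and>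
     (\<Sum>j. ennreal (diameter (U j) powr s)) \<le> ennreal (e * (1 / 2) ^ Suc i)"
    using assms \<open>e > 0\<close> unfolding hnull_def by simp
  then obtain U :: "nat \<Rightarrow> nat \<Rightarrow> real set" where U: "\<And>i. E i \<subseteq> (\<Union>j. U i j)" "\<And>i j. bounded (U i j)"
    "\<And>i. (\<Sum>j. ennreal (diameter (U i j) powr s)) \<le> ennreal (e * (1 / 2) ^ Suc i)"
    by metis
  define V where "V k = U (fst (prod_decode k)) (snd (prod_decode k))" for k
  have "(\<Sum>k. ennreal (diameter (V k) powr s)) = (\<Sum>i. \<Sum>j. ennreal (diameter (U i j) powr s))"
    using suminf_ennreal_2dimen[where f = "\<lambda>(i, j). ennreal (diameter (U i j) powr s)", OF refl]
    by (simp add: V_def o_def case_prod_unfold)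
  also have "\<dots> \<le> (\<Sum>i. ennreal (e * (1 / 2) ^ Suc i))"
    by (intro suminf_le U(3)) auto
  also have "\<dots> = ennreal (\<Sum>i. e * (1 / 2) ^ Suc i)"
    using \<open>e > 0\<close> sums_mult[OF power_half_series, of e]
    by (intro suminf_ennreal2) (auto dest: sums_summable)
  also have "(\<Sum>i. e * (1 / 2) ^ Suc i) = e"
    using sums_unique[OF sums_mult[OF power_half_series, of e]] by simp
  finally have "(\<Sum>k. ennreal (diameter (V k) powr s)) \<le> ennreal e" .
  moreover have "(\<Union>i. E i) \<subseteq> (\<Union>k. V k)"
  proof
    fix x assume "x \<in> (\<Union>i. E i)"
    then obtain i j where "x \<in> U i j" using U(1) by blast
    then have "x \<in> V (prod_encode (i, j))" by (simp add: V_def)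
    then show "x \<in> (\<Union>k. V k)" by blast
  qed
  moreover have "bounded (V k)" for k using U(2) by (simp add: V_def)
  ultimately show "\<exists>V :: nat \<Rightarrow> real set. (\<Union>i. E i) \<subseteq> (\<Union>k. V k) \<and> (\<forall>k. bounded (V k)) \<and>
     (\<Sum>k. ennreal (diameter (V k) powr s)) \<le> ennreal e" by blast
qed

lemma hnull_Un: "hnull s E \<Longrightarrow> hnull s F \<Longrightarrow> hnull s (E \<union> F)"
proof -
  assume "hnull s E" "hnull s F"
  then have "hnull s (\<Union>i::nat. if i = 0 then E else F)" by (intro hnull_UN) auto
  moreover have "E \<union> F \<subseteq> (\<Union>i::nat. if i = 0 then E else F)"
    by (auto intro: UN_I[of 0] UN_I[of 1])
  ultimately show ?thesis by (rule hnull_subset)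
qed

lemma hnull_cballsI:
  assumes s: "s > 0"
    and cover: "\<And>e. e > 0 \<Longrightarrow> \<exists>S r. finite S \<and> r \<ge> 0 \<and> E \<subseteq> (\<Union>c\<in>S. cball c r) \<and> real (card S) * (2 * r) powr s \<le> e"
  shows "hnull s E"
  unfolding hnull_def
proof (intro allI impI)
  fix e :: real assume "e > 0"
  then obtain S r where S: "finite S" "r \<ge> 0" "E \<subseteq> (\<Union>c\<in>S. cball c r)" "real (card S) * (2 * r) powr s \<le> e"
    using cover by blast
  obtain f where f: "bij_betw f {..<card S} S"
    using ex_bij_betw_nat_finite[OF S(1)] by (auto simp: atLeast0LessThan)
  define U where "U i = (if i < card S then cball (f i) r else {})" for i
  have "(\<Sum>i. ennreal (diameter (U i) powr s)) = (\<Sum>i<card S. ennreal (diameter (U i) powr s))"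
    by (rule suminf_finite) (auto simp: U_def)
  also have "\<dots> = (\<Sum>i<card S. ennreal ((2 * r) powr s))"
    using S(2) by (intro sum.cong) (auto simp: U_def)
  also have "\<dots> = ennreal (real (card S) * (2 * r) powr s)"
    by (simp add: ennreal_mult ennreal_of_nat_eq_real_of_nat)
  also have "\<dots> \<le> ennreal e" using S(4) by (intro ennreal_leI)
  finally have "(\<Sum>i. ennreal (diameter (U i) powr s)) \<le> ennreal e" .
  moreover have "E \<subseteq> (\<Union>i. U i)"
  proof
    fix x assume "x \<in> E"
    then obtain c where c: "c \<in> S" "x \<in> cball c r" using S(3) by blast
    then obtain i where "i < card S" "f i = c" using f unfolding bij_betw_def by (metis imageE lessThan_iff)
    then have "x \<in> U i" using c by (simp add: U_def)
    then show "x \<in> (\<Union>i. U i)" by blast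
  qed
  moreover have "bounded (U i)" for i by (simp add: U_def)
  ultimately show "\<exists>U :: nat \<Rightarrow> real set. E \<subseteq> (\<Union>i. U i) \<and> (\<forall>i. bounded (U i)) \<and>
     (\<Sum>i. ennreal (diameter (U i) powr s)) \<le> ennreal e" by blast
qed

lemma hnull_singleton: "s > 0 \<Longrightarrow> hnull s {x}"
  by (rule hnull_cballsI) (auto intro!: exI[of _ "{x}"] exI[of _ "0::real"])

lemma hnull_imp_hausdorff_measure_0:
  assumes s: "s > 0" and null: "hnull s E"
  shows "hausdorff_measure s E = 0"
proof -
  have "(INF U\<in>{U :: nat \<Rightarrow> real set. E \<subseteq> (\<Union>i. U i) \<and> (\<forall>i. bounded (U i) \<and> diameter (U i) \<le> \<delta>)}.
       (\<Sum>i. ennreal (hcontent s (U i)))) = 0" (is "?I = 0") if \<delta>: "\<delta> > 0" for \<delta>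
  proof -
    have le: "?I \<le> 0 + ennreal e" if "e > 0" for e
    proof -
      \<comment> \<open>The second bound makes each summand at most \<open>\<delta> powr s\<close>,
        hence each diameter at most \<open>\<delta>\<close>.\<close>
      define e' where "e' = min e (\<delta> powr s)"
      have "e' > 0" using \<open>e > 0\<close> \<delta> by (simp add: e'_def)
      then obtain U :: "nat \<Rightarrow> real set" where U: "E \<subseteq> (\<Union>i. U i)" "\<And>i. bounded (U i)"
        "(\<Sum>i. ennreal (diameter (U i) powr s)) \<le> ennreal e'"
        using null unfolding hnull_def by blast
      have "diameter (U i) \<le> \<delta>" for i
      proof (rule ccontr)
        assume "\<not> diameter (U i) \<le> \<delta>"
        then have "\<delta> powr s < diameter (U i) powr s"
          using \<delta> s by (intro powr_less_mono2) auto
        have "(\<Sum>j\<in>{i}. ennreal (diameter (U j) powr s)) \<le> (\<Sum>j. ennreal (diameter (U j) powr s))"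
          by (rule sum_le_suminf) auto
        then have "ennreal (diameter (U i) powr s) \<le> ennreal e'" using U(3) by (simp del: ennreal_le_iff)
        then have "diameter (U i) powr s \<le> e'" by (subst (asm) ennreal_le_iff) (use \<open>e' > 0\<close> in auto)
        with \<open>\<delta> powr s < diameter (U i) powr s\<close> show False by (simp add: e'_def)
      qed
      then have "?I \<le> (\<Sum>i. ennreal (hcontent s (U i)))"
        using U by (intro INF_lower) auto
      also have "\<dots> = (\<Sum>i. ennreal (diameter (U i) powr s))"
        using s by (intro suminf_cong) (auto simp: hcontent_def)
      also have "\<dots> \<le> ennreal e'" by (rule U(3))
      also have "\<dots> \<le> 0 + ennreal e" by (simp add: e'_def ennreal_leI)
      finally show ?thesis .
    qed
    have "?I \<le> 0" by (rule ennreal_le_epsilon) (rule le)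
    then show ?thesis by simp
  qed
  then show ?thesis unfolding hausdorff_measure_def by (intro SUP_eq_const) auto
qed

text \<open>The hypothesis makes \<open>x\<close> injective with a Hoelder inverse, so a cheap cover of \<open>E\<close>
  would yield a cover of the unit interval of Lebesgue measure less than one.\<close>

lemma hausdorff_measure_pos:
  fixes x :: "real \<Rightarrow> real"
  assumes xE: "\<And>y. y \<in> {0..<1} \<Longrightarrow> x y \<in> E" and C: "C > 0" and s: "0 < s" and s': "0 \<le> s'" "s' \<le> s"
    and hoelder: "\<And>y y'. y \<in> {0..<1} \<Longrightarrow> y' \<in> {0..<1} \<Longrightarrow> \<bar>y - y'\<bar> \<le> C * \<bar>x y - x y'\<bar> powr s"
  shows "hausdorff_measure s' E \<noteq> 0"
proof
  assume "hausdorff_measure s' E = 0"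
  then have "(INF U\<in>{U :: nat \<Rightarrow> real set. E \<subseteq> (\<Union>i. U i) \<and> (\<forall>i. bounded (U i) \<and> diameter (U i) \<le> 1)}.
       (\<Sum>i. ennreal (hcontent s' (U i)))) \<le> 0"
    unfolding hausdorff_measure_def by (intro order_trans[OF SUP_upper[of 1]]) auto
  \<comment> \<open>The unit interval will be covered by intervals of length \<open>2 * C\<close>
    times a content, so the total length stays at most 1/2.\<close>
  also have "(0 :: ennreal) < ennreal (1 / (4 * C))" using C by simp
  finally obtain U :: "nat \<Rightarrow> real set" where U: "E \<subseteq> (\<Union>i. U i)" "\<And>i. bounded (U i)" "\<And>i. diameter (U i) \<le> 1"
     "(\<Sum>i. ennreal (hcontent s' (U i))) < ennreal (1 / (4 * C))"
    unfolding INF_less_iff by auto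
  define V where "V i = {y \<in> {0..<1}. x y \<in> U i}" for i
  define y0 where "y0 i = (SOME y. y \<in> V i)" for i
  define c where "c i = C * hcontent s' (U i)" for i
  have hc: "hcontent s' W \<ge> 0" for W by (simp add: hcontent_def)
  have VI: "V i \<subseteq> {y0 i - c i .. y0 i + c i}" for i
  proof
    fix y assume y: "y \<in> V i"
    then have y0: "y0 i \<in> V i" unfolding y0_def by (rule someI)
    have xs: "x y \<in> U i" "x (y0 i) \<in> U i" using y y0 by (auto simp: V_def)
    let ?t = "\<bar>x y - x (y0 i)\<bar>"
    have t: "?t \<le> diameter (U i)" using diameter_bounded_bound[OF U(2) xs] by (simp add: dist_real_def)
    \<comment> \<open>Diameters are at most 1, so the smaller exponent gives the larger
      power.\<close>
    have "?t powr s \<le> ?t powr s'" using t U(3)[of i] s' by (intro powr_mono') auto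
    also have "?t powr s' \<le> hcontent s' (U i)"
    \<comment> \<open>At exponent 0 the power convention differs: \<open>0 powr 0\<close> is 0,
      while the content of a nonempty set is 1.\<close>
    proof (cases "s' = 0")
      case True
      then show ?thesis using xs by (auto simp: hcontent_def powr_def)
    next
      case False
      then show ?thesis using xs t s' by (auto simp: hcontent_def intro!: powr_mono2)
    qed
    finally have "C * ?t powr s \<le> c i" unfolding c_def using C by (intro mult_left_mono) auto
    then have "\<bar>y - y0 i\<bar> \<le> c i" using hoelder[of y "y0 i"] y y0 by (auto simp: V_def)
    then show "y \<in> {y0 i - c i .. y0 i + c i}" by auto
  qed
  have c0: "c i \<ge> 0" for i using C hc by (simp add: c_def)
  have "{0..<1} \<subseteq> (\<Union>i. V i)"
  proof
    fix y :: real assume y: "y \<in> {0..<1}"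
    then obtain i where "x y \<in> U i" using xE U(1) by blast
    then show "y \<in> (\<Union>i. V i)" using y by (auto simp: V_def)
  qed
  then have "{0..<1} \<subseteq> (\<Union>i. {y0 i - c i .. y0 i + c i})" using VI by blast
  then have "emeasure lborel {0..<1::real} \<le> emeasure lborel (\<Union>i. {y0 i - c i .. y0 i + c i})"
    by (intro emeasure_mono) auto
  also have "\<dots> \<le> (\<Sum>i. emeasure lborel {y0 i - c i .. y0 i + c i})"
    by (intro emeasure_subadditive_countably) auto
  also have "\<dots> = (\<Sum>i. ennreal (2 * C) * ennreal (hcontent s' (U i)))"
    using c0 C hc by (intro suminf_cong) (simp add: c_def ennreal_mult[symmetric] mult_ac)
  also have "\<dots> = ennreal (2 * C) * (\<Sum>i. ennreal (hcontent s' (U i)))" by simp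
  also have "\<dots> \<le> ennreal (2 * C) * ennreal (1 / (4 * C))" using U(4) by (intro mult_left_mono) auto
  also have "\<dots> = ennreal (1 / 2)" using C by (simp add: ennreal_mult[symmetric])
  finally have "ennreal 1 \<le> ennreal (1 / 2)" by simp
  then show False by (simp only: ennreal_le_iff)
qed

text \<open>The digit after a prefix is taken from the range of \<open>eB\<close> if the prefix has positive \<open>D\<close> and
  from the range of \<open>eA\<close> otherwise; this keeps \<open>D\<close> bounded along every branch.\<close>

locale moran_tree = barrier_level +
  fixes blk n :: nat and eA eB :: "nat \<Rightarrow> int"
  assumes blk: "blk \<ge> 1" and n1: "n \<ge> 1"
    and eA: "\<And>i. i < n \<Longrightarrow> eA i \<in> X blk" "\<And>i. i < n \<Longrightarrow> D blk (eA i) \<ge> 0" "inj_on eA {..<n}"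
    and eB: "\<And>i. i < n \<Longrightarrow> eB i \<in> X blk" "\<And>i. i < n \<Longrightarrow> D blk (eB i) \<le> 0" "inj_on eB {..<n}"
begin

definition branch :: "nat \<Rightarrow> int \<Rightarrow> nat \<Rightarrow> int" where
  "branch j v i = (if D (blk * j) v > 0 then eB i else eA i)"

primrec prefix :: "(nat \<Rightarrow> nat) \<Rightarrow> nat \<Rightarrow> int" where
  "prefix t 0 = 0"
| "prefix t (Suc j) = prefix t j * int d ^ blk + branch j (prefix t j) (t j)"

definition digit :: "real \<Rightarrow> nat \<Rightarrow> nat" where
  "digit y j = nat (\<lfloor>y * real n ^ Suc j\<rfloor> mod int n)"

lemma digit_less: "digit y j < n"
  using n1 by (simp add: digit_def nat_less_iff)

lemma branch_X: "i < n \<Longrightarrow> branch j v i \<in> X blk"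
  using eA eB by (simp add: branch_def)

lemma branch_inj: "i < n \<Longrightarrow> i' < n \<Longrightarrow> branch j v i = branch j v i' \<Longrightarrow> i = i'"
  using eA(3) eB(3) by (auto simp: branch_def inj_on_def split: if_splits)

definition R :: real where
  "R = Max ((\<lambda>w. \<bar>D blk w\<bar>) ` X blk)"

lemma D_le_R: "w \<in> X blk \<Longrightarrow> \<bar>D blk w\<bar> \<le> R"
  unfolding R_def by (intro Max_ge) auto

text \<open>A step of size at most \<open>R\<close>, never pointing away from 0 unless taken at 0,
  cannot leave the interval from \<open>- R\<close> to \<open>R\<close>.\<close>

lemma prefix_bounded:
  assumes "\<And>j. t j < n"
  shows "h (blk * j) (prefix t j) > 0 \<and> \<bar>D (blk * j) (prefix t j)\<bar> \<le> R"
proof (induction j)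
  case 0
  obtain w where "w \<in> X blk" using X_nonempty by blast
  then have "R \<ge> 0" using D_le_R[of w] by linarith
  then show ?case by (simp add: H_0 D_def)
next
  case (Suc j)
  let ?v = "prefix t j" let ?w = "branch j ?v (t j)"
  have w: "?w \<in> X blk" using branch_X assms by blast
  have k: "blk * Suc j = blk * j + blk" by simp
  have "h (blk * Suc j) (prefix t (Suc j)) > 0"
    unfolding k prefix.simps h_barrier[OF blk w] using Suc h_X_pos[OF blk w] by simp
  moreover have "D (blk * Suc j) (prefix t (Suc j)) = D (blk * j) ?v + D blk ?w"
    unfolding k prefix.simps using Suc by (intro D_append[OF blk w]) auto
  moreover have "\<bar>D blk ?w\<bar> \<le> R" using D_le_R[OF w] .
  moreover have "D (blk * j) ?v > 0 \<Longrightarrow> D blk ?w \<le> 0" "\<not> D (blk * j) ?v > 0 \<Longrightarrow> D blk ?w \<ge> 0"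
    using eA(2) eB(2) assms by (auto simp: branch_def)
  ultimately show ?case using Suc by (cases "D (blk * j) ?v > 0") auto
qed

lemma prefix_cong: "(\<And>i. i < j \<Longrightarrow> t i = t' i) \<Longrightarrow> prefix t j = prefix t' j"
  by (induction j) auto

definition near :: "real \<Rightarrow> (nat \<Rightarrow> int) \<Rightarrow> bool" where
  "near x v \<longleftrightarrow> (\<forall>j. real b / real d \<le> x * real d ^ (blk * j) - real_of_int (v j)
    \<and> x * real d ^ (blk * j) - real_of_int (v j) \<le> (real b + \<xi>) / real d)"

definition point :: "real \<Rightarrow> real" where
  "point y = (SOME x. near x (prefix (digit y)))"

lemma point_near: "near (point y) (prefix (digit y))"
proof -
  have "\<exists>x. near x (prefix (digit y))" unfolding near_def
    by (rule nested_point[OF blk, of "\<lambda>j. branch j (prefix (digit y) j) (digit y j)"])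
       (auto intro: branch_X digit_less)
  then show ?thesis unfolding point_def by (rule someI_ex)
qed

text \<open>Let \<open>Suc j\<close> be the first scale at which the floors differ. Equal floors at
  scale \<open>j\<close> bound the distance of \<open>y\<close> and \<open>y'\<close>. Equal
  prefixes up to \<open>j\<close> select the same alphabet, so the next digits give different
  integers; both points lie in windows of width at most 2/3 beyond these integers, hence at least
  1/3 apart at that scale.\<close>

lemma point_separation:
  assumes n2: "n \<ge> 2" and y: "y \<in> {0..<1}" "y' \<in> {0..<1}" "y \<noteq> y'"
  shows "\<exists>j. \<bar>y - y'\<bar> \<le> 1 / real n ^ j \<and> \<bar>point y - point y'\<bar> \<ge> 1 / (3 * real d ^ (blk * Suc j))"
proof -
  have fl: "\<bar>y - y'\<bar> * real n ^ j < 1" if "\<lfloor>y * real n ^ j\<rfloor> = \<lfloor>y' * real n ^ j\<rfloor>" for j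
  proof -
    have "\<bar>y * real n ^ j - y' * real n ^ j\<bar> < 1" using that by linarith
    then show ?thesis by (simp add: left_diff_distrib[symmetric] abs_mult)
  qed
  obtain K where "1 / \<bar>y - y'\<bar> < real n ^ K" using real_arch_pow[of "real n"] n2 by auto
  then have "\<lfloor>y * real n ^ K\<rfloor> \<noteq> \<lfloor>y' * real n ^ K\<rfloor>" using fl[of K] y(3) by (auto simp: field_simps)
  then obtain J where J: "\<lfloor>y * real n ^ J\<rfloor> \<noteq> \<lfloor>y' * real n ^ J\<rfloor>"
    and least: "\<And>i. i < J \<Longrightarrow> \<lfloor>y * real n ^ i\<rfloor> = \<lfloor>y' * real n ^ i\<rfloor>"
    using exists_least_iff[of "\<lambda>J. \<lfloor>y * real n ^ J\<rfloor> \<noteq> \<lfloor>y' * real n ^ J\<rfloor>"] by auto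
  have "\<lfloor>y\<rfloor> = 0" "\<lfloor>y'\<rfloor> = 0" using y by (auto simp: floor_eq_iff)
  then obtain j where j: "J = Suc j" using J by (cases J) auto
  have "\<bar>y - y'\<bar> \<le> 1 / real n ^ j" using fl[OF least, of j] j n1 by (simp add: field_simps)
  moreover have "\<bar>point y - point y'\<bar> \<ge> 1 / (3 * real d ^ (blk * Suc j))"
  proof -
    have "digit y i = digit y' i" if "i < j" for i
      using least[of "Suc i"] that j by (simp add: digit_def)
    then have pre: "prefix (digit y') j = prefix (digit y) j" by (intro prefix_cong) auto
    have fd: "\<lfloor>z * real n ^ Suc j\<rfloor> div int n = \<lfloor>z * real n ^ j\<rfloor>" for z
      using floor_divide_real_eq_div[of "int n" "z * real n ^ Suc j"] n1 by simp
    have "digit y j \<noteq> digit y' j"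
    proof
      assume "digit y j = digit y' j"
      then have "\<lfloor>y * real n ^ Suc j\<rfloor> mod int n = \<lfloor>y' * real n ^ Suc j\<rfloor> mod int n"
        using n1 unfolding digit_def by (subst (asm) eq_nat_nat_iff) auto
      moreover have "\<lfloor>y * real n ^ Suc j\<rfloor> div int n = \<lfloor>y' * real n ^ Suc j\<rfloor> div int n"
        unfolding fd using least[of j] j by simp
      ultimately show False using J j by (metis div_mult_mod_eq)
    qed
    then have "branch j (prefix (digit y) j) (digit y j) \<noteq> branch j (prefix (digit y) j) (digit y' j)"
      using branch_inj digit_less by blast
    then have neq: "prefix (digit y) (Suc j) \<noteq> prefix (digit y') (Suc j)" by (simp add: pre)
    let ?v = "real_of_int (prefix (digit y) (Suc j))" let ?v' = "real_of_int (prefix (digit y') (Suc j))"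
    let ?q = "real d ^ (blk * Suc j)"
    have v1: "\<bar>?v - ?v'\<bar> \<ge> 1" using neq by linarith
    have a: "real b / real d \<le> point y * ?q - ?v" "point y * ?q - ?v \<le> (real b + \<xi>) / real d"
      "real b / real d \<le> point y' * ?q - ?v'" "point y' * ?q - ?v' \<le> (real b + \<xi>) / real d"
      using point_near[of y] point_near[of y'] unfolding near_def by blast+
    have "(real b + \<xi>) / real d - real b / real d = \<xi> / real d" by (simp add: diff_divide_distrib[symmetric])
    moreover have "\<xi> / real d \<le> 2 / 3" using xi_bounds d3 by (intro frac_le) auto
    ultimately have ul: "(real b + \<xi>) / real d - real b / real d \<le> 2 / 3" by simp
    have gap: "\<bar>x - x'\<bar> \<ge> 1 / 3"
      if "l \<le> x - v" "x - v \<le> u" "l \<le> x' - v'" "x' - v' \<le> u" "u - l \<le> 2 / 3" "\<bar>v - v'\<bar> \<ge> 1"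
      for x x' v v' l u :: real using that by linarith
    have "\<bar>point y * ?q - point y' * ?q\<bar> \<ge> 1 / 3" by (rule gap[OF a ul v1])
    then have "\<bar>point y - point y'\<bar> * ?q \<ge> 1 / 3" by (simp add: left_diff_distrib[symmetric] abs_mult)
    then show ?thesis by (simp add: field_simps)
  qed
  ultimately show ?thesis by blast
qed

text \<open>The distance in \<open>y\<close> is measured at scale \<open>j\<close>, that of the
  points one block later. The lost block accounts for the exponential factor, the separation
  constant 1/3 for \<open>3 powr s\<close>.\<close>

lemma point_hoelder:
  assumes n2: "n \<ge> 2" and s: "s > 0" and ns: "real n \<ge> exp (s * ln (real d) * real blk)"
    and y: "y \<in> {0..<1}" "y' \<in> {0..<1}"
  shows "\<bar>y - y'\<bar> \<le> (exp (s * ln (real d) * real blk) * 3 powr s) * \<bar>point y - point y'\<bar> powr s"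
proof (cases "y = y'")
  case False
  let ?q = "exp (s * ln (real d) * real blk)"
  obtain j where j: "\<bar>y - y'\<bar> \<le> 1 / real n ^ j"
     "\<bar>point y - point y'\<bar> \<ge> 1 / (3 * real d ^ (blk * Suc j))"
    using point_separation[OF n2 y False] by blast
  have "1 / real n ^ j \<le> 1 / ?q ^ j" using ns n1 by (intro divide_left_mono power_mono mult_pos_pos zero_less_power) auto
  also have "\<dots> = ?q * (1 / ?q ^ Suc j)" by simp
  also have "1 / ?q ^ Suc j = (1 / real d ^ (blk * Suc j)) powr s"
  proof -
    have "(1 / real d ^ (blk * Suc j)) powr s = exp (- (s * (real (blk * Suc j) * ln (real d))))"
      using ln_realpow[of "real d" "blk * Suc j"]
      by (simp add: powr_def ln_div del: of_nat_mult mult_Suc_right)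
    moreover have "1 / ?q ^ Suc j = exp (- (real (Suc j) * (s * ln (real d) * real blk)))"
      by (simp only: exp_of_nat_mult exp_minus inverse_eq_divide)
    moreover have "s * (real (blk * Suc j) * ln (real d)) = real (Suc j) * (s * ln (real d) * real blk)"
      by (simp only: of_nat_mult mult_ac)
    ultimately show ?thesis by (simp only:)
  qed
  also have "\<dots> \<le> (3 * \<bar>point y - point y'\<bar>) powr s"
    using j(2) s by (intro powr_mono2) (auto simp: field_simps)
  also have "\<dots> = 3 powr s * \<bar>point y - point y'\<bar> powr s" by (simp add: powr_mult)
  finally show ?thesis using j(1) by (simp add: mult.assoc)
qed simp

end

section \<open>The level set\<close>

locale barrier_multifractal = barrier_level d m b p \<alpha> + barrier_measure d m b p \<mu>
  for d m b :: nat and p :: "nat \<Rightarrow> real" and \<alpha> :: real and \<mu> :: "real measure"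
begin

definition E :: "real set" where
  "E = {x \<in> msupport \<mu>. has_local_dim \<mu> x \<alpha>}"

lemma measure_ball_mono: "r \<le> r' \<Longrightarrow> measure \<mu> (ball x r) \<le> measure \<mu> (ball x r')"
  by (intro finite_measure_mono subset_ball) (auto simp: sets_mu)

text \<open>A ball of radius \<open>2 / q ^ j\<close> contains the cell of \<open>v j\<close>, since
  \<open>\<xi> < 2\<close>, and one of radius \<open>r0 / q ^ j\<close> meets no other cell. So ball
  masses agree with the weights \<open>h\<close> up to scale, and bounded \<open>D\<close> keeps
  these within a constant of the power for \<open>\<alpha>\<close>.\<close>

lemma near_imp_E:
  assumes blk: "blk \<ge> 1"
    and near: "\<And>j. real b / real d \<le> x * real d ^ (blk * j) - real_of_int (v j)"
      "\<And>j. x * real d ^ (blk * j) - real_of_int (v j) \<le> (real b + \<xi>) / real d"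
    and v: "\<And>j. h (blk * j) (v j) > 0" "\<And>j. \<bar>D (blk * j) (v j)\<bar> \<le> R"
  shows "x \<in> E"
proof -
  define q where "q = real d ^ blk"
  have q1: "q > 1" using d3 blk unfolding q_def by (intro one_less_power) auto
  have qj: "q ^ j = real d ^ (blk * j)" for j by (simp add: q_def power_mult)
  have lnq: "ln q = real blk * ln (real d)" by (simp add: q_def ln_realpow)
  have hD: "h (blk * j) (v j) = exp (D (blk * j) (v j) - \<alpha> * real j * ln q)" for j
    using v(1)[of j] by (simp add: D_def lnq algebra_simps)
  have dist: "dist x ((real_of_int n + y) / q ^ j) * q ^ j = \<bar>x * q ^ j - (real_of_int n + y)\<bar>" for n y j
  proof -
    have "\<bar>x - (real_of_int n + y) / q ^ j\<bar> * \<bar>q ^ j\<bar> = \<bar>x * q ^ j - (real_of_int n + y)\<bar>"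
      using q1 unfolding abs_mult[symmetric] by (simp add: left_diff_distrib)
    then show ?thesis using q1 by (simp add: dist_real_def)
  qed
  \<comment> \<open>The gap between the window of \<open>xi_bounds\<close> and the two neighbouring
    cells.\<close>
  define r0 where "r0 = min (1 - (real b + \<xi>) / real d) (real b / real d - (\<xi> - 1))"
  have r0: "r0 > 0" "r0 \<le> 1 - (real b + \<xi>) / real d" "r0 \<le> real b / real d - (\<xi> - 1)"
    using xi_bounds by (auto simp: r0_def)
  have near': "real b / real d \<le> x * q ^ j - real_of_int (v j)"
      "x * q ^ j - real_of_int (v j) \<le> (real b + \<xi>) / real d" for j
    using near unfolding qj by auto
  have low: "h (blk * j) (v j) \<le> measure \<mu> (ball x (2 / q ^ j))" for j
  proof (rule measure_ge_cell)
    fix y assume y: "0 \<le> y" "y \<le> \<xi>"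
    have "real b / real d \<ge> 0" by simp
    then have "\<bar>x * q ^ j - (real_of_int (v j) + y)\<bar> < 2" using near'[of j] y xi_bounds by linarith
    then show "(real_of_int (v j) + y) / real d ^ (blk * j) \<in> ball x (2 / q ^ j)"
      unfolding dist[symmetric] using q1 by (simp add: qj field_simps)
  qed auto
  have up: "measure \<mu> (ball x (r0 / q ^ j)) \<le> h (blk * j) (v j)" for j
  proof -
    have "measure \<mu> (ball x (r0 / q ^ j)) \<le> (\<Sum>n\<in>{v j}. h (blk * j) n)"
    proof (rule measure_le_cells)
      fix n y assume n: "n \<notin> {v j}" and y: "0 \<le> y" "y \<le> \<xi>"
      have "real_of_int n \<ge> real_of_int (v j) + 1 \<or> real_of_int n \<le> real_of_int (v j) - 1"
        using n by (simp) linarith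
      then have "\<bar>x * q ^ j - (real_of_int n + y)\<bar> \<ge> r0" using near'[of j] y r0 by linarith
      then show "(real_of_int n + y) / real d ^ (blk * j) \<notin> ball x (r0 / q ^ j)"
        unfolding dist[symmetric] using q1 by (simp add: qj field_simps)
    qed auto
    then show ?thesis by simp
  qed
  have "\<exists>C. \<forall>\<^sub>F r in at_right 0. \<bar>ln (measure \<mu> (ball x r)) - \<alpha> * ln r\<bar> \<le> C"
  proof (rule ln_scale_comparison[OF q1 r0(1), of 2 "\<lambda>r. measure \<mu> (ball x r)" R])
    show "exp (- R - \<alpha> * real j * ln q) \<le> measure \<mu> (ball x (2 / q ^ j))" for j
      using v(2)[of j] by (intro order_trans[OF _ low]) (auto simp: hD)
    show "measure \<mu> (ball x (r0 / q ^ j)) \<le> exp (R - \<alpha> * real j * ln q)" for j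
      using v(2)[of j] by (intro order_trans[OF up]) (auto simp: hD)
  qed (auto intro: measure_ball_mono)
  then have "has_local_dim \<mu> x \<alpha>" by (auto intro: has_local_dimI)
  moreover have "x \<in> msupport \<mu>"
    unfolding msupport_def
  proof (intro CollectI allI impI)
    fix e :: real assume "e > 0"
    obtain j where "2 / e < q ^ j" using real_arch_pow[OF q1] by blast
    then have "2 / q ^ j \<le> e" using \<open>e > 0\<close> q1 by (simp add: field_simps)
    then have "0 < measure \<mu> (ball x e)" using measure_ball_mono[of "2 / q ^ j" e x] low[of j] v(1)[of j] by linarith
    then show "emeasure \<mu> (ball x e) > 0" by (simp add: emeasure_eq_measure)
  qed
  ultimately show ?thesis by (simp add: E_def)
qed

text \<open>The second claim is stated as \<open>s = 0\<close> because at \<open>s = 0\<close> the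
  alphabets may have a single letter, and the tree a single branch. It allows any \<open>s'\<close>
  up to \<open>s\<close>, so the zeros of the Hausdorff measure need not be known to be upward
  closed.\<close>

lemma lower_bound:
  assumes s: "s \<ge> 0" and sc: "s = 0 \<or> (s * ln (real d) < c \<and> (\<forall>q. c < \<Lambda> q))"
  shows "E \<noteq> {}" and "0 \<le> s' \<Longrightarrow> s' \<le> s \<Longrightarrow> hausdorff_measure s' E = 0 \<Longrightarrow> s = 0"
proof -
  define a where "a = s * ln (real d)"
  have a: "a \<ge> 0" "a = 0 \<or> (a < c \<and> (\<forall>q. c < \<Lambda> q))" using s sc ln_d_pos by (auto simp: a_def)
  obtain blk A B where AB: "blk \<ge> 1" "A \<subseteq> X blk" "B \<subseteq> X blk" "card A = card B" "A \<noteq> {}"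
    "real (card A) \<ge> exp (a * real blk)" "\<And>w. w \<in> A \<Longrightarrow> D blk w \<ge> 0" "\<And>w. w \<in> B \<Longrightarrow> D blk w \<le> 0"
    using digit_sets[OF a] by metis
  have fin: "finite A" "finite B" using AB finite_subset[OF _ finite_X] by auto
  obtain eA where eA: "bij_betw eA {..<card A} A"
    using ex_bij_betw_nat_finite[OF fin(1)] by (auto simp: atLeast0LessThan)
  obtain eB where eB: "bij_betw eB {..<card A} B"
    using ex_bij_betw_nat_finite[OF fin(2)] AB(4) by (auto simp: atLeast0LessThan)
  have eA': "eA i \<in> A" and eB': "eB i \<in> B" if "i < card A" for i
    using that eA eB by (auto simp: bij_betw_def)
  interpret moran_tree d m b p \<alpha> blk "card A" eA eB
  proof
    show "card A \<ge> 1" using AB(5) fin(1) by (simp add: Suc_le_eq card_gt_0_iff)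
    show "inj_on eA {..<card A}" "inj_on eB {..<card A}" using eA eB by (auto simp: bij_betw_def)
    show "eA i \<in> X blk" "D blk (eA i) \<ge> 0" if "i < card A" for i
      using eA'[OF that] AB(2,7) by auto
    show "eB i \<in> X blk" "D blk (eB i) \<le> 0" if "i < card A" for i
      using eB'[OF that] AB(3,8) by auto
  qed (rule AB(1))
  have pE: "point y \<in> E" for y
  proof (rule near_imp_E[OF AB(1)])
    show "real b / real d \<le> point y * real d ^ (blk * j) - real_of_int (prefix (digit y) j)" for j
      using point_near[of y] by (simp add: near_def)
    show "point y * real d ^ (blk * j) - real_of_int (prefix (digit y) j) \<le> (real b + \<xi>) / real d" for j
      using point_near[of y] by (simp add: near_def)
    show "h (blk * j) (prefix (digit y) j) > 0" "\<bar>D (blk * j) (prefix (digit y) j)\<bar> \<le> R" for j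
      using prefix_bounded[of "digit y" j] digit_less by blast+
  qed
  then show "E \<noteq> {}" by blast
  assume s': "0 \<le> s'" "s' \<le> s" "hausdorff_measure s' E = 0"
  show "s = 0"
  proof (rule ccontr)
    assume "s \<noteq> 0"
    then have s0: "s > 0" using s by simp
    then have "exp (a * real blk) > 1" using ln_d_pos AB(1) by (simp add: a_def)
    \<comment> \<open>The coding separates points only in base at least 2; this is where
      \<open>s > 0\<close> enters.\<close>
    then have n2: "card A \<ge> 2" using AB(6) by linarith
    have "hausdorff_measure s' E \<noteq> 0"
      using AB(6) by (intro hausdorff_measure_pos[OF pE _ s0 s'(1,2) point_hoelder[OF n2 s0]]) (auto simp: a_def)
    then show False using s'(3) by simp
  qed
qed

text \<open>Along the radii \<open>2 / d ^ k\<close> the logarithm of the radius is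
  \<open>- k * ln d\<close> up to a constant, so the local dimension becomes two-sided mass bounds
  from some level on.\<close>

lemma local_dim_scales:
  assumes x: "x \<in> E" and \<epsilon>: "\<epsilon> > 0"
  shows "\<exists>k0. \<forall>k\<ge>k0. exp (- (\<alpha> + \<epsilon>) * real k * ln (real d)) \<le> measure \<mu> (ball x (2 / real d ^ k))
     \<and> measure \<mu> (ball x (2 / real d ^ k)) \<le> exp (- (\<alpha> - \<epsilon>) * real k * ln (real d))"
proof -
  let ?r = "\<lambda>k. 2 / real d ^ k" let ?M = "\<lambda>k. measure \<mu> (ball x (?r k))"
  \<comment> \<open>Keeps \<open>ln (2 / d ^ k)\<close> away from 0 for \<open>k \<ge> 1\<close>, so
    that it can be cancelled.\<close>
  have lnd: "ln (real d) > 1"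
  proof -
    have "exp 1 < (3::real)" using e_less_272 by simp
    also have "3 \<le> real d" using d3 by simp
    finally have "ln (exp 1) < ln (real d)" using d3 by (subst ln_less_cancel_iff) auto
    then show ?thesis by simp
  qed
  have Mpos: "?M k > 0" for k
  proof -
    have "emeasure \<mu> (ball x (?r k)) > 0" using x by (simp add: E_def msupport_def)
    then show ?thesis by (simp add: emeasure_eq_measure)
  qed
  have "(\<lambda>k. 2 * inverse (real d) ^ k) \<longlonglongrightarrow> 2 * 0"
    using d3 by (intro tendsto_intros LIMSEQ_power_zero) (simp add: field_simps)
  then have "?r \<longlonglongrightarrow> 0" by (simp add: divide_inverse power_inverse)
  then have "filterlim ?r (at_right 0) sequentially"
    by (auto simp: filterlim_at intro!: always_eventually)
  then have l1: "(\<lambda>k. ln (?M k) / ln (?r k)) \<longlonglongrightarrow> \<alpha>"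
    using x unfolding E_def has_local_dim_def by (auto intro: filterlim_compose)
  have lr: "ln (?r k) = ln 2 - real k * ln (real d)" for k
    by (simp add: ln_div ln_realpow)
  have "(\<lambda>k. ln 2 / real k - ln (real d)) \<longlonglongrightarrow> 0 - ln (real d)"
    by (intro tendsto_intros lim_const_over_n)
  then have "(\<lambda>k. ln (?M k) / ln (?r k) * (ln 2 / real k - ln (real d))) \<longlonglongrightarrow> \<alpha> * (0 - ln (real d))"
    by (intro tendsto_mult l1)
  moreover have "\<forall>\<^sub>F k in sequentially. ln (?M k) / ln (?r k) * (ln 2 / real k - ln (real d)) = ln (?M k) / real k"
  proof (rule eventually_at_top_linorderI[of 1])
    fix k :: nat assume k: "k \<ge> 1"
    have "ln 2 < (1::real)" using ln_2_less_1 .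
    also have "1 < 1 * ln (real d)" using lnd by simp
    also have "\<dots> \<le> real k * ln (real d)" using k lnd d3 by (intro mult_right_mono) auto
    finally have ne: "ln (?r k) \<noteq> 0" unfolding lr by simp
    have e: "ln 2 / real k - ln (real d) = ln (?r k) / real k" unfolding lr using k by (simp add: field_simps)
    show "ln (?M k) / ln (?r k) * (ln 2 / real k - ln (real d)) = ln (?M k) / real k"
      unfolding e using ne by simp
  qed
  ultimately have "(\<lambda>k. ln (?M k) / real k) \<longlonglongrightarrow> \<alpha> * (0 - ln (real d))"
    by (rule Lim_transform_eventually)
  then have "\<forall>\<^sub>F k in sequentially. dist (ln (?M k) / real k) (\<alpha> * (0 - ln (real d))) < \<epsilon> * ln (real d)"
    using mult_pos_pos[OF \<epsilon> ln_d_pos] by (rule tendstoD)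
  then obtain k1 where k1: "\<And>k. k \<ge> k1 \<Longrightarrow> dist (ln (?M k) / real k) (\<alpha> * (0 - ln (real d))) < \<epsilon> * ln (real d)"
    unfolding eventually_sequentially by blast
  show ?thesis
  proof (intro exI allI impI)
    fix k assume k: "k \<ge> max k1 1"
    have "\<bar>ln (?M k) / real k + \<alpha> * ln (real d)\<bar> < \<epsilon> * ln (real d)"
      using k1[of k] k by (simp add: dist_real_def)
    then have "- (\<alpha> + \<epsilon>) * ln (real d) \<le> ln (?M k) / real k" "ln (?M k) / real k \<le> - (\<alpha> - \<epsilon>) * ln (real d)"
      by (auto simp: algebra_simps abs_less_iff)
    then have "- (\<alpha> + \<epsilon>) * real k * ln (real d) \<le> ln (?M k)" "ln (?M k) \<le> - (\<alpha> - \<epsilon>) * real k * ln (real d)"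
      using k by (simp_all add: field_simps)
    then have "exp (- (\<alpha> + \<epsilon>) * real k * ln (real d)) \<le> exp (ln (?M k))"
       "exp (ln (?M k)) \<le> exp (- (\<alpha> - \<epsilon>) * real k * ln (real d))" by simp_all
    then show "exp (- (\<alpha> + \<epsilon>) * real k * ln (real d)) \<le> ?M k \<and> ?M k \<le> exp (- (\<alpha> - \<epsilon>) * real k * ln (real d))"
      using Mpos[of k] by simp
  qed
qed

section \<open>Counting cells for the upper bound\<close>

lemma E_bounds: "E \<subseteq> {0..\<xi>}"
proof
  fix x assume "x \<in> E"
  then have pos: "emeasure \<mu> (ball x e) > 0" if "e > 0" for e using that by (simp add: E_def msupport_def)
  show "x \<in> {0..\<xi>}"
  proof (rule ccontr)
    assume "x \<notin> {0..\<xi>}"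
    then have "max (- x) (x - \<xi>) > 0" by auto
    moreover have "ball x (max (- x) (x - \<xi>)) \<inter> {0..\<xi>} = {}" by (auto simp: dist_real_def)
    ultimately show False using pos[of "max (- x) (x - \<xi>)"] by (simp add: emeasure_eq_measure measure_disjoint)
  qed
qed

text \<open>Superadditivity makes the limit a supremum, so the bound holds at every length without
  an error term.\<close>

lemma Z_le: "k \<ge> 1 \<Longrightarrow> Z k q \<le> exp (P q * real k)"
proof -
  assume k: "k \<ge> 1"
  then have "ln (Z k q) \<le> P q * real k" using P_upper[OF k, of q] by (simp add: field_simps)
  then have "exp (ln (Z k q)) \<le> exp (P q * real k)" by simp
  then show ?thesis using Z_pos[OF k] by simp
qed

text \<open>Markov's inequality for \<open>h k n powr q\<close>. Prepending \<open>b\<close> maps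
  the cells of level \<open>k\<close> bijectively to \<open>X (k + 1)\<close> and costs at most a
  factor \<open>pmin\<close>, so the sum is controlled by \<open>Z\<close>.\<close>

lemma card_large_cells:
  assumes q: "q \<ge> 0" and t: "t > 0"
  shows "real (card {n \<in> {0..L k}. h k n \<ge> t}) * t powr q \<le> pmin powr (- q) * exp (P q * real (k + 1))"
proof -
  let ?S = "{n \<in> {0..L k}. h k n \<ge> t}"
  have hX: "pmin * h k n \<le> h (1 + k) (int b * int d ^ k + n)" if "n \<in> {0..L k}" for n
  proof -
    have "h (1 + k) (int b * int d ^ k + n) \<ge> h 1 (int b) * h k n"
      using h_split[of n k 1 "int b"] that h_nonneg by auto
    moreover have "pmin * h k n \<le> h 1 (int b) * h k n"
      using b_le h_nonneg by (intro mult_right_mono h_1_ge) auto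
    ultimately show ?thesis by linarith
  qed
  have "real (card ?S) * t powr q = (\<Sum>n\<in>?S. t powr q)" by simp
  also have "\<dots> \<le> (\<Sum>n\<in>?S. h k n powr q)" using q t by (intro sum_mono powr_mono2) auto
  also have "\<dots> \<le> (\<Sum>n\<in>{0..L k}. h k n powr q)" by (intro sum_mono2) auto
  also have "\<dots> = pmin powr (- q) * (\<Sum>n\<in>{0..L k}. (pmin * h k n) powr q)"
    unfolding sum_distrib_left using pmin_pos h_nonneg
    by (intro sum.cong refl) (simp add: powr_mult powr_minus field_simps)
  also have "\<dots> \<le> pmin powr (- q) * (\<Sum>n\<in>{0..L k}. h (1 + k) (int b * int d ^ k + n) powr q)"
    using hX q pmin_pos h_nonneg by (intro mult_left_mono sum_mono powr_mono2) auto
  also have "(\<Sum>n\<in>{0..L k}. h (1 + k) (int b * int d ^ k + n) powr q)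
     = (\<Sum>w\<in>(\<lambda>n. int b * int d ^ k + n) ` {0..L k}. h (1 + k) w powr q)"
    by (subst sum.reindex) (auto simp: inj_on_def)
  also have "(\<lambda>n. int b * int d ^ k + n) ` {0..L k} = X (1 + k)"
    by (simp add: X_def)
  also have "(\<Sum>w\<in>X (1 + k). h (1 + k) w powr q) \<le> exp (P q * real (k + 1))"
    using Z_le[of "1 + k" q] by (simp add: Z_def)
  finally show ?thesis by (simp add: mult_left_mono)
qed

text \<open>For negative \<open>q\<close>, weights must be bounded from below. The range of
  \<open>n\<close> makes the prefix value \<open>i\<close> satisfy \<open>1 \<le> i < L j\<close>,
  so \<open>i - 1\<close>, \<open>i\<close>, \<open>i + 1\<close> are all values of words of length
  \<open>j\<close>, with weight at least \<open>pmin ^ j\<close>. Then \<open>h_split\<close>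
  dominates, term by term, the splitting with prefix \<open>b\<close>.\<close>

lemma card_small_cells:
  assumes q: "q \<le> 0" and t: "t > 0" and j: "j \<le> k"
  shows "real (card {n. int d ^ (k - j) \<le> n \<and> n < L j * int d ^ (k - j) \<and> h k n \<le> t}) * t powr q
     \<le> real_of_int (L j) * pmin powr (real j * q) * exp (P q * real (k - j + 1))"
proof -
  define l where "l = k - j"
  have k: "k = j + l" using j by (simp add: l_def)
  let ?d = "int d ^ l"
  have dl: "?d > 0" by simp
  let ?S = "{n. ?d \<le> n \<and> n < L j * ?d \<and> h k n \<le> t}"
  let ?I = "{1..L j - 1}" let ?T = "{0..L l}"
  have finS: "finite ?S" by (rule finite_subset[of _ "{?d..L j * ?d}"]) auto
  have h: "pmin ^ j * h (1 + l) (int b * ?d + y) \<le> h k (i * ?d + y)" if "i \<in> ?I" "y \<in> ?T" for i y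
  proof -
    have y: "-1 \<le> y" "y \<le> L l + 1" using that by auto
    have "h (1 + l) (int b * ?d + y) \<le> 1 * h l (y + ?d) + 1 * h l y + 1 * h l (y - ?d)"
      unfolding h_split[OF y] using h_nonneg h_le1 by (intro add_mono mult_right_mono) auto
    then have "pmin ^ j * h (1 + l) (int b * ?d + y) \<le> pmin ^ j * (1 * h l (y + ?d) + 1 * h l y + 1 * h l (y - ?d))"
      using pmin_pos by (intro mult_left_mono) auto
    also have "\<dots> = pmin ^ j * h l (y + ?d) + pmin ^ j * h l y + pmin ^ j * h l (y - ?d)"
      by (simp add: algebra_simps)
    also have "\<dots> \<le> h (j + l) (i * ?d + y)"
      unfolding h_split[OF y] using that h_nonneg by (intro add_mono mult_right_mono h_ge) auto
    finally show ?thesis by (simp add: k)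
  qed
  have sub: "?S \<subseteq> (\<lambda>(i, y). i * ?d + y) ` (?I \<times> ?T)"
  proof
    fix n assume n: "n \<in> ?S"
    have "1 * ?d \<le> n" "n < L j * ?d" using n by auto
    then have "1 \<le> n div ?d" using pos_imp_zdiv_pos_iff[OF dl, of n] by simp
    moreover have "n div ?d < L j"
    proof (rule ccontr)
      assume "\<not> n div ?d < L j"
      then have "L j * ?d \<le> n div ?d * ?d" by (intro mult_right_mono) auto
      also have "\<dots> \<le> n" using pos_mod_sign[OF dl, of n] div_mult_mod_eq[of n ?d] by linarith
      finally show False using \<open>n < L j * ?d\<close> by simp
    qed
    \<comment> \<open>By \<open>L_ge\<close> every residue modulo \<open>d ^ l\<close> is the value
      of a suffix of length \<open>l\<close>.\<close>
    moreover have "n mod ?d < ?d" using dl by simp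
    then have "n mod ?d \<le> L l" using L_ge[of l] by linarith
    moreover have "0 \<le> n mod ?d" using dl by simp
    ultimately have "(n div ?d, n mod ?d) \<in> ?I \<times> ?T" by auto
    moreover have "n = (\<lambda>(i, y). i * ?d + y) (n div ?d, n mod ?d)"
      unfolding case_prod_conv by (rule div_mult_mod_eq[symmetric])
    ultimately show "n \<in> (\<lambda>(i, y). i * ?d + y) ` (?I \<times> ?T)" by blast
  qed
  have "real (card ?S) * t powr q = (\<Sum>n\<in>?S. t powr q)" by simp
  also have "\<dots> \<le> (\<Sum>n\<in>?S. h k n powr q)"
  proof (rule sum_mono)
    fix n assume n: "n \<in> ?S"
    then obtain i y where iy: "i \<in> ?I" "y \<in> ?T" "n = i * ?d + y" using sub by fastforce
    \<comment> \<open>Positivity is essential: \<open>0 powr q\<close> is 0, so a cell of weight 0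
      would break the monotonicity of negative powers.\<close>
    have "h (1 + l) (int b * ?d + y) > 0" using iy by (intro h_X_pos X_Cons) auto
    then have "h k n > 0" using h[OF iy(1,2)] iy(3) pmin_pos by (smt (verit) mult_pos_pos zero_less_power)
    then show "t powr q \<le> h k n powr q" using n q by (intro powr_mono2') auto
  qed
  also have "\<dots> \<le> (\<Sum>n\<in>(\<lambda>(i, y). i * ?d + y) ` (?I \<times> ?T). h k n powr q)"
    using sub by (intro sum_mono2) auto
  also have "\<dots> \<le> (\<Sum>(i, y)\<in>?I \<times> ?T. h k (i * ?d + y) powr q)"
    by (rule order_trans[OF sum_image_le]) (auto simp: case_prod_unfold o_def)
  also have "\<dots> \<le> (\<Sum>(i, y)\<in>?I \<times> ?T. pmin powr (real j * q) * h (1 + l) (int b * ?d + y) powr q)"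
  proof (rule sum_mono, clarify)
    fix i y assume iy: "i \<in> ?I" "y \<in> ?T"
    have pos: "h (1 + l) (int b * ?d + y) > 0" using iy by (intro h_X_pos X_Cons) auto
    have "h k (i * ?d + y) powr q \<le> (pmin ^ j * h (1 + l) (int b * ?d + y)) powr q"
      using h[OF iy] pos pmin_pos q by (intro powr_mono2') auto
    also have "\<dots> = pmin powr (real j * q) * h (1 + l) (int b * ?d + y) powr q"
      using pmin_pos h_nonneg by (simp add: powr_mult powr_realpow[symmetric] powr_powr)
    finally show "h k (i * ?d + y) powr q \<le> \<dots>" .
  qed
  also have "\<dots> = real (card ?I) * (pmin powr (real j * q) * (\<Sum>y\<in>?T. h (1 + l) (int b * ?d + y) powr q))"
    by (simp add: sum.cartesian_product[symmetric] sum_distrib_left)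
  also have "(\<Sum>y\<in>?T. h (1 + l) (int b * ?d + y) powr q)
     = (\<Sum>w\<in>(\<lambda>n. int b * ?d + n) ` ?T. h (1 + l) w powr q)"
    by (subst sum.reindex) (auto simp: inj_on_def)
  also have "(\<lambda>n. int b * ?d + n) ` ?T = X (1 + l)" by (simp add: X_def)
  also have "real (card ?I) * (pmin powr (real j * q) * (\<Sum>w\<in>X (1 + l). h (1 + l) w powr q))
     \<le> real_of_int (L j) * (pmin powr (real j * q) * exp (P q * real (l + 1)))"
    using Z_le[of "1 + l" q] Lv_nonneg[of d m j] unfolding Z_def
    by (intro mult_mono mult_left_mono mult_nonneg_nonneg sum_nonneg) auto
  finally show ?thesis by (simp add: l_def mult.assoc)
qed

text \<open>The constant \<open>C\<close> may depend on the piece \<open>j\<close> and on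
  \<open>q\<close>, but not on \<open>k\<close>. For \<open>q \<ge> 0\<close> a ball of large mass
  has a cell of large weight nearby; for \<open>q < 0\<close> a ball of small mass contains a cell
  of small weight.\<close>

lemma piece_cover:
  assumes \<epsilon>: "\<epsilon> > 0"
  shows "\<exists>C. \<forall>k\<ge>j. \<exists>S. finite S \<and> real (card S) \<le> C * exp (real k * (\<Lambda> q + \<bar>q\<bar> * \<epsilon> * ln (real d))) \<and>
    (\<forall>x. 4 / real d ^ j \<le> x \<longrightarrow> x \<le> \<xi> - 4 / real d ^ j \<longrightarrow>
      exp (- (\<alpha> + \<epsilon>) * real k * ln (real d)) \<le> measure \<mu> (ball x (2 / real d ^ k)) \<longrightarrow>
      measure \<mu> (ball x (2 / real d ^ k)) \<le> exp (- (\<alpha> - \<epsilon>) * real k * ln (real d)) \<longrightarrow>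
      (\<exists>n\<in>S. \<bar>x - real_of_int n / real d ^ k\<bar> \<le> 5 / real d ^ k))"
proof -
  have dist: "\<bar>x - u / real d ^ k\<bar> * real d ^ k = \<bar>x * real d ^ k - u\<bar>" for x u :: real and k
  proof -
    have "\<bar>x - u / real d ^ k\<bar> * \<bar>real d ^ k\<bar> = \<bar>x * real d ^ k - u\<bar>"
      unfolding abs_mult[symmetric] by (simp add: left_diff_distrib)
    then show ?thesis by simp
  qed
  have close: "\<bar>x - real_of_int n / real d ^ k\<bar> \<le> 5 / real d ^ k" if "\<bar>x * real d ^ k - real_of_int n\<bar> \<le> 5" for x n k
    using that unfolding dist[symmetric] by (simp add: field_simps)
  show ?thesis
  proof (cases "q \<ge> 0")
    case True
    define C where "C = 9 powr q * (pmin powr (- q) * exp (P q))"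
    have "\<exists>S. finite S \<and> real (card S) \<le> C * exp (real k * (\<Lambda> q + \<bar>q\<bar> * \<epsilon> * ln (real d))) \<and>
      (\<forall>x. exp (- (\<alpha> + \<epsilon>) * real k * ln (real d)) \<le> measure \<mu> (ball x (2 / real d ^ k)) \<longrightarrow>
        (\<exists>n\<in>S. \<bar>x - real_of_int n / real d ^ k\<bar> \<le> 5 / real d ^ k))" for k
    proof -
      define a where "a = (\<alpha> + \<epsilon>) * real k * ln (real d)"
      \<comment> \<open>At most nine cells can share the mass of the ball, so one of them has at
        least a ninth of it.\<close>
      define t where "t = exp (- a) / 9"
      have t: "t > 0" by (simp add: t_def)
      let ?S = "{n \<in> {0..L k}. h k n \<ge> t}"
      have lt: "ln t = - a - ln 9" by (simp add: t_def ln_div)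
      have "q * ln t = - (q * a) - q * ln 9" unfolding lt by (simp add: right_diff_distrib)
      then have "t powr q = exp (- (q * a) - q * ln 9)" using t by (simp add: powr_def)
      then have tq: "t powr q = exp (- (q * a)) / 9 powr q" by (simp add: powr_def exp_diff)
      have "real (card ?S) * t powr q \<le> pmin powr (- q) * exp (P q * real (k + 1))"
        by (rule card_large_cells[OF True t])
      then have "real (card ?S) \<le> pmin powr (- q) * exp (P q * real (k + 1)) / t powr q"
        using t by (simp add: pos_le_divide_eq)
      also have "\<dots> = C * (exp (P q * real k) * exp (q * a))"
        unfolding tq C_def by (simp add: exp_minus exp_add algebra_simps divide_inverse)
      also have "exp (P q * real k) * exp (q * a) = exp (real k * (\<Lambda> q + \<bar>q\<bar> * \<epsilon> * ln (real d)))"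
        using True by (simp add: exp_add[symmetric] \<Lambda>_def a_def algebra_simps)
      finally have card: "real (card ?S) \<le> C * exp (real k * (\<Lambda> q + \<bar>q\<bar> * \<epsilon> * ln (real d)))" .
      have "\<exists>n\<in>?S. \<bar>x - real_of_int n / real d ^ k\<bar> \<le> 5 / real d ^ k"
        if x: "exp (- (\<alpha> + \<epsilon>) * real k * ln (real d)) \<le> measure \<mu> (ball x (2 / real d ^ k))" for x
      proof -
        \<comment> \<open>Ball radius 2 and cell length below 2 put the left end of every cell that
          meets the ball within 4 of the floor; the rounding adds 1, whence the distance 5.\<close>
        let ?f = "\<lfloor>x * real d ^ k\<rfloor>" let ?W = "{?f - 4..?f + 4}"
        have fl: "real_of_int ?f \<le> x * real d ^ k" "x * real d ^ k < real_of_int ?f + 1" by linarith+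
        have "measure \<mu> (ball x (2 / real d ^ k)) \<le> (\<Sum>n\<in>?W. h k n)"
        proof (rule measure_le_cells)
          fix n y assume n: "n \<notin> ?W" and y: "0 \<le> y" "y \<le> \<xi>"
          have "n \<le> ?f - 5 \<or> n \<ge> ?f + 5" using n by auto
          then have "real_of_int n \<le> real_of_int (?f - 5) \<or> real_of_int n \<ge> real_of_int (?f + 5)"
            by (simp only: of_int_le_iff)
          then have "\<bar>x * real d ^ k - (real_of_int n + y)\<bar> \<ge> 2"
            using y xi_bounds(2) fl by (simp only: of_int_diff of_int_add of_int_numeral) linarith
          then show "(real_of_int n + y) / real d ^ k \<notin> ball x (2 / real d ^ k)"
            unfolding dist[symmetric] by (simp add: dist_real_def field_simps)
        qed auto
        moreover have "9 * t = exp (- (\<alpha> + \<epsilon>) * real k * ln (real d))"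
          unfolding t_def a_def mult_minus_left by simp
        ultimately have ge: "9 * t \<le> (\<Sum>n\<in>?W. h k n)" using x by linarith
        have "\<exists>n\<in>?W. h k n \<ge> t"
        proof (rule ccontr)
          assume "\<not> (\<exists>n\<in>?W. h k n \<ge> t)"
          then have "h k n < t" if "n \<in> ?W" for n using that by (simp add: not_le)
          then have "(\<Sum>n\<in>?W. h k n) < (\<Sum>n\<in>?W. t)" by (intro sum_strict_mono) auto
          then show False using ge by simp
        qed
        then obtain n where n: "n \<in> ?W" "h k n \<ge> t" by blast
        have "n \<in> {0..L k}" using n(2) t H_outside[of n d m k p] by (cases "n \<in> {0..L k}") auto
        moreover have "real_of_int (?f - 4) \<le> real_of_int n" "real_of_int n \<le> real_of_int (?f + 4)"
          using n(1) by (simp_all only: of_int_le_iff atLeastAtMost_iff)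
        then have "\<bar>x * real d ^ k - real_of_int n\<bar> \<le> 5"
          using fl unfolding of_int_diff of_int_add of_int_numeral by linarith
        ultimately show ?thesis using n(2) close by blast
      qed
      moreover have "finite ?S" by (rule finite_subset[of _ "{0..L k}"]) auto
      ultimately show ?thesis using card by (intro exI[of _ ?S] conjI allI impI)
    qed
    then show ?thesis by (intro exI[of _ C]) meson
  next
    case False
    define C where "C = real_of_int (L j) * pmin powr (real j * q) * exp (P q * (1 - real j))"
    have "\<exists>S. finite S \<and> real (card S) \<le> C * exp (real k * (\<Lambda> q + \<bar>q\<bar> * \<epsilon> * ln (real d))) \<and>
      (\<forall>x. 4 / real d ^ j \<le> x \<longrightarrow> x \<le> \<xi> - 4 / real d ^ j \<longrightarrow>
        measure \<mu> (ball x (2 / real d ^ k)) \<le> exp (- (\<alpha> - \<epsilon>) * real k * ln (real d)) \<longrightarrow>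
        (\<exists>n\<in>S. \<bar>x - real_of_int n / real d ^ k\<bar> \<le> 5 / real d ^ k))" if j: "k \<ge> j" for k
    proof -
      define a where "a = (\<alpha> - \<epsilon>) * real k * ln (real d)"
      define t where "t = exp (- a)"
      have t: "t > 0" by (simp add: t_def)
      let ?S = "{n. int d ^ (k - j) \<le> n \<and> n < L j * int d ^ (k - j) \<and> h k n \<le> t}"
      have finS: "finite ?S" by (rule finite_subset[of _ "{int d ^ (k - j)..L j * int d ^ (k - j)}"]) auto
      have tq: "t powr q = exp (- (q * a))" by (simp add: t_def powr_def)
      have "real (card ?S) * t powr q \<le> real_of_int (L j) * pmin powr (real j * q) * exp (P q * real (k - j + 1))"
        using False by (intro card_small_cells t j) auto
      then have "real (card ?S) \<le> real_of_int (L j) * pmin powr (real j * q) * exp (P q * real (k - j + 1)) / t powr q"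
        using t by (simp add: pos_le_divide_eq)
      also have "\<dots> = real_of_int (L j) * pmin powr (real j * q) * (exp (P q * real (k - j + 1)) * exp (q * a))"
        unfolding tq by (simp add: exp_minus divide_inverse)
      also have "exp (P q * real (k - j + 1)) * exp (q * a)
          = exp (P q * (1 - real j)) * exp (real k * (\<Lambda> q + \<bar>q\<bar> * \<epsilon> * ln (real d)))"
        using False j by (simp add: exp_add[symmetric] \<Lambda>_def a_def of_nat_diff algebra_simps)
      finally have card: "real (card ?S) \<le> C * exp (real k * (\<Lambda> q + \<bar>q\<bar> * \<epsilon> * ln (real d)))"
        by (simp add: C_def mult.assoc)
      have "\<exists>n\<in>?S. \<bar>x - real_of_int n / real d ^ k\<bar> \<le> 5 / real d ^ k"
        if x: "4 / real d ^ j \<le> x" "x \<le> \<xi> - 4 / real d ^ j"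
          "measure \<mu> (ball x (2 / real d ^ k)) \<le> exp (- (\<alpha> - \<epsilon>) * real k * ln (real d))" for x
      proof -
        let ?f = "\<lfloor>x * real d ^ k\<rfloor>"
        have fl: "real_of_int ?f \<le> x * real d ^ k" "x * real d ^ k < real_of_int ?f + 1" by linarith+
        have split: "real d ^ k = real d ^ j * real d ^ (k - j)" using j by (simp add: power_add[symmetric])
        let ?e = "real d ^ (k - j)"
        have e1: "?e \<ge> 1" using d3 by (intro one_le_power) auto
        have "4 / real d ^ j * real d ^ k \<le> x * real d ^ k" using x(1) by (intro mult_right_mono) auto
        then have lo: "4 * ?e \<le> x * real d ^ k" unfolding split by simp
        have "x * real d ^ k \<le> (\<xi> - 4 / real d ^ j) * real d ^ k" using x(2) by (intro mult_right_mono) auto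
        then have hi: "x * real d ^ k \<le> \<xi> * real d ^ k - 4 * ?e" unfolding split by (simp add: algebra_simps)
        have "real_of_int (int d ^ (k - j)) = ?e" by simp
        then have "real_of_int (int d ^ (k - j)) \<le> real_of_int ?f" using lo fl e1 by linarith
        then have f1: "int d ^ (k - j) \<le> ?f" by (simp only: of_int_le_iff)
        \<comment> \<open>In these units the admissible range stops \<open>\<xi>\<close> times
          \<open>d ^ (k - j)\<close> short of \<open>\<xi> * d ^ k\<close>; the margin 4 of the
          piece exceeds this since \<open>\<xi> < 2\<close>.\<close>
        have "real_of_int (L j * int d ^ (k - j)) = \<xi> * real d ^ k - \<xi> * ?e"
          unfolding split by (simp add: L_xi algebra_simps)
        moreover have "\<xi> * ?e < 4 * ?e" using e1 xi_bounds(2) by (intro mult_strict_right_mono) auto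
        ultimately have "real_of_int ?f < real_of_int (L j * int d ^ (k - j))" using hi fl by linarith
        then have f2: "?f < L j * int d ^ (k - j)" by (simp only: of_int_less_iff)
        have "h k ?f \<le> measure \<mu> (ball x (2 / real d ^ k))"
        proof (rule measure_ge_cell)
          fix y assume y: "0 \<le> y" "y \<le> \<xi>"
          have "\<bar>x * real d ^ k - (real_of_int ?f + y)\<bar> < 2" using y xi_bounds fl by linarith
          then show "(real_of_int ?f + y) / real d ^ k \<in> ball x (2 / real d ^ k)"
            unfolding dist[symmetric] by (simp add: dist_real_def field_simps)
        qed auto
        moreover have "t = exp (- (\<alpha> - \<epsilon>) * real k * ln (real d))"
          unfolding t_def a_def mult_minus_left ..
        ultimately have "h k ?f \<le> t" using x(3) by linarith
        moreover have "\<bar>x * real d ^ k - real_of_int ?f\<bar> \<le> 5" using fl by linarith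
        ultimately show ?thesis using f1 f2 close by blast
      qed
      then show ?thesis using card finS by (intro exI[of _ ?S] conjI allI impI)
    qed
    then show ?thesis by (intro exI[of _ C]) meson
  qed
qed

text \<open>The surplus \<open>\<beta>\<close> is split: \<open>\<epsilon>\<close> is so small that
  the deviation in local dimension uses at most half, and the other half makes the covering sums
  decay like \<open>exp (- k * \<beta> / 2)\<close>.\<close>

lemma upper_bound:
  assumes s: "s > 0" and sq: "\<Lambda> q < s * ln (real d)"
  shows "hnull s E"
proof -
  define \<beta> where "\<beta> = s * ln (real d) - \<Lambda> q"
  have \<beta>: "\<beta> > 0" using sq by (simp add: \<beta>_def)
  define \<epsilon> where "\<epsilon> = \<beta> / (2 * (\<bar>q\<bar> + 1) * ln (real d))"
  have q1: "\<bar>q\<bar> + 1 > 0" by simp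
  have \<epsilon>: "\<epsilon> > 0" unfolding \<epsilon>_def using \<beta> ln_d_pos q1 by (intro divide_pos_pos mult_pos_pos) auto
  have q\<epsilon>: "\<bar>q\<bar> * \<epsilon> * ln (real d) \<le> \<beta> / 2"
  proof -
    have "\<bar>q\<bar> * \<epsilon> * ln (real d) = \<beta> / 2 * (\<bar>q\<bar> / (\<bar>q\<bar> + 1))"
      unfolding \<epsilon>_def using ln_d_pos q1 by (simp add: divide_simps)
    also have "\<dots> \<le> \<beta> / 2 * 1" using \<beta> by (intro mult_left_mono) (auto simp: divide_simps)
    finally show ?thesis by simp
  qed
  let ?good = "\<lambda>x k. exp (- (\<alpha> + \<epsilon>) * real k * ln (real d)) \<le> measure \<mu> (ball x (2 / real d ^ k))
     \<and> measure \<mu> (ball x (2 / real d ^ k)) \<le> exp (- (\<alpha> - \<epsilon>) * real k * ln (real d))"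
  \<comment> \<open>\<open>j\<close> measures the distance from the endpoints and \<open>k0\<close>
    the level from which the mass bounds hold. Fixing both makes the estimates uniform; the two
    endpoints are added as singletons.\<close>
  define F where "F j k0 = {x. 4 / real d ^ j \<le> x \<and> x \<le> \<xi> - 4 / real d ^ j \<and> (\<forall>k\<ge>k0. ?good x k)}" for j k0
  have "hnull s (F j k0)" for j k0
  proof (rule hnull_cballsI[OF s])
    fix e :: real assume "e > 0"
    obtain C where C: "\<And>k. k \<ge> j \<Longrightarrow> \<exists>S. finite S \<and> real (card S) \<le> C * exp (real k * (\<Lambda> q + \<bar>q\<bar> * \<epsilon> * ln (real d))) \<and>
      (\<forall>x. 4 / real d ^ j \<le> x \<longrightarrow> x \<le> \<xi> - 4 / real d ^ j \<longrightarrow>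
        exp (- (\<alpha> + \<epsilon>) * real k * ln (real d)) \<le> measure \<mu> (ball x (2 / real d ^ k)) \<longrightarrow>
        measure \<mu> (ball x (2 / real d ^ k)) \<le> exp (- (\<alpha> - \<epsilon>) * real k * ln (real d)) \<longrightarrow>
        (\<exists>n\<in>S. \<bar>x - real_of_int n / real d ^ k\<bar> \<le> 5 / real d ^ k))"
      using piece_cover[OF \<epsilon>, of j q] by blast
    define C' where "C' = \<bar>C\<bar> * 10 powr s + 1"
    have C': "C' > 0" "\<bar>C\<bar> * 10 powr s \<le> C'" by (simp_all add: C'_def add_nonneg_pos)
    obtain k1 :: nat where k1: "real k1 * (\<beta> / 2) > ln C' - ln e"
      using reals_Archimedean3[OF half_gt_zero[OF \<beta>]] by blast
    define k where "k = max (max j k0) k1"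
    have k: "k \<ge> j" "k \<ge> k0" "k \<ge> k1" by (auto simp: k_def)
    obtain S where S: "finite S" "real (card S) \<le> C * exp (real k * (\<Lambda> q + \<bar>q\<bar> * \<epsilon> * ln (real d)))"
      and cover: "\<And>x. x \<in> F j k0 \<Longrightarrow> \<exists>n\<in>S. \<bar>x - real_of_int n / real d ^ k\<bar> \<le> 5 / real d ^ k"
      using C[OF k(1)] k(2) unfolding F_def by blast
    let ?S = "(\<lambda>n. real_of_int n / real d ^ k) ` S"
    have ten: "(2 * (5 / real d ^ k)) powr s = 10 powr s * exp (- (real k * (s * ln (real d))))"
    proof -
      have "2 * (5 / real d ^ k) = 10 / real d ^ k" by simp
      then have ln10: "ln (2 * (5 / real d ^ k)) = ln 10 - real k * ln (real d)"
        using ln_div[of 10 "real d ^ k"] ln_realpow[of "real d" k] by simp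
      have "s * ln (2 * (5 / real d ^ k)) = s * ln 10 + - (real k * (s * ln (real d)))"
        unfolding ln10 by (simp add: right_diff_distrib)
      then show ?thesis unfolding powr_def by (simp add: exp_add[symmetric])
    qed
    have "real (card ?S) * (2 * (5 / real d ^ k)) powr s
      \<le> real (card S) * (10 powr s * exp (- (real k * (s * ln (real d)))))"
      unfolding ten using card_image_le[OF S(1)] by (intro mult_right_mono) auto
    also have "\<dots> \<le> (\<bar>C\<bar> * exp (real k * (\<Lambda> q + \<beta> / 2))) * (10 powr s * exp (- (real k * (s * ln (real d)))))"
    proof (intro mult_right_mono)
      have "C * exp (real k * (\<Lambda> q + \<bar>q\<bar> * \<epsilon> * ln (real d))) \<le> \<bar>C\<bar> * exp (real k * (\<Lambda> q + \<beta> / 2))"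
        using q\<epsilon> by (intro mult_mono) (auto intro!: mult_left_mono)
      then show "real (card S) \<le> \<bar>C\<bar> * exp (real k * (\<Lambda> q + \<beta> / 2))" using S(2) by linarith
    qed auto
    also have "\<dots> = (\<bar>C\<bar> * 10 powr s) * exp (- (real k * (\<beta> / 2)))"
    proof -
      have "exp (real k * (\<Lambda> q + \<beta> / 2)) * exp (- (real k * (s * ln (real d)))) = exp (- (real k * (\<beta> / 2)))"
        unfolding exp_add[symmetric] by (simp add: \<beta>_def field_simps)
      then show ?thesis by simp
    qed
    also have "\<dots> \<le> C' * exp (- (real k * (\<beta> / 2)))" using C' by (intro mult_right_mono) auto
    also have "\<dots> \<le> C' * exp (ln e - ln C')"
    proof -
      have "real k1 * (\<beta> / 2) \<le> real k * (\<beta> / 2)" using k(3) \<beta> by (intro mult_right_mono) auto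
      then show ?thesis using k1 C' by (intro mult_left_mono) auto
    qed
    also have "\<dots> = e" using C' \<open>e > 0\<close> by (simp add: exp_diff)
    finally have "real (card ?S) * (2 * (5 / real d ^ k)) powr s \<le> e" .
    moreover have "F j k0 \<subseteq> (\<Union>c\<in>?S. cball c (5 / real d ^ k))"
    proof
      fix x assume "x \<in> F j k0"
      then obtain n where "n \<in> S" "\<bar>x - real_of_int n / real d ^ k\<bar> \<le> 5 / real d ^ k" using cover by blast
      then show "x \<in> (\<Union>c\<in>?S. cball c (5 / real d ^ k))"
        by (auto simp: dist_real_def abs_minus_commute)
    qed
    ultimately show "\<exists>S r. finite S \<and> r \<ge> 0 \<and> F j k0 \<subseteq> (\<Union>c\<in>S. cball c r) \<and> real (card S) * (2 * r) powr s \<le> e"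
      using S(1) by (intro exI[of _ ?S] exI[of _ "5 / real d ^ k"]) auto
  qed
  then have "hnull s (({0} \<union> {\<xi>}) \<union> (\<Union>j. \<Union>k0. F j k0))"
    by (intro hnull_Un hnull_UN hnull_singleton s)
  moreover have "E \<subseteq> ({0} \<union> {\<xi>}) \<union> (\<Union>j. \<Union>k0. F j k0)"
  proof
    fix x assume x: "x \<in> E"
    show "x \<in> ({0} \<union> {\<xi>}) \<union> (\<Union>j. \<Union>k0. F j k0)"
    proof (cases "x = 0 \<or> x = \<xi>")
      case False
      define \<delta> where "\<delta> = min x (\<xi> - x)"
      have \<delta>: "\<delta> > 0" "\<delta> \<le> x" "\<delta> \<le> \<xi> - x" using False x E_bounds by (force simp: \<delta>_def)+
      obtain j where "4 / \<delta> < real d ^ j"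
        using real_arch_pow[of "real d"] d3 by auto
      then have "4 / real d ^ j < \<delta>" using \<delta>(1) by (simp add: field_simps)
      then have "4 / real d ^ j \<le> x" "x \<le> \<xi> - 4 / real d ^ j" using \<delta> by linarith+
      moreover obtain k0 where "\<forall>k\<ge>k0. ?good x k" using local_dim_scales[OF x \<epsilon>] by blast
      ultimately have "x \<in> F j k0" by (simp add: F_def)
      then show ?thesis by blast
    qed auto
  qed
  ultimately show ?thesis by (rule hnull_subset)
qed

text \<open>If the dimension were smaller than the infimum, numbers \<open>s < c\<close> would fit
  strictly between them. Then \<open>c\<close> lies below all \<open>\<Lambda> q / ln d\<close> at
  once, as the construction requires, and some \<open>s' < s\<close> has Hausdorff measure 0. This
  forces \<open>s = 0\<close> and so \<open>s' < 0\<close>, a contradiction.\<close>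

lemma hausdorff_dim_E: "hausdorff_dim E = (INF q. ereal (\<Lambda> q / ln (real d)))"
proof (rule antisym)
  let ?T = "{s. 0 \<le> s \<and> hausdorff_measure s E = 0}"
  have ne: "E \<noteq> {}" using lower_bound(1)[of 0] by simp
  have dim: "hausdorff_dim E = ereal (Inf ?T)" using ne by (simp add: hausdorff_dim_def)
  have bdd: "bdd_below ?T" by (rule bdd_belowI[of _ 0]) auto
  have inT: "s \<in> ?T" if "\<Lambda> q / ln (real d) < s" for s q
  proof -
    have "0 \<le> \<Lambda> q / ln (real d)" using \<Lambda>_nonneg ln_d_pos by (intro divide_nonneg_nonneg) auto
    then have s: "s > 0" using that by linarith
    have "\<Lambda> q < s * ln (real d)" using that ln_d_pos by (simp only: pos_divide_less_eq)
    then show ?thesis using hnull_imp_hausdorff_measure_0[OF s upper_bound[OF s]] s by simp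
  qed
  show "hausdorff_dim E \<le> (INF q. ereal (\<Lambda> q / ln (real d)))"
    unfolding dim
  proof (rule INF_greatest)
    fix q
    have "Inf ?T \<le> \<Lambda> q / ln (real d)"
    proof (rule dense_ge)
      fix s assume "\<Lambda> q / ln (real d) < s"
      from cInf_lower[OF inT[OF this] bdd] show "Inf ?T \<le> s" .
    qed
    then show "ereal (Inf ?T) \<le> ereal (\<Lambda> q / ln (real d))" by (rule ereal_less_eq(3)[THEN iffD2])
  qed
  show "(INF q. ereal (\<Lambda> q / ln (real d))) \<le> hausdorff_dim E"
  proof (rule ccontr)
    assume "\<not> (INF q. ereal (\<Lambda> q / ln (real d))) \<le> hausdorff_dim E"
    then have "ereal (Inf ?T) < (INF q. ereal (\<Lambda> q / ln (real d)))" by (simp add: dim)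
    from ereal_dense2[OF this] obtain s
      where s: "Inf ?T < s" "ereal s < (INF q. ereal (\<Lambda> q / ln (real d)))" by auto
    from ereal_dense2[OF s(2)] obtain c
      where c: "s < c" "ereal c < (INF q. ereal (\<Lambda> q / ln (real d)))" by auto
    have cq: "c * ln (real d) < \<Lambda> q" for q
    proof -
      have "ereal c < ereal (\<Lambda> q / ln (real d))" using c(2) INF_lower[of q UNIV] by (rule less_le_trans) auto
      then show ?thesis using ln_d_pos by (simp add: pos_less_divide_eq)
    qed
    have "?T \<noteq> {}" using inT[of 0 "\<Lambda> 0 / ln (real d) + 1"] by auto
    from cInf_lessD[OF this s(1)] obtain s' where s': "s' \<in> ?T" "s' < s" by auto
    have "s * ln (real d) < c * ln (real d)" using c(1) ln_d_pos by (intro mult_strict_right_mono)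
    then have "s = 0" using lower_bound(2)[of s "c * ln (real d)" s'] s' cq by auto
    then show False using s' by simp
  qed
qed

end

section \<open>The barrier condition at the extreme words, and the conclusion\<close>

lemma piinf_eq:
  assumes "d \<ge> 2"
  shows "piinf d (\<lambda>j. if j = 0 then b else c) = (real b + real c / (real d - 1)) / real d"
proof -
  have "(\<lambda>j. (1 / real d) ^ j) sums (1 / (1 - 1 / real d))"
    using assms by (intro geometric_sums) auto
  from sums_mult[OF this, of "real c / real d"]
  have 1: "(\<lambda>j. real c / real d ^ Suc j) sums (real c / (real d - 1))"
    using assms by (simp add: power_divide field_simps)
  have "(\<lambda>j. if j = 0 then (real b - real c) / real d else 0) sums ((real b - real c) / real d)"
    using sums_single[of 0 "\<lambda>j. (real b - real c) / real d"] by simp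
  from sums_add[OF 1 this]
  have "(\<lambda>j. real (if j = 0 then b else c) / real d ^ Suc j) sums (real c / (real d - 1) + (real b - real c) / real d)"
    by (rule sums_cong[THEN iffD1, rotated]) (auto simp: diff_divide_distrib)
  then have "piinf d (\<lambda>j. if j = 0 then b else c) = real c / (real d - 1) + (real b - real c) / real d"
    unfolding piinf_def by (rule sums_unique[symmetric])
  then show ?thesis using assms by (simp add: field_simps)
qed

lemma barrier_digit_bounds:
  assumes "d \<ge> 2" "barrier_digit d m b"
  shows "(int d - 1) * int b + int m < int d * (int d - 1)"
    and "int m * int d < (int b + int d) * (int d - 1)"
proof -
  have b: "b \<le> m" and w: "\<And>\<omega>. (\<forall>j. \<omega> j \<le> m) \<Longrightarrow> \<omega> 0 = b \<Longrightarrow> piinf d \<omega> - 1 < 0 \<and> xi d m < piinf d \<omega> + 1"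
    using assms(2) by (auto simp: barrier_digit_def)
  have "(real b + real m / (real d - 1)) / real d < 1"
    using w[of "\<lambda>j. if j = 0 then b else m"] b piinf_eq[OF assms(1), of b m] by simp
  then have "(real d - 1) * real b + real m < real d * (real d - 1)"
    using assms(1) by (simp add: field_simps)
  then have "real_of_int ((int d - 1) * int b + int m) < real_of_int (int d * (int d - 1))" by simp
  then show "(int d - 1) * int b + int m < int d * (int d - 1)" by (simp only: of_int_less_iff)
  have "real m / (real d - 1) < (real b + real 0 / (real d - 1)) / real d + 1"
    using w[of "\<lambda>j. if j = 0 then b else 0"] b piinf_eq[OF assms(1), of b 0] by (simp add: xi_def)
  then have "real m * real d < (real b + real d) * (real d - 1)"
    using assms(1) by (simp add: field_simps)
  then have "real_of_int (int m * int d) < real_of_int ((int b + int d) * (int d - 1))" by simp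
  then show "int m * int d < (int b + int d) * (int d - 1)" by (simp only: of_int_less_iff)
qed

theorem theorem5:
  fixes d m :: nat and p :: "nat \<Rightarrow> real" and \<mu> :: "real measure"
    and \<Xi> :: "nat \<Rightarrow> nat list set" and b :: nat and \<alpha> :: real
  assumes d: "d \<ge> 3" and md: "m \<ge> d"
    and ppos: "\<forall>i\<le>m. p i > 0" and psum: "(\<Sum>i\<le>m. p i) = 1"
    and preg: "p 0 \<le> p m" "\<forall>i\<in>{1..m-1}. p m \<le> p i"
    and \<mu>_sets: "sets \<mu> = sets borel" and \<mu>_prob: "emeasure \<mu> (space \<mu>) = 1"
    and \<mu>_cpt: "\<exists>K. compact K \<and> emeasure \<mu> K = 1"
    and \<mu>_ss: "\<forall>A\<in>sets borel. emeasure \<mu> A =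
        (\<Sum>i\<le>m. ennreal (p i) * emeasure \<mu> ((\<lambda>x. real d * x - real i) ` A))"
    and \<Xi>: "representatives d m \<Xi>"
    and b: "barrier_digit d m b"
    and \<alpha>: "alpha_low d m p < ereal \<alpha>" "ereal \<alpha> < alpha_star d m p"
  shows "hausdorff_dim {x \<in> msupport \<mu>. has_local_dim \<mu> x \<alpha>}
         = (INF q. ereal (q * \<alpha> - tau_hat d m p \<Xi> b q))"
proof -
  have d2: "d \<ge> 2" using d by simp
  interpret B: barrier_system d m b p
    by unfold_locales (use d md ppos psum barrier_digit_bounds[OF d2 b] in auto)
  interpret barrier_multifractal d m b p \<alpha> \<mu>
    by unfold_locales (use B.exists_large[OF \<alpha>(1)] B.exists_small[OF \<alpha>(2)] \<mu>_sets \<mu>_prob \<mu>_cpt \<mu>_ss in auto)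
  have "q * \<alpha> - tau_hat d m p \<Xi> b q = \<Lambda> q / ln (real d)" for q
    using B.ln_d_pos unfolding B.tau_hat_P[OF \<Xi>] \<Lambda>_def by (simp add: field_simps)
  then show ?thesis using hausdorff_dim_E unfolding E_def by simp
qed

end
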